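(* Let $\mathcal{S}$ be any one of the following subsets of $\mathcal{M}$: $\mathcal{X}(u,v,w)$ for some $(u,v,w)\in\{0,1,2\}^3$, or $\mathcal{I}(\mathcal{D})$ for some dimensional function $\mathcal{D}$, or $\mathcal{CA}$. Then for all $(X,d),(Y,e)\in\mathcal{S}$ satisfying $d_{GH}((X,d),(Y,e))>0$, the set of geodesics in $(\mathcal{M},d_{GH})$ from $(X,d)$ to $(Y,e)$ passing through $\mathcal{S}$ (i.e. whose image is contained in $\mathcal{S}$) has cardinality exactly the continuum $2^{\aleph_0}$.
   Context: $\mathcal{M}$ is the set of all isometry classes of non-empty compact metric spaces, equipped with the Gromov--Hausdorff distance $d_{GH}$. $B(x,r)$ denotes the closed ball and $\delta_d(X)$ the diameter. A metric space $(X,d)$ is $N$-doubling ($N\in\mathbb{N}$) if for all $x\in X$, $r\in(0,\infty)$ there is $F\subset X$ with $B(x,r)\subset\bigcup_{y\in F}B(y,r/2)$ and $\mathrm{Card}(F)\le N$; it is doubling if it is $N$-doubling for some $N$. It is $\delta$-uniformly disconnected ($\delta\in(0,\infty)$) if for every non-constant finite sequence $\{z_i\}_{i=1}^N$ in $X$ we have $\delta d(z_1,z_N)\le\max_{1\le i\le N-1}d(z_i,z_{i+1})$; it is uniformly disconnected if this holds for some $\delta\in(0,\infty)$. It is $c$-uniformly perfect ($c\in(0,1)$) if for every $x\in X$ and every $r\in(0,\delta_d(X))$ there is $y\in X$ with $c\cdot r\le d(x,y)\le r$; it is uniformly perfect if this holds for some $c\in(0,1)$. Let $\mathcal{Q}_1,\mathcal{Q}_2,\mathcal{Q}_3\subset\mathcal{M}$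 be the sets of all doubling, all uniformly disconnected, and all uniformly perfect spaces, respectively. For $k\in\{1,2,3\}$ put $\mathcal{E}_k(0)=\mathcal{M}\setminus\mathcal{Q}_k$, $\mathcal{E}_k(1)=\mathcal{Q}_k$, $\mathcal{E}_k(2)=\mathcal{M}$, and $\mathcal{X}(u,v,w)=\mathcal{E}_1(u)\cap\mathcal{E}_2(v)\cap\mathcal{E}_3(w)$. A map $\mathcal{D}:\mathcal{M}\to[0,\infty]$ is a dimensional function if (i) for every $(X,d)\in\mathcal{M}$ and every (non-empty) closed subset $A$ of $X$ we have $\mathcal{D}(A,d)\le\mathcal{D}(X,d)$, and (ii) for all $\epsilon\in(0,\infty)$ there is a compact metric space $(Y,e)$ with $\mathcal{D}(Y,e)=\infty$ and $\delta_e(Y)\le\epsilon$. Put $\mathcal{I}(\mathcal{D})=\{(X,d)\in\mathcal{M}:\mathcal{D}(X,d)=\infty\}$. $\mathcal{CA}\subset\mathcal{M}$ is the set of all compact metric spaces homeomorphic to the Cantor set. In a metric space $(S,\rho)$, a geodesic from $x$ to $y$ is a continuous map $\gamma:[0,1]\to S$ with $\gamma(0)=x$, $\gamma(1)=y$ and $\rho(\gamma(s),\gamma(t))=|s-t|\cdot\rho(x,y)$ for all $s,t\in[0,1]$. *)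

theory Defs
  imports "HOL-Analysis.Analysis"
begin

definition compact_metric :: "'a metric \<Rightarrow> bool"
  where "compact_metric m \<longleftrightarrow> mspace m \<noteq> {} \<and> compact_space (mtopology_of m)"

definition isometric_embedding :: "'a metric \<Rightarrow> 'b metric \<Rightarrow> ('a \<Rightarrow> 'b) \<Rightarrow> bool"
  where "isometric_embedding m n f \<longleftrightarrow>
    f \<in> mspace m \<rightarrow> mspace n \<and> (\<forall>x\<in>mspace m. \<forall>y\<in>mspace m. mdist n (f x) (f y) = mdist m x y)"

definition isometric :: "'a metric \<Rightarrow> 'b metric \<Rightarrow> bool"
  where "isometric m n \<longleftrightarrow> (\<exists>f. isometric_embedding m n f \<and> f ` mspace m = mspace n)"

definition hausdorff_dist :: "'a metric \<Rightarrow> 'a set \<Rightarrow> 'a set \<Rightarrow> real"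
  where "hausdorff_dist m A B =
    max (SUP a\<in>A. INF b\<in>B. mdist m a b) (SUP b\<in>B. INF a\<in>A. mdist m a b)"

text \<open>
  The infimum over all ambient metric spaces. A common ambient space of two compact metric spaces
  can be cut down to the union of the two images, which has at most continuum many points, so
  ambient spaces carried by reals suffice; \<open>GH_dist_le_hausdorff_dist\<close> below shows that ambient
  spaces over any other type give nothing smaller.
\<close>

definition GH_dist :: "real metric \<Rightarrow> real metric \<Rightarrow> real"
  where "GH_dist m n = Inf {hausdorff_dist Z (f ` mspace m) (g ` mspace n) | (Z :: real metric) f g.
    isometric_embedding m Z f \<and> isometric_embedding n Z g}"

lemma isometric_refl: "isometric m m"
  unfolding isometric_def isometric_embedding_def by (rule exI[of _ id]) auto

lemma isometric_sym:
  assumes "isometric m n" shows "isometric n m"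
proof -
  obtain f where f: "f \<in> mspace m \<rightarrow> mspace n" "f ` mspace m = mspace n"
      "\<And>x y. x \<in> mspace m \<Longrightarrow> y \<in> mspace m \<Longrightarrow> mdist n (f x) (f y) = mdist m x y"
    using assms by (auto simp: isometric_def isometric_embedding_def)
  have "inj_on f (mspace m)"
    by (rule inj_onI) (metis f(3) mdist_zero)
  then have "bij_betw f (mspace m) (mspace n)"
    by (simp add: bij_betw_def f(2))
  then obtain g where g: "\<And>x. x \<in> mspace m \<Longrightarrow> g (f x) = x" "\<And>y. y \<in> mspace n \<Longrightarrow> f (g y) = y"
      "bij_betw g (mspace n) (mspace m)"
    by (metis bij_betw_inv_into bij_betw_inv_into_left bij_betw_inv_into_right)
  have "g \<in> mspace n \<rightarrow> mspace m" "g ` mspace n = mspace m"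
    using g(3) by (auto simp: bij_betw_def)
  moreover have "mdist m (g x) (g y) = mdist n x y" if "x \<in> mspace n" "y \<in> mspace n" for x y
    using that by (metis PiE calculation(1) f(3) g(2))
  ultimately show ?thesis
    unfolding isometric_def isometric_embedding_def by blast
qed

lemma isometric_trans:
  assumes "isometric m n" "isometric n p" shows "isometric m p"
proof -
  obtain f g where "isometric_embedding m n f" "f ` mspace m = mspace n"
      "isometric_embedding n p g" "g ` mspace n = mspace p"
    using assms by (auto simp: isometric_def)
  then have "isometric_embedding m p (g \<circ> f)" "(g \<circ> f) ` mspace m = mspace p"
    unfolding image_comp[symmetric] by (auto simp: isometric_embedding_def Pi_iff)
  then show ?thesis unfolding isometric_def by blast
qed

text \<open>
  The set of all isometry classes of non-empty compact metric spaces. Every compact metric space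
  has at most continuum many points and hence an isometric copy whose points are reals
  (\<open>compact_metric_isometric_real\<close> below), so it is enough to take classes of metric spaces
  carried by sets of reals.
\<close>

quotient_type gh_space = "real metric" / partial:
  "\<lambda>m n. compact_metric m \<and> compact_metric n \<and> isometric m n"
proof (rule part_equivpI)
  have "compact_metric (metric ({0::real}, dist))"
  proof -
    have "Metric_space {0::real} dist"
      by (meson Met_TC.subspace subset_UNIV)
    then have "mspace (metric ({0::real}, dist)) = {0}"
      by (simp add: Metric_space.mspace_metric)
    then show ?thesis
      unfolding compact_metric_def compact_space_def
      by (simp add: finite_imp_compactin)
  qed
  then show "\<exists>m :: real metric. compact_metric m \<and> compact_metric m \<and> isometric m m"
    using isometric_refl by blast
qed (auto intro!: sympI transpI intro: isometric_sym isometric_trans)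

lemma compact_metric_bounded:
  assumes "compact_metric m"
  obtains B where "B > 0" "\<And>x y. x \<in> mspace m \<Longrightarrow> y \<in> mspace m \<Longrightarrow> mdist m x y \<le> B"
proof -
  interpret M: Metric_space "mspace m" "mdist m" by simp
  have "compactin M.mtopology (mspace m)"
    using assms by (simp add: compact_metric_def mtopology_of_def compact_space_def)
  then have "M.mbounded (mspace m)" by (rule M.compactin_imp_mbounded)
  then show ?thesis using that by (auto simp: M.mbounded_alt_pos)
qed

lemma hausdorff_dist_less:
  assumes B: "\<And>a b. a \<in> S \<union> T \<Longrightarrow> b \<in> S \<union> T \<Longrightarrow> mdist m a b \<le> B"
    and ne: "S \<noteq> {}" "T \<noteq> {}" and r: "hausdorff_dist m S T < r"
  shows "\<forall>a\<in>S. \<exists>b\<in>T. mdist m a b < r" "\<forall>b\<in>T. \<exists>a\<in>S. mdist m a b < r"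
proof -
  have bdb: "bdd_below (h ` U)" if "\<And>x. h x \<ge> 0" for h :: "'a \<Rightarrow> real" and U
    using that by (intro bdd_belowI2[of _ 0]) auto
  obtain s t where st: "s \<in> S" "t \<in> T" using ne by auto
  have 1: "bdd_above ((\<lambda>a. INF b\<in>T. mdist m a b) ` S)"
  proof (rule bdd_aboveI2)
    fix a assume "a \<in> S"
    then show "(INF b\<in>T. mdist m a b) \<le> B"
      using st by (intro cINF_lower2[OF bdb _ B]) auto
  qed
  have 2: "bdd_above ((\<lambda>b. INF a\<in>S. mdist m a b) ` T)"
  proof (rule bdd_aboveI2)
    fix b assume "b \<in> T"
    then show "(INF a\<in>S. mdist m a b) \<le> B"
      using st by (intro cINF_lower2[OF bdb _ B]) auto
  qed
  show "\<forall>a\<in>S. \<exists>b\<in>T. mdist m a b < r"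
  proof
    fix a assume "a \<in> S"
    then have "(INF b\<in>T. mdist m a b) < r"
      using cSUP_upper[OF _ 1] r unfolding hausdorff_dist_def by fastforce
    then show "\<exists>b\<in>T. mdist m a b < r"
      by (subst (asm) cINF_less_iff) (use ne bdb in auto)
  qed
  show "\<forall>b\<in>T. \<exists>a\<in>S. mdist m a b < r"
  proof
    fix b assume "b \<in> T"
    then have "(INF a\<in>S. mdist m a b) < r"
      using cSUP_upper[OF _ 2] r unfolding hausdorff_dist_def by fastforce
    then show "\<exists>a\<in>S. mdist m a b < r"
      by (subst (asm) cINF_less_iff) (use ne bdb in auto)
  qed
qed

lemma hausdorff_dist_le:
  assumes ne: "S \<noteq> {}" "T \<noteq> {}"
    and "\<And>a. a \<in> S \<Longrightarrow> \<exists>b\<in>T. mdist m a b \<le> r" "\<And>b. b \<in> T \<Longrightarrow> \<exists>a\<in>S. mdist m a b \<le> r"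
  shows "hausdorff_dist m S T \<le> r"
proof -
  have bdb: "bdd_below (h ` U)" if "\<And>x. h x \<ge> 0" for h :: "'a \<Rightarrow> real" and U
    using that by (intro bdd_belowI2[of _ 0]) auto
  have "(SUP a\<in>S. INF b\<in>T. mdist m a b) \<le> r"
    using assms by (intro cSUP_least) (auto intro!: cINF_lower2[OF bdb] dest!: assms(3))
  moreover have "(SUP b\<in>T. INF a\<in>S. mdist m a b) \<le> r"
    using assms by (intro cSUP_least) (auto intro!: cINF_lower2[OF bdb] dest!: assms(4))
  ultimately show ?thesis by (simp add: hausdorff_dist_def)
qed

text \<open>
  The facts up to the class instance show that the Gromov--Hausdorff distance is a metric on the
  isometry classes. A coupling is the restriction to \<open>m \<times> n\<close> of a pseudometric on the disjoint union
  that extends both metrics.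
\<close>

definition coupling :: "'a metric \<Rightarrow> 'b metric \<Rightarrow> ('a \<Rightarrow> 'b \<Rightarrow> real) \<Rightarrow> bool"
  where "coupling m n c \<longleftrightarrow>
    (\<forall>x\<in>mspace m. \<forall>y\<in>mspace n. 0 \<le> c x y) \<and>
    (\<forall>x\<in>mspace m. \<forall>x'\<in>mspace m. \<forall>y\<in>mspace n.
       c x y \<le> mdist m x x' + c x' y \<and> mdist m x x' \<le> c x y + c x' y) \<and>
    (\<forall>x\<in>mspace m. \<forall>y\<in>mspace n. \<forall>y'\<in>mspace n.
       c x y \<le> c x y' + mdist n y y' \<and> mdist n y y' \<le> c x y + c x y')"

definition near :: "'a metric \<Rightarrow> 'b metric \<Rightarrow> ('a \<Rightarrow> 'b \<Rightarrow> real) \<Rightarrow> real \<Rightarrow> bool"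
  where "near m n c r \<longleftrightarrow> (\<forall>x\<in>mspace m. \<exists>y\<in>mspace n. c x y < r) \<and> (\<forall>y\<in>mspace n. \<exists>x\<in>mspace m. c x y < r)"

lemma coupling_embedding:
  assumes "isometric_embedding m Z f" "isometric_embedding n Z g"
  shows "coupling m n (\<lambda>x y. mdist Z (f x) (g y))"
proof -
  have *: "\<And>x. x \<in> mspace m \<Longrightarrow> f x \<in> mspace Z" "\<And>y. y \<in> mspace n \<Longrightarrow> g y \<in> mspace Z"
    "\<And>x x'. x \<in> mspace m \<Longrightarrow> x' \<in> mspace m \<Longrightarrow> mdist m x x' = mdist Z (f x) (f x')"
    "\<And>x x'. x \<in> mspace n \<Longrightarrow> x' \<in> mspace n \<Longrightarrow> mdist n x x' = mdist Z (g x) (g x')"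
    using assms by (auto simp: isometric_embedding_def Pi_iff)
  show ?thesis
    unfolding coupling_def
    by (simp add: * ) (smt (verit) "*"(1,2) mdist_commute mdist_triangle)
qed

lemma coupling_realise:
  fixes m n :: "real metric"
  assumes c: "coupling m n c" and \<delta>: "\<delta> > 0"
  obtains Z :: "real metric" and f g where "isometric_embedding m Z f" "isometric_embedding n Z g"
    "\<And>x y. x \<in> mspace m \<Longrightarrow> y \<in> mspace n \<Longrightarrow> mdist Z (f x) (g y) = c x y + \<delta>"
proof -
  define S where "S = Inl ` mspace m \<union> Inr ` mspace n"
  define D :: "real + real \<Rightarrow> real + real \<Rightarrow> real" where "D p q = (case p of
      Inl x \<Rightarrow> (case q of Inl x' \<Rightarrow> mdist m x x' | Inr y \<Rightarrow> \<bar>c x y\<bar> + \<delta>)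
    | Inr y \<Rightarrow> (case q of Inl x \<Rightarrow> \<bar>c x y\<bar> + \<delta> | Inr y' \<Rightarrow> mdist n y y'))" for p q
  have c0: "\<And>x y. x \<in> mspace m \<Longrightarrow> y \<in> mspace n \<Longrightarrow> \<bar>c x y\<bar> = c x y"
    using c by (simp add: coupling_def)
  have c1: "\<And>x x' y. x \<in> mspace m \<Longrightarrow> x' \<in> mspace m \<Longrightarrow> y \<in> mspace n \<Longrightarrow>
       c x y \<le> mdist m x x' + c x' y \<and> mdist m x x' \<le> c x y + c x' y"
    and c2: "\<And>x y y'. x \<in> mspace m \<Longrightarrow> y \<in> mspace n \<Longrightarrow> y' \<in> mspace n \<Longrightarrow>
       c x y \<le> c x y' + mdist n y y' \<and> mdist n y y' \<le> c x y + c x y'"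
    using c by (auto simp: coupling_def)
  have MS: "Metric_space S D"
  proof
    show "0 \<le> D p q" for p q
      using \<delta> by (auto simp: D_def split: sum.split)
    show "D p q = D q p" for p q
      by (auto simp: D_def mdist_commute split: sum.split)
    show "D p q = 0 \<longleftrightarrow> p = q" if "p \<in> S" "q \<in> S" for p q
      using that \<delta> by (auto simp: D_def S_def)
    show "D p r \<le> D p q + D q r" if "p \<in> S" "q \<in> S" "r \<in> S" for p q r
      using that \<delta> by (auto simp: D_def S_def c0 mdist_triangle; smt (verit) c1 c2 mdist_commute)
  qed
  have "(UNIV :: (real + real) set) \<lesssim> (UNIV :: real set)"
  proof -
    have "inj (case_sum (\<lambda>x::real. exp x) (\<lambda>x. - exp x))"
    proof (rule injI)
      fix p q assume "case_sum (\<lambda>x::real. exp x) (\<lambda>x. - exp x) p = case_sum (\<lambda>x. exp x) (\<lambda>x. - exp x) q"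
      then show "p = q"
        by (cases p; cases q) (auto, (metis exp_gt_zero neg_less_0_iff_less not_less_iff_gr_or_eq)+)
    qed
    then show ?thesis by (auto simp: lepoll_def)
  qed
  then obtain \<phi> :: "real + real \<Rightarrow> real" where \<phi>: "inj \<phi>"
    by (auto simp: lepoll_def)
  define D' where "D' a b = D (inv \<phi> a) (inv \<phi> b)" for a b
  have "Metric_space (\<phi> ` S) D'"
  proof -
    interpret MS: Metric_space S D by (rule MS)
    show ?thesis
      by unfold_locales (auto simp: D'_def inv_f_f[OF \<phi>] MS.commute MS.triangle)
  qed
  then have Z: "mspace (metric (\<phi> ` S, D')) = \<phi> ` S" "mdist (metric (\<phi> ` S, D')) = D'"
    by (simp_all add: Metric_space.mspace_metric Metric_space.mdist_metric)
  show ?thesis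
  proof
    show "isometric_embedding m (metric (\<phi> ` S, D')) (\<phi> \<circ> Inl)"
      "isometric_embedding n (metric (\<phi> ` S, D')) (\<phi> \<circ> Inr)"
      unfolding isometric_embedding_def Z
      by (auto simp: D'_def inv_f_f[OF \<phi>] D_def S_def)
    show "mdist (metric (\<phi> ` S, D')) ((\<phi> \<circ> Inl) x) ((\<phi> \<circ> Inr) y) = c x y + \<delta>"
      if "x \<in> mspace m" "y \<in> mspace n" for x y
      using that unfolding Z by (auto simp: D'_def inv_f_f[OF \<phi>] D_def c0)
  qed
qed

lemma hausdorff_dist_embedding_less:
  assumes cm: "compact_metric m" and cn: "compact_metric n"
    and e: "isometric_embedding m Z f" "isometric_embedding n Z g"
    and r: "hausdorff_dist Z (f ` mspace m) (g ` mspace n) < r"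
  shows "near m n (\<lambda>x y. mdist Z (f x) (g y)) r"
proof -
  obtain B C where B: "\<And>x y. x \<in> mspace m \<Longrightarrow> y \<in> mspace m \<Longrightarrow> mdist m x y \<le> B"
    and C: "\<And>x y. x \<in> mspace n \<Longrightarrow> y \<in> mspace n \<Longrightarrow> mdist n x y \<le> C"
    using compact_metric_bounded cm cn by metis
  obtain x0 y0 where xy: "x0 \<in> mspace m" "y0 \<in> mspace n"
    using cm cn by (auto simp: compact_metric_def)
  have c: "coupling m n (\<lambda>x y. mdist Z (f x) (g y))" by (rule coupling_embedding[OF e])
  define K where "K = B + mdist Z (f x0) (g y0) + C"
  have 0: "0 \<le> B" "0 \<le> C"
    using B[OF xy(1) xy(1)] C[OF xy(2) xy(2)] by (meson mdist_nonneg order_trans)+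
  have *: "mdist Z (f x) (g y) \<le> K" if "x \<in> mspace m" "y \<in> mspace n" for x y
  proof -
    have "mdist Z (f x) (g y) \<le> mdist m x x0 + mdist Z (f x0) (g y)"
      "mdist Z (f x0) (g y) \<le> mdist Z (f x0) (g y0) + mdist n y y0"
      using c that xy by (auto simp: coupling_def)
    then show ?thesis using B[OF that(1) xy(1)] C[OF that(2) xy(2)] by (simp add: K_def)
  qed
  have "mdist Z a b \<le> K" if "a \<in> f ` mspace m \<union> g ` mspace n" "b \<in> f ` mspace m \<union> g ` mspace n" for a b
    using that
  proof (elim UnE imageE)
    fix x y assume "a = f x" "b = f y" "x \<in> mspace m" "y \<in> mspace m"
    then have "mdist Z a b \<le> B" using B e by (auto simp: isometric_embedding_def)
    then show ?thesis using 0 unfolding K_def by (smt (verit) mdist_nonneg)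
  next
    fix x y assume "a = g x" "b = g y" "x \<in> mspace n" "y \<in> mspace n"
    then have "mdist Z a b \<le> C" using C e by (auto simp: isometric_embedding_def)
    then show ?thesis using 0 unfolding K_def by (smt (verit) mdist_nonneg)
  qed (use * in \<open>auto simp: mdist_commute\<close>)
  from hausdorff_dist_less[OF this _ _ r] xy show ?thesis
    unfolding near_def by blast
qed

lemma hausdorff_dist_nonneg:
  assumes cm: "compact_metric m" and cn: "compact_metric n"
    and e: "isometric_embedding m Z f" "isometric_embedding n Z g"
  shows "0 \<le> hausdorff_dist Z (f ` mspace m) (g ` mspace n)"
proof (rule ccontr)
  assume "\<not> ?thesis"
  then have "near m n (\<lambda>x y. mdist Z (f x) (g y)) 0"
    by (intro hausdorff_dist_embedding_less[OF assms]) auto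
  then show False using cm unfolding near_def compact_metric_def
    by (metis ex_in_conv linorder_not_le mdist_nonneg)
qed

lemma GH_dist_bdd:
  assumes "compact_metric m" "compact_metric n"
  shows "bdd_below {hausdorff_dist Z (f ` mspace m) (g ` mspace n) | (Z :: real metric) f g.
    isometric_embedding m Z f \<and> isometric_embedding n Z g}"
  using hausdorff_dist_nonneg[OF assms] by (intro bdd_belowI[of _ 0]) auto

lemma GH_dist_le:
  assumes m: "compact_metric m" and n: "compact_metric n" and c: "coupling m n c" "near m n c r"
  shows "GH_dist m n \<le> r"
proof (rule field_le_epsilon)
  fix \<delta> :: real assume "\<delta> > 0"
  then obtain Z :: "real metric" and f g where Z: "isometric_embedding m Z f" "isometric_embedding n Z g"
    "\<And>x y. x \<in> mspace m \<Longrightarrow> y \<in> mspace n \<Longrightarrow> mdist Z (f x) (g y) = c x y + \<delta>"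
    using coupling_realise[OF c(1)] by metis
  have "hausdorff_dist Z (f ` mspace m) (g ` mspace n) \<le> r + \<delta>"
  proof (rule hausdorff_dist_le)
    show "f ` mspace m \<noteq> {}" "g ` mspace n \<noteq> {}"
      using m n by (auto simp: compact_metric_def)
    show "\<exists>b\<in>g ` mspace n. mdist Z a b \<le> r + \<delta>" if a: "a \<in> f ` mspace m" for a
    proof -
      obtain x where x: "x \<in> mspace m" "a = f x" using a by auto
      then obtain y where "y \<in> mspace n" "c x y < r" using c(2) by (auto simp: near_def)
      then show ?thesis using x Z(3) by (intro bexI[of _ "g y"]) auto
    qed
    show "\<exists>a\<in>f ` mspace m. mdist Z a b \<le> r + \<delta>" if b: "b \<in> g ` mspace n" for b
    proof -
      obtain y where y: "y \<in> mspace n" "b = g y" using b by auto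
      then obtain x where "x \<in> mspace m" "c x y < r" using c(2) by (auto simp: near_def)
      then show ?thesis using y Z(3) by (intro bexI[of _ "f x"]) auto
    qed
  qed
  then show "GH_dist m n \<le> r + \<delta>"
    unfolding GH_dist_def using Z by (intro cInf_lower2[OF _ _ GH_dist_bdd[OF m n]]) auto
qed

lemma GH_dist_nonempty:
  assumes m: "compact_metric (m :: real metric)" and n: "compact_metric (n :: real metric)"
  shows "\<exists>(Z :: real metric) f g. isometric_embedding m Z f \<and> isometric_embedding n Z g"
proof -
  obtain B C where B: "B > 0" "\<And>x y. x \<in> mspace m \<Longrightarrow> y \<in> mspace m \<Longrightarrow> mdist m x y \<le> B"
    and C: "C > 0" "\<And>x y. x \<in> mspace n \<Longrightarrow> y \<in> mspace n \<Longrightarrow> mdist n x y \<le> C"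
    using compact_metric_bounded m n by metis
  have "coupling m n (\<lambda>x y. B + C)"
    using B C by (fastforce simp: coupling_def)
  then show ?thesis
    using coupling_realise[OF _ zero_less_one] by metis
qed

lemma GH_dist_nonneg:
  assumes m: "compact_metric m" and n: "compact_metric n"
  shows "0 \<le> GH_dist m n"
  unfolding GH_dist_def using GH_dist_nonempty[OF assms]
  by (intro cInf_greatest) (auto intro: hausdorff_dist_nonneg[OF assms])

lemma GH_dist_lessD:
  assumes m: "compact_metric m" and n: "compact_metric n" and r: "GH_dist m n < r"
  obtains c where "coupling m n c" "near m n c r"
proof -
  have "\<exists>h\<in>{hausdorff_dist Z (f ` mspace m) (g ` mspace n) | (Z :: real metric) f g.
    isometric_embedding m Z f \<and> isometric_embedding n Z g}. h < r"
    using r unfolding GH_dist_def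
    by (subst (asm) cInf_less_iff[OF _ GH_dist_bdd[OF m n]]) (use GH_dist_nonempty[OF m n] in auto)
  then show ?thesis
    using that coupling_embedding hausdorff_dist_embedding_less[OF m n] by blast
qed

lemma GH_dist_sym_le:
  assumes m: "compact_metric m" and n: "compact_metric n"
  shows "GH_dist m n \<le> GH_dist n m"
proof (rule field_le_epsilon)
  fix e :: real assume "e > 0"
  then obtain c where c: "coupling n m c" "near n m c (GH_dist n m + e)"
    using GH_dist_lessD[OF n m, of "GH_dist n m + e"] by auto
  have "coupling m n (\<lambda>x y. c y x)"
    using c(1) unfolding coupling_def by (smt (verit))
  moreover have "near m n (\<lambda>x y. c y x) (GH_dist n m + e)"
    using c(2) by (auto simp: near_def)
  ultimately show "GH_dist m n \<le> GH_dist n m + e" by (rule GH_dist_le[OF m n])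
qed

lemma GH_dist_isometric:
  assumes m: "compact_metric m" and n: "compact_metric n" and i: "isometric m n"
  shows "GH_dist m n = 0"
proof -
  obtain f where f: "isometric_embedding m n f" "f ` mspace m = mspace n"
    using i by (auto simp: isometric_def)
  have c: "coupling m n (\<lambda>x y. mdist n (f x) (id y))"
    by (rule coupling_embedding[OF f(1)]) (auto simp: isometric_embedding_def)
  have "GH_dist m n \<le> 0"
  proof (rule field_le_epsilon)
    fix e :: real assume "e > 0"
    then have "near m n (\<lambda>x y. mdist n (f x) (id y)) e"
      using f by (auto simp: near_def isometric_embedding_def Pi_iff)
         (metis (mono_tags, lifting) imageE f(2) mdist_zero image_eqI)+
    then show "GH_dist m n \<le> 0 + e" using GH_dist_le[OF m n c] by simp
  qed
  then show ?thesis using GH_dist_nonneg[OF m n] by simp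
qed

lemma coupling_compose:
  assumes c1: "coupling m n c1" and c2: "coupling n p c2" and ne: "mspace n \<noteq> {}"
  shows "coupling m p (\<lambda>x z. INF y\<in>mspace n. c1 x y + c2 y z)"
proof -
  let ?c = "\<lambda>x z. INF y\<in>mspace n. c1 x y + c2 y z"
  have lo: "?c x z \<le> c1 x y + c2 y z" if "x \<in> mspace m" "y \<in> mspace n" "z \<in> mspace p" for x y z
    by (rule cINF_lower[OF bdd_belowI2[of _ 0]])
       (use that c1 c2 in \<open>auto simp: coupling_def intro!: add_nonneg_nonneg\<close>)
  have gr: "a \<le> ?c x z" if "\<And>y. y \<in> mspace n \<Longrightarrow> a \<le> c1 x y + c2 y z" for a x z
    using that ne by (intro cINF_greatest) auto
  have gr2: "a \<le> ?c x z + ?c x' z'"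
    if *: "\<And>y y'. y \<in> mspace n \<Longrightarrow> y' \<in> mspace n \<Longrightarrow> a \<le> (c1 x y + c2 y z) + (c1 x' y' + c2 y' z')" for a x z x' z'
  proof -
    have "a - ?c x z \<le> c1 x' y' + c2 y' z'" if "y' \<in> mspace n" for y'
    proof -
      have "a - (c1 x' y' + c2 y' z') \<le> ?c x z"
        by (rule gr) (use *[OF _ that] in \<open>smt (verit)\<close>)
      then show ?thesis by simp
    qed
    then have "a - ?c x z \<le> ?c x' z'" by (rule gr)
    then show ?thesis by simp
  qed
  have C1: "\<And>x y. x \<in> mspace m \<Longrightarrow> y \<in> mspace n \<Longrightarrow> 0 \<le> c1 x y"
    "\<And>x x' y. x \<in> mspace m \<Longrightarrow> x' \<in> mspace m \<Longrightarrow> y \<in> mspace n \<Longrightarrow> c1 x y \<le> mdist m x x' + c1 x' y"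
    "\<And>x x' y. x \<in> mspace m \<Longrightarrow> x' \<in> mspace m \<Longrightarrow> y \<in> mspace n \<Longrightarrow> mdist m x x' \<le> c1 x y + c1 x' y"
    "\<And>x y y'. x \<in> mspace m \<Longrightarrow> y \<in> mspace n \<Longrightarrow> y' \<in> mspace n \<Longrightarrow> c1 x y \<le> c1 x y' + mdist n y y'"
    "\<And>x y y'. x \<in> mspace m \<Longrightarrow> y \<in> mspace n \<Longrightarrow> y' \<in> mspace n \<Longrightarrow> mdist n y y' \<le> c1 x y + c1 x y'"
    using c1 by (auto simp: coupling_def)
  have C2: "\<And>x y. x \<in> mspace n \<Longrightarrow> y \<in> mspace p \<Longrightarrow> 0 \<le> c2 x y"
    "\<And>x x' y. x \<in> mspace n \<Longrightarrow> x' \<in> mspace n \<Longrightarrow> y \<in> mspace p \<Longrightarrow> c2 x y \<le> mdist n x x' + c2 x' y"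
    "\<And>x x' y. x \<in> mspace n \<Longrightarrow> x' \<in> mspace n \<Longrightarrow> y \<in> mspace p \<Longrightarrow> mdist n x x' \<le> c2 x y + c2 x' y"
    "\<And>x y y'. x \<in> mspace n \<Longrightarrow> y \<in> mspace p \<Longrightarrow> y' \<in> mspace p \<Longrightarrow> c2 x y \<le> c2 x y' + mdist p y y'"
    "\<And>x y y'. x \<in> mspace n \<Longrightarrow> y \<in> mspace p \<Longrightarrow> y' \<in> mspace p \<Longrightarrow> mdist p y y' \<le> c2 x y + c2 x y'"
    using c2 by (auto simp: coupling_def)
  show ?thesis
    unfolding coupling_def
  proof (intro conjI ballI)
    fix x z assume x: "x \<in> mspace m" and z: "z \<in> mspace p"
    show "0 \<le> ?c x z"
      by (rule gr) (simp add: C1(1) C2(1) x z)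
    fix x' assume x': "x' \<in> mspace m"
    have "?c x z - mdist m x x' \<le> ?c x' z"
      by (rule gr) (use lo[OF x _ z] C1(2)[OF x x'] in \<open>smt (verit)\<close>)
    then show "?c x z \<le> mdist m x x' + ?c x' z" by simp
    show "mdist m x x' \<le> ?c x z + ?c x' z"
    proof (rule gr2)
      fix y y' assume y: "y \<in> mspace n" "y' \<in> mspace n"
      show "mdist m x x' \<le> c1 x y + c2 y z + (c1 x' y' + c2 y' z)"
        using C1(3)[OF x x' y(1)] C1(4)[OF x' y] C2(3)[OF y z] by simp
    qed
  next
    fix x z z' assume x: "x \<in> mspace m" and z: "z \<in> mspace p" and z': "z' \<in> mspace p"
    have "?c x z - mdist p z z' \<le> ?c x z'"
      by (rule gr) (use lo[OF x _ z] C2(4)[OF _ z z'] in \<open>smt (verit)\<close>)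
    then show "?c x z \<le> ?c x z' + mdist p z z'" by simp
    show "mdist p z z' \<le> ?c x z + ?c x z'"
    proof (rule gr2)
      fix y y' assume y: "y \<in> mspace n" "y' \<in> mspace n"
      show "mdist p z z' \<le> c1 x y + c2 y z + (c1 x y' + c2 y' z')"
        using C1(5)[OF x y] C2(2)[OF y(2) y(1) z] C2(5)[OF y(2) z z'] by (simp add: mdist_commute)
    qed
  qed
qed

lemma GH_dist_triangle:
  assumes m: "compact_metric m" and n: "compact_metric n" and p: "compact_metric p"
  shows "GH_dist m p \<le> GH_dist m n + GH_dist n p"
proof (rule field_le_epsilon)
  fix e :: real assume e: "e > 0"
  obtain c1 where c1: "coupling m n c1" "near m n c1 (GH_dist m n + e/2)"
    using GH_dist_lessD[OF m n, of "GH_dist m n + e/2"] e by auto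
  obtain c2 where c2: "coupling n p c2" "near n p c2 (GH_dist n p + e/2)"
    using GH_dist_lessD[OF n p, of "GH_dist n p + e/2"] e by auto
  let ?c = "\<lambda>x z. INF y\<in>mspace n. c1 x y + c2 y z"
  have c: "coupling m p ?c"
    using n by (intro coupling_compose c1 c2) (auto simp: compact_metric_def)
  have lo: "?c x z \<le> c1 x y + c2 y z" if "x \<in> mspace m" "y \<in> mspace n" "z \<in> mspace p" for x y z
    by (rule cINF_lower[OF bdd_belowI2[of _ 0]])
       (use that c1 c2 in \<open>auto simp: coupling_def intro!: add_nonneg_nonneg\<close>)
  have "near m p ?c (GH_dist m n + GH_dist n p + e)"
    unfolding near_def
  proof (intro conjI ballI)
    fix x assume x: "x \<in> mspace m"
    obtain y where y: "y \<in> mspace n" "c1 x y < GH_dist m n + e/2"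
      using c1 x by (auto simp: near_def)
    obtain z where z: "z \<in> mspace p" "c2 y z < GH_dist n p + e/2"
      using c2 y by (auto simp: near_def)
    show "\<exists>z\<in>mspace p. ?c x z < GH_dist m n + GH_dist n p + e"
      using lo[OF x y(1) z(1)] y z by (intro bexI[of _ z]) auto
  next
    fix z assume z: "z \<in> mspace p"
    obtain y where y: "y \<in> mspace n" "c2 y z < GH_dist n p + e/2"
      using c2 z by (auto simp: near_def)
    obtain x where x: "x \<in> mspace m" "c1 x y < GH_dist m n + e/2"
      using c1 y by (auto simp: near_def)
    show "\<exists>x\<in>mspace m. ?c x z < GH_dist m n + GH_dist n p + e"
      using lo[OF x(1) y(1) z] x y by (intro bexI[of _ x]) auto
  qed
  then show "GH_dist m p \<le> GH_dist m n + GH_dist n p + e"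
    by (rule GH_dist_le[OF m p c])
qed

lemma GH_dist_eq_0_imp:
  assumes m: "compact_metric m" and n: "compact_metric n" and 0: "GH_dist m n = 0"
  shows "isometric m n"
proof -
  define P where "P = prod_topology (product_topology (\<lambda>_. mtopology_of n) (mspace m))
    (product_topology (\<lambda>_. mtopology_of m) (mspace n))"
  have P: "compact_space P"
    using m n by (simp add: P_def compact_metric_def compact_space_prod_topology compact_space_product_topology)
  have top: "topspace P = (mspace m \<rightarrow>\<^sub>E mspace n) \<times> (mspace n \<rightarrow>\<^sub>E mspace m)"
    by (simp add: P_def PiE_def)
  define C where "C k = {h \<in> topspace P. \<forall>x\<in>mspace m. \<forall>y\<in>mspace n.
     \<bar>mdist n (fst h x) y - mdist m x (snd h y)\<bar> \<le> 2 / real (Suc k)}" for k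
  have cl: "closedin P (C k)" for k
  proof -
    have "closedin P {h \<in> topspace P. \<bar>mdist n (fst h x) y - mdist m x (snd h y)\<bar> \<in> {..2 / real (Suc k)}}"
      if "x \<in> mspace m" "y \<in> mspace n" for x y
    proof (rule closedin_continuous_map_preimage)
      have 1: "continuous_map P (mtopology_of n) (\<lambda>h. fst h x)"
        unfolding P_def using that
        by (intro continuous_map_compose[OF continuous_map_fst continuous_map_product_projection, unfolded o_def])
      have 2: "continuous_map P (mtopology_of m) (\<lambda>h. snd h y)"
        unfolding P_def using that
        by (intro continuous_map_compose[OF continuous_map_snd continuous_map_product_projection, unfolded o_def])
      show "continuous_map P euclideanreal (\<lambda>h. \<bar>mdist n (fst h x) y - mdist m x (snd h y)\<bar>)"
        using that 1 2
        by (intro continuous_map_real_abs continuous_map_diff continuous_map_mdist) auto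
    qed auto
    moreover have "C k = \<Inter>((\<lambda>(x, y). {h \<in> topspace P. \<bar>mdist n (fst h x) y - mdist m x (snd h y)\<bar> \<in> {..2 / real (Suc k)}}) ` (mspace m \<times> mspace n))"
      using m n by (auto simp: C_def compact_metric_def)
    ultimately show ?thesis
      using m n by (auto simp: compact_metric_def intro!: closedin_Inter)
  qed
  have ne: "C k \<noteq> {}" for k
  proof -
    obtain c where c: "coupling m n c" "near m n c (1 / real (Suc k))"
      using GH_dist_lessD[OF m n, of "1 / real (Suc k)"] 0 by auto
    obtain f where f: "\<And>x. x \<in> mspace m \<Longrightarrow> f x \<in> mspace n \<and> c x (f x) < 1 / real (Suc k)"
      using c(2) unfolding near_def by metis
    obtain g where g: "\<And>y. y \<in> mspace n \<Longrightarrow> g y \<in> mspace m \<and> c (g y) y < 1 / real (Suc k)"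
      using c(2) unfolding near_def by metis
    have "(restrict f (mspace m), restrict g (mspace n)) \<in> C k"
    proof -
      have "\<bar>mdist n (f x) y - mdist m x (g y)\<bar> \<le> 2 / real (Suc k)"
        if x: "x \<in> mspace m" and y: "y \<in> mspace n" for x y
      proof -
        have "mdist n (f x) y \<le> c x (f x) + c x y" "c x y \<le> mdist m x (g y) + c (g y) y"
          "mdist m x (g y) \<le> c x y + c (g y) y" "c x y \<le> c x (f x) + mdist n y (f x)"
          using c(1) f[OF x] g[OF y] x y mdist_commute[of n y "f x"] unfolding coupling_def by force+
        then have "\<bar>mdist n (f x) y - mdist m x (g y)\<bar> \<le> 1 / real (Suc k) + 1 / real (Suc k)"
          using f[OF x] g[OF y] by (simp add: mdist_commute abs_le_iff del: of_nat_Suc)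
        then show ?thesis by simp
      qed
      then show ?thesis using f g by (auto simp: C_def top simp del: of_nat_Suc)
    qed
    then show ?thesis by auto
  qed
  have "(\<Inter>k. C k) \<noteq> {}"
  proof (rule compact_space_imp_nest[OF P cl ne])
    show "decseq C"
    proof (rule decseq_SucI, rule subsetI)
      fix k h assume "h \<in> C (Suc k)"
      moreover have "2 / real (Suc (Suc k)) \<le> 2 / real (Suc k)"
        by (intro divide_left_mono) auto
      ultimately show "h \<in> C k"
        unfolding C_def by (blast intro: order_trans)
    qed
  qed
  then obtain f g where fg: "\<And>k. (f, g) \<in> C k" by auto
  have f: "f \<in> mspace m \<rightarrow> mspace n" and g: "g \<in> mspace n \<rightarrow> mspace m"
    using fg[of 0] by (auto simp: C_def top)
  have eq: "mdist n (f x) y = mdist m x (g y)" if "x \<in> mspace m" "y \<in> mspace n" for x y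
  proof -
    have "\<bar>mdist n (f x) y - mdist m x (g y)\<bar> \<le> 0"
    proof (rule field_le_epsilon)
      fix e :: real assume "e > 0"
      then obtain k where "2 / real (Suc k) < e"
        using nat_approx_posE[of "e / 2"] by (auto simp: field_simps simp del: of_nat_Suc)
      then show "\<bar>mdist n (f x) y - mdist m x (g y)\<bar> \<le> 0 + e"
        using fg[of k] that unfolding C_def by fastforce
    qed
    then show ?thesis by simp
  qed
  have gf: "g (f x) = x" if "x \<in> mspace m" for x
  proof -
    have a: "f x \<in> mspace n" "g (f x) \<in> mspace m" using f g that by auto
    have "mdist m x (g (f x)) = 0"
      by (rule trans[OF eq[OF that a(1), symmetric]]) (simp add: a)
    then show ?thesis unfolding mdist_zero[OF that a(2)] by (rule sym)
  qed
  have fg: "f (g y) = y" if "y \<in> mspace n" for y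
  proof -
    have a: "g y \<in> mspace m" "f (g y) \<in> mspace n" using f g that by auto
    have "mdist n (f (g y)) y = 0"
      by (rule trans[OF eq[OF a(1) that]]) (simp add: a)
    then show ?thesis unfolding mdist_zero[OF a(2) that] .
  qed
  have "mdist n (f x) (f x') = mdist m x x'" if "x \<in> mspace m" "x' \<in> mspace m" for x x'
    using eq[OF that(1), of "f x'"] f gf that by auto
  moreover have "f ` mspace m = mspace n"
    using f g fg by (force simp: image_iff)
  ultimately show ?thesis
    using f by (auto simp: isometric_def isometric_embedding_def)
qed

lemma rep_gh_space_compact: "compact_metric (rep_gh_space X)"
  using Quotient3_rep_reflp[OF Quotient3_gh_space] by blast

lemma gh_class_eq_iff:
  assumes "compact_metric m" "compact_metric n"
  shows "abs_gh_space m = abs_gh_space n \<longleftrightarrow> isometric m n"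
  using Quotient3_rel[OF Quotient3_gh_space, of m n] assms isometric_refl by blast

lemma rep_abs_gh_space:
  assumes "compact_metric m"
  shows "isometric (rep_gh_space (abs_gh_space m)) m"
  using Quotient3_rep_abs[OF Quotient3_gh_space, of m] assms isometric_refl by blast

instantiation gh_space :: metric_space
begin

definition dist_gh_space :: "gh_space \<Rightarrow> gh_space \<Rightarrow> real"
  where "dist_gh_space X Y = GH_dist (rep_gh_space X) (rep_gh_space Y)"

definition uniformity_gh_space :: "(gh_space \<times> gh_space) filter"
  where "uniformity_gh_space = (INF e\<in>{0<..}. principal {(X, Y). dist X Y < e})"

definition open_gh_space :: "gh_space set \<Rightarrow> bool"
  where "open_gh_space U \<longleftrightarrow> (\<forall>X\<in>U. eventually (\<lambda>(X', Y). X' = X \<longrightarrow> Y \<in> U) uniformity)"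

instance
proof
  fix X Y Z :: gh_space
  show "dist X Y = 0 \<longleftrightarrow> X = Y"
  proof
    assume "dist X Y = 0"
    then have "isometric (rep_gh_space X) (rep_gh_space Y)"
      by (simp add: dist_gh_space_def GH_dist_eq_0_imp rep_gh_space_compact)
    then show "X = Y"
      by (metis Quotient3_abs_rep[OF Quotient3_gh_space] gh_class_eq_iff rep_gh_space_compact)
  qed (simp add: dist_gh_space_def GH_dist_isometric rep_gh_space_compact isometric_refl)
  show "dist X Y \<le> dist X Z + dist Y Z"
    unfolding dist_gh_space_def
    by (meson GH_dist_sym_le GH_dist_triangle add_left_mono order_trans rep_gh_space_compact)
qed (rule uniformity_gh_space_def open_gh_space_def)+

end

lemma dist_abs_gh_space:
  assumes m: "compact_metric m" and n: "compact_metric n"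
  shows "dist (abs_gh_space m) (abs_gh_space n) = GH_dist m n"
proof -
  define m' n' where "m' = rep_gh_space (abs_gh_space m)" and "n' = rep_gh_space (abs_gh_space n)"
  have c: "compact_metric m'" "compact_metric n'"
    by (simp_all add: m'_def n'_def rep_gh_space_compact)
  have i: "isometric m' m" "isometric n' n"
    using m n by (simp_all add: m'_def n'_def rep_abs_gh_space)
  have "GH_dist m' m = 0" "GH_dist n' n = 0" "GH_dist m m' = 0" "GH_dist n n' = 0"
    using i m n c by (auto intro!: GH_dist_isometric intro: isometric_sym)
  moreover have "GH_dist m' n' \<le> GH_dist m' m + GH_dist m n + GH_dist n n'"
    "GH_dist m n \<le> GH_dist m m' + GH_dist m' n' + GH_dist n' n"
    using GH_dist_triangle[OF c(1) m n] GH_dist_triangle[OF c(1) n c(2)]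
      GH_dist_triangle[OF m c(1) c(2)] GH_dist_triangle[OF m c(2) n] by linarith+
  ultimately show ?thesis by (simp add: dist_gh_space_def m'_def n'_def)
qed

lemma GH_dist_le_hausdorff_dist:
  fixes Z :: "'c metric"
  assumes "compact_metric m" "compact_metric n"
    and "isometric_embedding m Z f" "isometric_embedding n Z g"
  shows "GH_dist m n \<le> hausdorff_dist Z (f ` mspace m) (g ` mspace n)"
proof (rule field_le_epsilon)
  fix e :: real assume "e > 0"
  then show "GH_dist m n \<le> hausdorff_dist Z (f ` mspace m) (g ` mspace n) + e"
    using GH_dist_le[OF assms(1,2) coupling_embedding[OF assms(3,4)] hausdorff_dist_embedding_less[OF assms]]
    by simp
qed

lemma compact_metric_isometric_real:
  fixes m :: "'a metric"
  assumes m: "compact_metric m"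
  obtains m' :: "real metric" where "compact_metric m'" "isometric m m'"
proof -
  interpret M: Metric_space "mspace m" "mdist m" by simp
  have "M.mtotally_bounded (mspace m)"
    using m by (simp add: compact_metric_def mtopology_of_def M.compactin_imp_mtotally_bounded compact_space_def)
  then have "\<forall>k. \<exists>K. finite K \<and> K \<subseteq> mspace m \<and> mspace m \<subseteq> (\<Union>x\<in>K. M.mball x (1 / real (Suc k)))"
    unfolding M.mtotally_bounded_def by (simp del: of_nat_Suc)
  then obtain K where K: "\<And>k. finite (K k)" "\<And>k. K k \<subseteq> mspace m"
      "\<And>k. mspace m \<subseteq> (\<Union>x\<in>K k. M.mball x (1 / real (Suc k)))"
    by metis
  define D where "D = (\<Union>k. K k)"
  have D: "countable D" "D \<subseteq> mspace m"
    using K by (auto simp: D_def intro: countable_finite)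
  define h where "h x = {(p, k). p \<in> D \<and> mdist m p x < 1 / real (Suc k)}" for x
  have "inj_on h (mspace m)"
  proof (rule inj_onI, rule ccontr)
    fix x y assume xy: "x \<in> mspace m" "y \<in> mspace m" "h x = h y" "x \<noteq> y"
    then have "mdist m x y / 2 > 0" by (simp add: order_less_le)
    then obtain k where k: "1 / real (Suc k) < mdist m x y / 2" using nat_approx_posE by blast
    obtain p where p: "p \<in> K k" "mdist m p x < 1 / real (Suc k)"
      using K(3)[of k] xy(1) by (auto simp del: of_nat_Suc)
    then have "(p, k) \<in> h x" by (auto simp: h_def D_def)
    then have "mdist m p y < 1 / real (Suc k)" unfolding xy(3) by (simp add: h_def)
    then show False
      using p k K(2)[of k] xy M.triangle[of x p y] M.commute[of p x] by auto
  qed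
  moreover have "h ` mspace m \<subseteq> Pow (D \<times> UNIV)" by (auto simp: h_def)
  ultimately have "mspace m \<lesssim> Pow (D \<times> (UNIV :: nat set))" by (auto simp: lepoll_def)
  moreover have "Pow (D \<times> (UNIV :: nat set)) \<lesssim> (UNIV :: nat set set)"
  proof -
    obtain e :: "'a \<times> nat \<Rightarrow> nat" where "inj_on e (D \<times> UNIV)"
      using D(1) by (meson countableE countable_SIGMA countableI_type)
    then have "inj_on ((`) e) (Pow (D \<times> UNIV))" by (rule inj_on_image_Pow)
    then show ?thesis by (auto simp: lepoll_def)
  qed
  ultimately have "mspace m \<lesssim> (UNIV :: real set)"
    by (meson lepoll_trans lepoll_trans2 nat_sets_eqpoll_reals)
  then obtain \<phi> :: "'a \<Rightarrow> real" where \<phi>: "inj_on \<phi> (mspace m)" by (auto simp: lepoll_def)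
  define \<psi> where "\<psi> = the_inv_into (mspace m) \<phi>"
  have \<psi>: "\<psi> (\<phi> x) = x" if "x \<in> mspace m" for x
    using the_inv_into_f_f[OF \<phi> that] by (simp add: \<psi>_def)
  define m' where "m' = metric (\<phi> ` mspace m, \<lambda>a b. mdist m (\<psi> a) (\<psi> b))"
  have "Metric_space (\<phi> ` mspace m) (\<lambda>a b. mdist m (\<psi> a) (\<psi> b))"
    by unfold_locales (auto simp: \<psi> M.commute M.triangle)
  then have m': "mspace m' = \<phi> ` mspace m" "mdist m' = (\<lambda>a b. mdist m (\<psi> a) (\<psi> b))"
    by (simp_all add: m'_def Metric_space.mspace_metric Metric_space.mdist_metric)
  have "isometric_embedding m m' \<phi>"
    by (auto simp: isometric_embedding_def m' \<psi>)
  moreover have "compact_metric m'"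
  proof -
    interpret MM: Metric_space12 "mspace m" "mdist m" "mspace m'" "mdist m'"
      by (simp add: Metric_space12_mspace_mdist)
    have "homeomorphic_map M.mtopology MM.M2.mtopology \<phi>"
      by (rule MM.isometry_imp_homeomorphic_map) (auto simp: m' \<psi>)
    then show ?thesis
      using m homeomorphic_compact_space[OF homeomorphic_map_imp_homeomorphic_space]
      by (auto simp: compact_metric_def mtopology_of_def m')
  qed
  ultimately show ?thesis using that m' by (auto simp: isometric_def)
qed

text \<open>Extended-real valued, so that unbounded spaces have infinite diameter.\<close>

definition m_diameter :: "'a metric \<Rightarrow> ennreal"
  where "m_diameter m = (SUP x\<in>mspace m. SUP y\<in>mspace m. ennreal (mdist m x y))"

definition doubling_with :: "'a metric \<Rightarrow> nat \<Rightarrow> bool"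
  where "doubling_with m N \<longleftrightarrow> (\<forall>x\<in>mspace m. \<forall>r>0. \<exists>F\<subseteq>mspace m.
    finite F \<and> card F \<le> N \<and> mcball_of m x r \<subseteq> (\<Union>y\<in>F. mcball_of m y (r / 2)))"

definition doubling :: "'a metric \<Rightarrow> bool"
  where "doubling m \<longleftrightarrow> (\<exists>N. doubling_with m N)"

text \<open>A non-constant sequence has \<open>N \<ge> 2\<close>, so the maximum is over a non-empty set.\<close>

definition uniformly_disconnected_with :: "'a metric \<Rightarrow> real \<Rightarrow> bool"
  where "uniformly_disconnected_with m \<delta> \<longleftrightarrow> (\<forall>(N::nat) z.
    (\<forall>i\<in>{1..N}. z i \<in> mspace m) \<and> (\<exists>i\<in>{1..N}. \<exists>j\<in>{1..N}. z i \<noteq> z j) \<longrightarrow>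
    \<delta> * mdist m (z 1) (z N) \<le> (MAX i\<in>{1..N - 1}. mdist m (z i) (z (i + 1))))"

definition uniformly_disconnected :: "'a metric \<Rightarrow> bool"
  where "uniformly_disconnected m \<longleftrightarrow> (\<exists>\<delta>>0. uniformly_disconnected_with m \<delta>)"

definition uniformly_perfect_with :: "'a metric \<Rightarrow> real \<Rightarrow> bool"
  where "uniformly_perfect_with m c \<longleftrightarrow> (\<forall>x\<in>mspace m. \<forall>r>0. ennreal r < m_diameter m \<longrightarrow>
    (\<exists>y\<in>mspace m. c * r \<le> mdist m x y \<and> mdist m x y \<le> r))"

definition uniformly_perfect :: "'a metric \<Rightarrow> bool"
  where "uniformly_perfect m \<longleftrightarrow> (\<exists>c\<in>{0<..<1}. uniformly_perfect_with m c)"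

definition gh_spaces_with :: "(real metric \<Rightarrow> bool) \<Rightarrow> gh_space set"
  where "gh_spaces_with P = abs_gh_space ` {m. compact_metric m \<and> P m}"

text \<open>The sets \<open>E_k(u)\<close> and \<open>X(u,v,w)\<close>; the indices are meant to be in \<open>{0,1,2}\<close>.\<close>

definition E_set :: "gh_space set \<Rightarrow> nat \<Rightarrow> gh_space set"
  where "E_set Q u = (if u = 0 then - Q else if u = 1 then Q else UNIV)"

definition X_set :: "nat \<Rightarrow> nat \<Rightarrow> nat \<Rightarrow> gh_space set"
  where "X_set u v w = E_set (gh_spaces_with doubling) u
    \<inter> E_set (gh_spaces_with uniformly_disconnected) v
    \<inter> E_set (gh_spaces_with uniformly_perfect) w"

definition dimensional_function :: "(gh_space \<Rightarrow> ennreal) \<Rightarrow> bool"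
  where "dimensional_function D \<longleftrightarrow>
    (\<forall>m A. compact_metric m \<and> closedin (mtopology_of m) A \<and> A \<noteq> {} \<longrightarrow>
       D (abs_gh_space (submetric m A)) \<le> D (abs_gh_space m)) \<and>
    (\<forall>\<epsilon>>0. \<exists>m. compact_metric m \<and> D (abs_gh_space m) = \<infinity> \<and> m_diameter m \<le> ennreal \<epsilon>)"

definition infinite_dimensional :: "(gh_space \<Rightarrow> ennreal) \<Rightarrow> gh_space set"
  where "infinite_dimensional D = {X. D X = \<infinity>}"

text \<open>The middle-thirds set: reals with a ternary expansion using only the digits 0 and 2.\<close>

definition cantor_set :: "real set"
  where "cantor_set = range (\<lambda>b :: nat \<Rightarrow> bool. \<Sum>n. 2 * of_bool (b n) / 3 ^ Suc n)"

definition cantor_spaces :: "gh_space set"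
  where "cantor_spaces = gh_spaces_with (\<lambda>m. mtopology_of m homeomorphic_space top_of_set cantor_set)"

text \<open>
  Maps on \<open>[0,1]\<close> are represented by functions that are undefined outside \<open>[0,1]\<close>, so that
  distinct elements are distinct maps on \<open>[0,1]\<close> and cardinalities are the intended ones.
\<close>

definition geodesics :: "'a::metric_space \<Rightarrow> 'a \<Rightarrow> (real \<Rightarrow> 'a) set"
  where "geodesics x y = {\<gamma> \<in> extensional {0..1}. continuous_on {0..1} \<gamma> \<and> \<gamma> 0 = x \<and> \<gamma> 1 = y \<and>
    (\<forall>s\<in>{0..1}. \<forall>t\<in>{0..1}. dist (\<gamma> s) (\<gamma> t) = \<bar>s - t\<bar> * dist x y)}"

end

theory Submission
  imports Defs
begin

text \<open>
  Let \<open>R \<subseteq> X \<times> Y\<close> be a compact correspondence of distortion \<open>2D\<close>, where \<open>D = d\<^sub>G\<^sub>H(X, Y)\<close>; it exists by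
  compactness. Let \<open>K\<close> be a set with a map onto \<open>R\<close>, written \<open>(p, q)\<close>, and let \<open>\<zeta>\<^sub>t\<close> be pseudometrics on \<open>K\<close>
  that vanish at \<open>t = 0, 1\<close> and are \<open>2D\<close>-Lipschitz in \<open>t\<close>. Since the maximum does not increase
  the Lipschitz constant, the quotients of \<open>K\<close> by
  \<open>\<rho>\<^sub>t = max ((1 - t) d(p, p') + t e(q, q')) \<zeta>\<^sub>t\<close> form a geodesic from \<open>X\<close> to \<open>Y\<close>, and for suitable \<open>K\<close>
  and \<open>\<zeta>\<close> all its interior points have the required property. Scaling a summand of \<open>\<zeta>\<close> by \<open>l \<in> (0, 1]\<close>
  gives continuum many geodesics: a compact space has no isometric copy with a pointwise smaller
  metric on the same points other than itself, because non-contracting self-maps are isometric.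
  Conversely a compact space is determined by the distance matrix of a dense sequence and a
  geodesic by its values at rational times, so there are at most continuum many.
\<close>

section \<open>Quotients of compact pseudometrics\<close>

text \<open>A fixed set K of names for the points of all spaces on the path makes different times
  comparable: any two quotients correspond through K, and at the ends most of K may collapse. For
  the sets X(u, v, w) and for Cantor spaces, \<zeta> is a multiple of one vertical pseudometric, so
  at every interior time the space is bi-Lipschitz to a single base, whose properties are decided
  once. This fails for a dimensional function, whose value may change under any rescaling; that case
  has its own construction, in which infinitely many small spaces are faded in and out. K must
  contain two distinct points over the same point of R, because only there is the distance \<zeta>
  alone and the factor l visible. The factor l may multiply only what the required property
  tolerates: everything vertical in the bi-Lipschitz cases, an additional two-point factor in the
  case of a dimensional function.\<close>

abbreviation gh_points :: "gh_space \<Rightarrow> real set"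
  where "gh_points X \<equiv> mspace (rep_gh_space X)"

abbreviation gh_mdist :: "gh_space \<Rightarrow> real \<Rightarrow> real \<Rightarrow> real"
  where "gh_mdist X \<equiv> mdist (rep_gh_space X)"

definition pseudometric :: "'k set \<Rightarrow> ('k \<Rightarrow> 'k \<Rightarrow> real) \<Rightarrow> bool"
  where "pseudometric K \<rho> \<longleftrightarrow> (\<forall>x\<in>K. \<rho> x x = 0) \<and> (\<forall>x\<in>K. \<forall>y\<in>K. 0 \<le> \<rho> x y \<and> \<rho> x y = \<rho> y x) \<and>
    (\<forall>x\<in>K. \<forall>y\<in>K. \<forall>z\<in>K. \<rho> x z \<le> \<rho> x y + \<rho> y z)"

text \<open>Sequences are used because this form passes to quotients, products and smaller distance
  functions without putting a topology on K.\<close>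

definition sequentially_compact :: "'k set \<Rightarrow> ('k \<Rightarrow> 'k \<Rightarrow> real) \<Rightarrow> bool"
  where "sequentially_compact K \<rho> \<longleftrightarrow> (\<forall>\<sigma> :: nat \<Rightarrow> 'k. range \<sigma> \<subseteq> K \<longrightarrow>
    (\<exists>k\<in>K. \<exists>r :: nat \<Rightarrow> nat. strict_mono r \<and> (\<lambda>i. \<rho> (\<sigma> (r i)) k) \<longlonglongrightarrow> 0))"

definition compact_pseudometric :: "'k set \<Rightarrow> ('k \<Rightarrow> 'k \<Rightarrow> real) \<Rightarrow> bool"
  where "compact_pseudometric K \<rho> \<longleftrightarrow> K \<noteq> {} \<and> pseudometric K \<rho> \<and> sequentially_compact K \<rho>"

definition quotient_map_of :: "'a metric \<Rightarrow> 'k set \<Rightarrow> ('k \<Rightarrow> 'k \<Rightarrow> real) \<Rightarrow> ('k \<Rightarrow> 'a) \<Rightarrow> bool"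
  where "quotient_map_of m K \<rho> \<phi> \<longleftrightarrow> \<phi> ` K = mspace m \<and> (\<forall>x\<in>K. \<forall>y\<in>K. mdist m (\<phi> x) (\<phi> y) = \<rho> x y)"

text \<open>The choice does not matter: all quotients of one pseudometric are isometric
  (\<open>gh_class_eqI\<close>).\<close>

definition gh_class :: "'k set \<Rightarrow> ('k \<Rightarrow> 'k \<Rightarrow> real) \<Rightarrow> gh_space"
  where "gh_class K \<rho> = abs_gh_space (SOME m. compact_metric m \<and> (\<exists>\<phi>. quotient_map_of m K \<rho> \<phi>))"

lemma mdist_self: "x \<in> mspace m \<Longrightarrow> mdist m x x = 0"
  by simp

lemma pseudometricI:
  assumes "\<And>x. x \<in> K \<Longrightarrow> \<rho> x x = 0" "\<And>x y. x \<in> K \<Longrightarrow> y \<in> K \<Longrightarrow> 0 \<le> \<rho> x y"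
    "\<And>x y. x \<in> K \<Longrightarrow> y \<in> K \<Longrightarrow> \<rho> x y = \<rho> y x"
    "\<And>x y z. x \<in> K \<Longrightarrow> y \<in> K \<Longrightarrow> z \<in> K \<Longrightarrow> \<rho> x z \<le> \<rho> x y + \<rho> y z"
  shows "pseudometric K \<rho>"
  using assms unfolding pseudometric_def by blast

lemma pseudometricD:
  assumes "pseudometric K \<rho>"
  shows "x \<in> K \<Longrightarrow> \<rho> x x = 0" "x \<in> K \<Longrightarrow> y \<in> K \<Longrightarrow> 0 \<le> \<rho> x y"
    "x \<in> K \<Longrightarrow> y \<in> K \<Longrightarrow> \<rho> x y = \<rho> y x"
    "x \<in> K \<Longrightarrow> y \<in> K \<Longrightarrow> z \<in> K \<Longrightarrow> \<rho> x z \<le> \<rho> x y + \<rho> y z"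
  using assms unfolding pseudometric_def by blast+

lemma compact_metric_iff_sequentially_compact:
  "compact_metric m \<longleftrightarrow> mspace m \<noteq> {} \<and> sequentially_compact (mspace m) (mdist m)"
proof -
  interpret M: Metric_space "mspace m" "mdist m" by simp
  have "compact_space (mtopology_of m) \<longleftrightarrow> compactin M.mtopology (mspace m)"
    by (simp add: compact_space_def mtopology_of_def)
  also have "\<dots> \<longleftrightarrow> sequentially_compact (mspace m) (mdist m)"
    unfolding M.compactin_sequentially sequentially_compact_def
  proof (intro iffI conjI allI impI; (elim conjE)?)
    fix \<sigma> :: "nat \<Rightarrow> 'a"
    assume *: "range \<sigma> \<subseteq> mspace m" "\<forall>\<sigma> :: nat \<Rightarrow> 'a. range \<sigma> \<subseteq> mspace m \<longrightarrow>
        (\<exists>l r. l \<in> mspace m \<and> strict_mono r \<and> limitin M.mtopology (\<sigma> \<circ> r) l sequentially)"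
    obtain l r where "l \<in> mspace m" "strict_mono r" "limitin M.mtopology (\<sigma> \<circ> r) l sequentially"
      using *(2)[rule_format, OF *(1)] by auto
    then show "\<exists>k\<in>mspace m. \<exists>r. strict_mono r \<and> (\<lambda>i. mdist m (\<sigma> (r i)) k) \<longlonglongrightarrow> 0"
      by (auto simp: M.limitin_metric_dist_null o_def)
  next
    fix \<sigma> :: "nat \<Rightarrow> 'a"
    assume \<sigma>: "range \<sigma> \<subseteq> mspace m" "\<forall>\<sigma> :: nat \<Rightarrow> 'a. range \<sigma> \<subseteq> mspace m \<longrightarrow>
        (\<exists>k\<in>mspace m. \<exists>r. strict_mono r \<and> (\<lambda>i. mdist m (\<sigma> (r i)) k) \<longlonglongrightarrow> 0)"
    obtain k r where "k \<in> mspace m" "strict_mono r" "(\<lambda>i. mdist m (\<sigma> (r i)) k) \<longlonglongrightarrow> 0"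
      using \<sigma>(2)[rule_format, OF \<sigma>(1)] by auto
    then show "\<exists>l r. l \<in> mspace m \<and> strict_mono r \<and> limitin M.mtopology (\<sigma> \<circ> r) l sequentially"
      using \<sigma>(1) by (intro exI[of _ k] exI[of _ r]) (auto simp: M.limitin_metric_dist_null o_def image_subset_iff)
  qed auto
  finally show ?thesis by (simp add: compact_metric_def)
qed

lemma sequentially_compactE:
  assumes "sequentially_compact K \<rho>" "\<And>i::nat. \<sigma> i \<in> K"
  obtains k r where "k \<in> K" "strict_mono (r :: nat \<Rightarrow> nat)" "(\<lambda>i. \<rho> (\<sigma> (r i)) k) \<longlonglongrightarrow> 0"
  using assms unfolding sequentially_compact_def by blast

text \<open>Used in both directions: from K to obtain compact quotients, and from X and Y to see
  that K is compact at times 0 and 1.\<close>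

lemma compact_metric_iff_quotient:
  assumes "quotient_map_of m K \<rho> \<phi>"
  shows "compact_metric m \<longleftrightarrow> K \<noteq> {} \<and> sequentially_compact K \<rho>"
proof -
  have \<phi>: "\<phi> ` K = mspace m" "\<And>x y. x \<in> K \<Longrightarrow> y \<in> K \<Longrightarrow> mdist m (\<phi> x) (\<phi> y) = \<rho> x y"
    using assms by (auto simp: quotient_map_of_def)
  then have \<phi>': "\<And>x. x \<in> K \<Longrightarrow> \<phi> x \<in> mspace m" by auto
  define \<psi> where "\<psi> = inv_into K \<phi>"
  have \<psi>: "\<And>y. y \<in> mspace m \<Longrightarrow> \<psi> y \<in> K \<and> \<phi> (\<psi> y) = y"
    using \<phi>(1) by (auto simp: \<psi>_def f_inv_into_f inv_into_into)
  have "sequentially_compact (mspace m) (mdist m) \<longleftrightarrow> sequentially_compact K \<rho>"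
  proof
    assume c: "sequentially_compact (mspace m) (mdist m)"
    show "sequentially_compact K \<rho>"
      unfolding sequentially_compact_def
    proof (intro allI impI)
      fix \<sigma> :: "nat \<Rightarrow> 'b" assume \<sigma>: "range \<sigma> \<subseteq> K"
      have "\<phi> (\<sigma> i) \<in> mspace m" for i using \<phi>' \<sigma> by auto
      then obtain k r where "k \<in> mspace m" "strict_mono r" "(\<lambda>i. mdist m (\<phi> (\<sigma> (r i))) k) \<longlonglongrightarrow> 0"
        by (rule sequentially_compactE[OF c, of "\<lambda>i. \<phi> (\<sigma> i)"])
      moreover have "mdist m (\<phi> (\<sigma> i)) k = \<rho> (\<sigma> i) (\<psi> k)" if "k \<in> mspace m" for i k
        using \<phi>(2)[of "\<sigma> i" "\<psi> k"] \<sigma> \<psi> that by auto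
      ultimately show "\<exists>k\<in>K. \<exists>r. strict_mono r \<and> (\<lambda>i. \<rho> (\<sigma> (r i)) k) \<longlonglongrightarrow> 0"
        using \<psi> by (intro bexI[of _ "\<psi> k"]) auto
    qed
  next
    assume c: "sequentially_compact K \<rho>"
    show "sequentially_compact (mspace m) (mdist m)"
      unfolding sequentially_compact_def
    proof (intro allI impI)
      fix \<sigma> :: "nat \<Rightarrow> 'a" assume "range \<sigma> \<subseteq> mspace m"
      then have \<sigma>: "\<And>i. \<sigma> i \<in> mspace m" by auto
      have "\<psi> (\<sigma> i) \<in> K" for i using \<psi> \<sigma> by auto
      then obtain k r where "k \<in> K" "strict_mono r" "(\<lambda>i. \<rho> (\<psi> (\<sigma> (r i))) k) \<longlonglongrightarrow> 0"
        by (rule sequentially_compactE[OF c, of "\<lambda>i. \<psi> (\<sigma> i)"])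
      moreover have "\<rho> (\<psi> (\<sigma> i)) k = mdist m (\<sigma> i) (\<phi> k)" if "k \<in> K" for i k
        using \<phi>(2)[of "\<psi> (\<sigma> i)" k] \<sigma> \<psi> that by auto
      ultimately show "\<exists>k\<in>mspace m. \<exists>r. strict_mono r \<and> (\<lambda>i. mdist m (\<sigma> (r i)) k) \<longlonglongrightarrow> 0"
        using \<phi>' by (intro bexI[of _ "\<phi> k"]) auto
    qed
  qed
  moreover have "mspace m \<noteq> {} \<longleftrightarrow> K \<noteq> {}" using \<phi>(1) by auto
  ultimately show ?thesis by (simp add: compact_metric_iff_sequentially_compact)
qed

lemma quotient_map_of_trans:
  assumes "quotient_map_of m K \<rho> \<phi>" "isometric m n"
  shows "\<exists>\<psi>. quotient_map_of n K \<rho> \<psi>"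
proof -
  obtain f where f: "isometric_embedding m n f" "f ` mspace m = mspace n"
    using assms(2) by (auto simp: isometric_def)
  have "quotient_map_of n K \<rho> (f \<circ> \<phi>)"
    using assms(1) f unfolding quotient_map_of_def isometric_embedding_def
    by (metis comp_def image_comp imageI)
  then show ?thesis by blast
qed

text \<open>Going back to K by a section of \<phi> may change a point, but only to one at
  \<rho>-distance 0, which \<psi> cannot tell apart.\<close>

lemma isometric_quotients:
  assumes "quotient_map_of m K \<rho> \<phi>" "quotient_map_of n K \<rho> \<psi>"
  shows "isometric m n"
proof -
  define f where "f x = \<psi> (inv_into K \<phi> x)" for x
  have i: "inv_into K \<phi> x \<in> K" "\<phi> (inv_into K \<phi> x) = x" if "x \<in> mspace m" for x
    using assms(1) that by (auto simp: quotient_map_of_def f_inv_into_f inv_into_into)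
  have d: "mdist n (f x) (f y) = mdist m x y" if "x \<in> mspace m" "y \<in> mspace m" for x y
    using assms i[OF that(1)] i[OF that(2)] unfolding quotient_map_of_def f_def by metis
  have e: "f x \<in> mspace n" if "x \<in> mspace m" for x
    using assms(2) i[OF that] by (auto simp: quotient_map_of_def f_def)
  have "\<exists>x\<in>mspace m. f x = y" if y: "y \<in> mspace n" for y
  proof -
    have "y \<in> \<psi> ` K" using assms(2) y by (simp add: quotient_map_of_def)
    then obtain k where k: "k \<in> K" "\<psi> k = y" by blast
    have \<phi>k: "\<phi> k \<in> mspace m" using assms(1) k by (auto simp: quotient_map_of_def)
    have "mdist n (f (\<phi> k)) y = mdist m (\<phi> (inv_into K \<phi> (\<phi> k))) (\<phi> k)"
      using assms k i[OF \<phi>k] unfolding quotient_map_of_def f_def by metis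
    then have "f (\<phi> k) = y" using i[OF \<phi>k] \<phi>k e y by (simp add: mdist_self)
    then show ?thesis using \<phi>k by blast
  qed
  then show ?thesis
    using d e unfolding isometric_def isometric_embedding_def by (intro exI[of _ f]) auto
qed

lemma quotient_map_of_self: "quotient_map_of m (mspace m) (mdist m) (\<lambda>x. x)"
  by (simp add: quotient_map_of_def)

lemma quotient_exists:
  assumes "compact_pseudometric K \<rho>"
  obtains m :: "real metric" and \<phi> where "compact_metric m" "quotient_map_of m K \<rho> \<phi>"
proof -
  have pm: "pseudometric K \<rho>" and K: "K \<noteq> {}" "sequentially_compact K \<rho>"
    using assms by (auto simp: compact_pseudometric_def)
  \<comment> \<open>One representative per class: the predicate depends only on the class of x, so
    \<pi> is constant on classes.\<close>
  define \<pi> where "\<pi> x = (SOME y. y \<in> K \<and> \<rho> y x = 0)" for x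
  have \<pi>: "\<pi> x \<in> K" "\<rho> (\<pi> x) x = 0" if "x \<in> K" for x
    using someI[of "\<lambda>y. y \<in> K \<and> \<rho> y x = 0" x] that pseudometricD(1)[OF pm that]
    by (auto simp: \<pi>_def)
  have \<pi>d: "\<rho> (\<pi> x) (\<pi> y) = \<rho> x y" if "x \<in> K" "y \<in> K" for x y
    using \<pi>[OF that(1)] \<pi>[OF that(2)] that pseudometricD(3)[OF pm, of x "\<pi> x"] pseudometricD(3)[OF pm, of y "\<pi> y"]
      pseudometricD(4)[OF pm, of "\<pi> x" x "\<pi> y"] pseudometricD(4)[OF pm, of x y "\<pi> y"]
      pseudometricD(4)[OF pm, of x "\<pi> x" y] pseudometricD(4)[OF pm, of "\<pi> x" "\<pi> y" y] by auto
  have \<pi>eq: "\<pi> x = \<pi> y" if "x \<in> K" "y \<in> K" "\<rho> x y = 0" for x y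
  proof -
    have "\<rho> z x = 0 \<longleftrightarrow> \<rho> z y = 0" if "z \<in> K" for z
      using that \<open>x \<in> K\<close> \<open>y \<in> K\<close> \<open>\<rho> x y = 0\<close> pseudometricD(4)[OF pm, of z x y] pseudometricD(4)[OF pm, of z y x]
        pseudometricD(2)[OF pm, of z x] pseudometricD(2)[OF pm, of z y] pseudometricD(3)[OF pm, of x y] by auto
    then show ?thesis unfolding \<pi>_def by metis
  qed
  \<comment> \<open>The value 0 outside K is there because \<open>Metric_space\<close> requires
    symmetry and non-negativity on the whole type.\<close>
  define m where "m = metric (\<pi> ` K, \<lambda>x y. if x \<in> K \<and> y \<in> K then \<rho> x y else 0)"
  have "Metric_space (\<pi> ` K) (\<lambda>x y. if x \<in> K \<and> y \<in> K then \<rho> x y else 0)"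
    by unfold_locales (auto simp: \<pi> \<pi>d pseudometricD[OF pm] intro: \<pi>eq)
  then have m: "mspace m = \<pi> ` K" "mdist m = (\<lambda>x y. if x \<in> K \<and> y \<in> K then \<rho> x y else 0)"
    by (simp_all add: m_def Metric_space.mspace_metric Metric_space.mdist_metric)
  have q: "quotient_map_of m K \<rho> \<pi>"
    by (auto simp: quotient_map_of_def m \<pi> \<pi>d)
  then have "compact_metric m" using K by (simp add: compact_metric_iff_quotient)
  then obtain n :: "real metric" where "compact_metric n" "isometric m n"
    by (rule compact_metric_isometric_real)
  then show thesis using that quotient_map_of_trans[OF q] by blast
qed

lemma gh_class_eqI:
  assumes m: "compact_metric m" "quotient_map_of m K \<rho> \<phi>"
  shows "gh_class K \<rho> = abs_gh_space m"
proof -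
  define n where "n = (SOME m :: real metric. compact_metric m \<and> (\<exists>\<phi>. quotient_map_of m K \<rho> \<phi>))"
  have "compact_metric n \<and> (\<exists>\<phi>. quotient_map_of n K \<rho> \<phi>)"
    unfolding n_def by (rule someI[of _ m]) (use m in blast)
  then have "compact_metric n" "isometric n m" using m(2) isometric_quotients by blast+
  then show ?thesis
    unfolding gh_class_def n_def[symmetric] using m(1) by (simp add: gh_class_eq_iff)
qed

lemma gh_class_rep:
  assumes "quotient_map_of (rep_gh_space X) K \<rho> \<phi>"
  shows "gh_class K \<rho> = X"
  using gh_class_eqI[OF rep_gh_space_compact assms] Quotient3_abs_rep[OF Quotient3_gh_space] by metis

text \<open>The two spaces are joined by bridges of length \<delta> along R. The distortion bound
  says that a detour over two bridges never shortens a distance, so the bridges define a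
  coupling.\<close>

lemma GH_dist_le_distortion:
  assumes m: "compact_metric m" and n: "compact_metric n"
    and R: "R \<subseteq> mspace m \<times> mspace n" "fst ` R = mspace m" "snd ` R = mspace n"
    and dis: "\<And>x y x' y'. (x, y) \<in> R \<Longrightarrow> (x', y') \<in> R \<Longrightarrow> \<bar>mdist m x x' - mdist n y y'\<bar> \<le> 2 * \<delta>"
  shows "GH_dist m n \<le> \<delta>"
proof -
  obtain x0 y0 where R0: "(x0, y0) \<in> R" using R m by (force simp: compact_metric_def)
  then have \<delta>: "0 \<le> \<delta>" using dis[OF R0 R0] by simp
  define c where "c x y = (INF (x', y')\<in>R. mdist m x x' + \<delta> + mdist n y' y)" for x y
  have bdb: "bdd_below ((\<lambda>(x', y'). mdist m x x' + \<delta> + mdist n y' y) ` R)" for x y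
    by (rule bdd_belowI2[of _ 0]) (use \<delta> in \<open>auto simp: mdist_nonneg\<close>)
  have lo: "c x y \<le> mdist m x x' + \<delta> + mdist n y' y" if "(x', y') \<in> R" for x y x' y'
    unfolding c_def using cINF_lower[OF bdb that] by simp
  have gr: "a \<le> c x y" if "\<And>x' y'. (x', y') \<in> R \<Longrightarrow> a \<le> mdist m x x' + \<delta> + mdist n y' y" for a x y
    unfolding c_def using R0 that by (intro cINF_greatest) auto
  have gr2: "a \<le> c x y + c u v"
    if *: "\<And>x' y' u' v'. (x', y') \<in> R \<Longrightarrow> (u', v') \<in> R \<Longrightarrow>
      a \<le> (mdist m x x' + \<delta> + mdist n y' y) + (mdist m u u' + \<delta> + mdist n v' v)" for a x y u v
  proof -
    have "a - c x y \<le> c u v"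
    proof (rule gr)
      fix u' v' assume uv: "(u', v') \<in> R"
      have "a - (mdist m u u' + \<delta> + mdist n v' v) \<le> c x y"
        by (rule gr) (use *[OF _ uv] in \<open>smt (verit)\<close>)
      then show "a - c x y \<le> mdist m u u' + \<delta> + mdist n v' v" by simp
    qed
    then show ?thesis by simp
  qed
  have mem: "x \<in> mspace m" "y \<in> mspace n" if "(x, y) \<in> R" for x y using R that by auto
  have "coupling m n c"
    unfolding coupling_def
  proof (intro conjI ballI)
    fix x y assume x: "x \<in> mspace m" and y: "y \<in> mspace n"
    show "0 \<le> c x y" by (rule gr) (use \<delta> in simp)
    fix x' assume x': "x' \<in> mspace m"
    have "c x y - mdist m x x' \<le> c x' y"
    proof (rule gr)
      fix u v assume uv: "(u, v) \<in> R"
      then show "c x y - mdist m x x' \<le> mdist m x' u + \<delta> + mdist n v y"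
        using lo[OF uv, of x y] mdist_triangle[of x m x' u] x x' mem by fastforce
    qed
    then show "c x y \<le> mdist m x x' + c x' y" by simp
    show "mdist m x x' \<le> c x y + c x' y"
    proof (rule gr2)
      fix u v u' v' assume uv: "(u, v) \<in> R" "(u', v') \<in> R"
      have "mdist m x x' \<le> mdist m x u + mdist m u u' + mdist m x' u'"
        using mdist_triangle[of x m u x'] mdist_triangle[of u m u' x'] x x' mem[OF uv(1)] mem[OF uv(2)]
        by (simp add: mdist_commute)
      moreover have "mdist n v v' \<le> mdist n v y + mdist n v' y"
        using mdist_triangle[of v n y v'] y mem[OF uv(1)] mem[OF uv(2)] by (simp add: mdist_commute)
      ultimately show "mdist m x x' \<le> mdist m x u + \<delta> + mdist n v y + (mdist m x' u' + \<delta> + mdist n v' y)"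
        using dis[OF uv] by linarith
    qed
  next
    fix x y y' assume x: "x \<in> mspace m" and y: "y \<in> mspace n" and y': "y' \<in> mspace n"
    have "c x y - mdist n y y' \<le> c x y'"
    proof (rule gr)
      fix u v assume uv: "(u, v) \<in> R"
      then show "c x y - mdist n y y' \<le> mdist m x u + \<delta> + mdist n v y'"
        using lo[OF uv, of x y] mdist_triangle[of v n y' y] y y' mem[OF uv] by (simp add: mdist_commute)
    qed
    then show "c x y \<le> c x y' + mdist n y y'" by simp
    show "mdist n y y' \<le> c x y + c x y'"
    proof (rule gr2)
      fix u v u' v' assume uv: "(u, v) \<in> R" "(u', v') \<in> R"
      have "mdist n y y' \<le> mdist n v y + mdist n v v' + mdist n v' y'"
        using mdist_triangle[of y n v y'] mdist_triangle[of v n v' y'] y y' mem[OF uv(1)] mem[OF uv(2)]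
        by (simp add: mdist_commute)
      moreover have "mdist m u u' \<le> mdist m x u + mdist m x u'"
        using mdist_triangle[of u m x u'] x mem[OF uv(1)] mem[OF uv(2)] by (simp add: mdist_commute)
      ultimately show "mdist n y y' \<le> mdist m x u + \<delta> + mdist n v y + (mdist m x u' + \<delta> + mdist n v' y')"
        using dis[OF uv] by linarith
    qed
  qed
  moreover have "near m n c (\<delta> + \<epsilon>)" if "\<epsilon> > 0" for \<epsilon>
  proof -
    have cR: "c x y < \<delta> + \<epsilon>" if "(x, y) \<in> R" for x y
      using lo[OF that, of x y] mem[OF that] \<open>\<epsilon> > 0\<close> by (simp add: mdist_self)
    have "\<exists>y\<in>mspace n. (x, y) \<in> R" if "x \<in> mspace m" for x
    proof -
      have "x \<in> fst ` R" using that R(2) by simp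
      then show ?thesis using R(1) by force
    qed
    moreover have "\<exists>x\<in>mspace m. (x, y) \<in> R" if "y \<in> mspace n" for y
    proof -
      have "y \<in> snd ` R" using that R(3) by simp
      then show ?thesis using R(1) by force
    qed
    ultimately show ?thesis
      unfolding near_def using cR by blast
  qed
  ultimately show ?thesis
    using GH_dist_le[OF m n] field_le_epsilon by metis
qed

text \<open>The correspondence pairs the two images of each point of K.\<close>

lemma dist_gh_class_le:
  assumes "compact_pseudometric K \<rho>" "compact_pseudometric K \<rho>'"
    and le: "\<And>x y. x \<in> K \<Longrightarrow> y \<in> K \<Longrightarrow> \<bar>\<rho> x y - \<rho>' x y\<bar> \<le> 2 * \<delta>"
  shows "dist (gh_class K \<rho>) (gh_class K \<rho>') \<le> \<delta>"
proof -
  obtain m :: "real metric" and \<phi> where m: "compact_metric m" "quotient_map_of m K \<rho> \<phi>"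
    using quotient_exists[OF assms(1)] by metis
  obtain n :: "real metric" and \<psi> where n: "compact_metric n" "quotient_map_of n K \<rho>' \<psi>"
    using quotient_exists[OF assms(2)] by metis
  have "GH_dist m n \<le> \<delta>"
  proof (rule GH_dist_le_distortion[OF m(1) n(1), of "(\<lambda>k. (\<phi> k, \<psi> k)) ` K"])
    show "\<bar>mdist m x x' - mdist n y y'\<bar> \<le> 2 * \<delta>"
      if "(x, y) \<in> (\<lambda>k. (\<phi> k, \<psi> k)) ` K" "(x', y') \<in> (\<lambda>k. (\<phi> k, \<psi> k)) ` K" for x y x' y'
      using that m(2) n(2) le unfolding quotient_map_of_def by auto
  qed (use m(2) n(2) in \<open>auto simp: quotient_map_of_def image_image\<close>)
  then show ?thesis
    using m n by (simp add: gh_class_eqI dist_abs_gh_space)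
qed

section \<open>Non-contracting self-maps of compact spaces\<close>

lemma sequentially_compact_Cauchy:
  assumes pm: "pseudometric K \<rho>" and K: "sequentially_compact K \<rho>" and \<sigma>: "\<And>i::nat. \<sigma> i \<in> K"
  obtains r where "strict_mono (r :: nat \<Rightarrow> nat)"
    "\<And>\<epsilon>. \<epsilon> > 0 \<Longrightarrow> \<exists>N. \<forall>i\<ge>N. \<forall>j\<ge>N. \<rho> (\<sigma> (r i)) (\<sigma> (r j)) < \<epsilon>"
proof -
  obtain k r where k: "k \<in> K" "strict_mono (r :: nat \<Rightarrow> nat)" "(\<lambda>i. \<rho> (\<sigma> (r i)) k) \<longlonglongrightarrow> 0"
    using sequentially_compactE[where \<sigma> = \<sigma>, OF K \<sigma>] by blast
  show thesis
  proof (rule that[OF k(2)])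
    fix \<epsilon> :: real assume "\<epsilon> > 0"
    then obtain N where N: "\<And>i. i \<ge> N \<Longrightarrow> \<bar>\<rho> (\<sigma> (r i)) k\<bar> < \<epsilon> / 2"
      using LIMSEQ_D[OF k(3), of "\<epsilon> / 2"] by auto
    have "\<rho> (\<sigma> (r i)) (\<sigma> (r j)) < \<epsilon>" if "i \<ge> N" "j \<ge> N" for i j
      using N[OF that(1)] N[OF that(2)] pseudometricD(4)[OF pm \<sigma> k(1) \<sigma>, of "r i" "r j"]
        pseudometricD(3)[OF pm \<sigma> k(1), of "r j"] by auto
    then show "\<exists>N. \<forall>i\<ge>N. \<forall>j\<ge>N. \<rho> (\<sigma> (r i)) (\<sigma> (r j)) < \<epsilon>" by blast
  qed
qed

text \<open>By compactness some positive iterate of g moves both x and y by less than \<epsilon>/2.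
  Its remaining applications of g do not contract, so \<rho> (g x) (g y) is at most the distance of
  the two iterates, hence at most \<rho> x y + \<epsilon>.\<close>

lemma noncontracting_self_map_isometric:
  assumes pm: "pseudometric K \<rho>" and K: "sequentially_compact K \<rho>" and g: "\<And>x. x \<in> K \<Longrightarrow> g x \<in> K"
    and nc: "\<And>x y. x \<in> K \<Longrightarrow> y \<in> K \<Longrightarrow> \<rho> x y \<le> \<rho> (g x) (g y)" and x: "x \<in> K" and y: "y \<in> K"
  shows "\<rho> (g x) (g y) = \<rho> x y"
proof -
  have gK: "(g ^^ n) z \<in> K" if "z \<in> K" for z n
    by (induction n) (auto intro: g that)
  have iter: "\<rho> u v \<le> \<rho> ((g ^^ n) u) ((g ^^ n) v)" if "u \<in> K" "v \<in> K" for u v n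
  proof (induction n)
    case (Suc n)
    then show ?case using nc[OF gK[OF that(1), of n] gK[OF that(2), of n]] by simp
  qed simp
  have "\<rho> (g x) (g y) \<le> \<rho> x y + \<epsilon>" if "\<epsilon> > 0" for \<epsilon>
  proof -
    obtain r where r: "strict_mono (r :: nat \<Rightarrow> nat)"
      "\<And>\<epsilon>. \<epsilon> > 0 \<Longrightarrow> \<exists>N. \<forall>i\<ge>N. \<forall>j\<ge>N. \<rho> ((g ^^ r i) x) ((g ^^ r j) x) < \<epsilon>"
      using sequentially_compact_Cauchy[OF pm K, of "\<lambda>n. (g ^^ n) x"] gK[OF x] by metis
    \<comment> \<open>The second subsequence refines the first, so that x and y return at the same
      times.\<close>
    obtain r' where r': "strict_mono (r' :: nat \<Rightarrow> nat)"
      "\<And>\<epsilon>. \<epsilon> > 0 \<Longrightarrow> \<exists>N. \<forall>i\<ge>N. \<forall>j\<ge>N. \<rho> ((g ^^ r (r' i)) y) ((g ^^ r (r' j)) y) < \<epsilon>"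
      using sequentially_compact_Cauchy[OF pm K, of "\<lambda>n. (g ^^ r n) y"] gK[OF y] by metis
    obtain N where N: "\<And>i j. i \<ge> N \<Longrightarrow> j \<ge> N \<Longrightarrow> \<rho> ((g ^^ r i) x) ((g ^^ r j) x) < \<epsilon> / 2"
      using r(2)[of "\<epsilon> / 2"] \<open>\<epsilon> > 0\<close> by auto
    obtain N' where N': "\<And>i j. i \<ge> N' \<Longrightarrow> j \<ge> N' \<Longrightarrow> \<rho> ((g ^^ r (r' i)) y) ((g ^^ r (r' j)) y) < \<epsilon> / 2"
      using r'(2)[of "\<epsilon> / 2"] \<open>\<epsilon> > 0\<close> by auto
    define i where "i = max N N'"
    define a b where "a = r (r' i)" and "b = r (r' (Suc i))"
    have ab: "a < b" using r(1) r'(1) by (simp add: a_def b_def strict_monoD)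
    have ge: "r' i \<ge> N" "r' (Suc i) \<ge> N"
      using seq_suble[OF r'(1), of i] seq_suble[OF r'(1), of "Suc i"] by (auto simp: i_def)
    \<comment> \<open>Non-contraction under the first a applications turns closeness of the a-th and
      b-th iterates into a return to z itself.\<close>
    have close: "\<rho> z ((g ^^ (b - a)) z) \<le> \<rho> ((g ^^ a) z) ((g ^^ b) z)" if "z \<in> K" for z
      using iter[OF that gK[OF that], of "b - a" a] ab
      by (simp add: funpow_add[symmetric, THEN fun_cong, unfolded o_def])
    have cx: "\<rho> x ((g ^^ (b - a)) x) < \<epsilon> / 2"
      using close[OF x] N[OF ge] by (simp add: a_def b_def)
    have cy: "\<rho> y ((g ^^ (b - a)) y) < \<epsilon> / 2"
      using close[OF y] N'[of i "Suc i"] by (simp add: a_def b_def i_def le_SucI)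
    obtain c where c: "b - a = Suc c" using ab by (metis Suc_diff_Suc)
    have "\<rho> (g x) (g y) \<le> \<rho> ((g ^^ (b - a)) x) ((g ^^ (b - a)) y)"
      using iter[OF g[OF x] g[OF y], of c] unfolding c by (simp add: funpow_swap1)
    also have "\<dots> \<le> \<rho> x ((g ^^ (b - a)) x) + \<rho> x y + \<rho> y ((g ^^ (b - a)) y)"
      using pseudometricD(4)[OF pm gK[OF x, of "b - a"] x gK[OF y, of "b - a"]]
        pseudometricD(4)[OF pm x y gK[OF y, of "b - a"]] pseudometricD(3)[OF pm x gK[OF x, of "b - a"]] by simp
    finally show ?thesis using cx cy by simp
  qed
  then have "\<rho> (g x) (g y) \<le> \<rho> x y" by (rule field_le_epsilon)
  then show ?thesis using nc[OF x y] by simp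
qed

text \<open>
  An isometry between the two quotients lifts to a self-map of \<open>K\<close> that does not contract \<open>\<rho>\<close>.
\<close>

lemma gh_class_eq_imp_eq:
  assumes c: "compact_pseudometric K \<rho>" "compact_pseudometric K \<rho>'"
    and eq: "gh_class K \<rho> = gh_class K \<rho>'"
    and le: "\<And>x y. x \<in> K \<Longrightarrow> y \<in> K \<Longrightarrow> \<rho> x y \<le> \<rho>' x y" and xy: "x \<in> K" "y \<in> K"
  shows "\<rho> x y = \<rho>' x y"
proof -
  obtain m :: "real metric" and \<phi> where m: "compact_metric m" "quotient_map_of m K \<rho> \<phi>"
    using quotient_exists[OF c(1)] by metis
  obtain n :: "real metric" and \<psi> where n: "compact_metric n" "quotient_map_of n K \<rho>' \<psi>"
    using quotient_exists[OF c(2)] by metis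
  have "isometric m n"
    using eq m n by (simp add: gh_class_eqI gh_class_eq_iff)
  then obtain \<psi>' where \<psi>': "quotient_map_of m K \<rho>' \<psi>'"
    using quotient_map_of_trans[OF n(2)] isometric_sym by blast
  define g where "g x = inv_into K \<phi> (\<psi>' x)" for x
  have g: "g x \<in> K" "\<phi> (g x) = \<psi>' x" if "x \<in> K" for x
  proof -
    have "\<psi>' x \<in> \<phi> ` K" using that m(2) \<psi>' by (auto simp: quotient_map_of_def)
    then show "g x \<in> K" "\<phi> (g x) = \<psi>' x" by (simp_all add: g_def inv_into_into f_inv_into_f)
  qed
  have \<rho>': "\<rho> (g x) (g y) = \<rho>' x y" if "x \<in> K" "y \<in> K" for x y
    using g[OF that(1)] g[OF that(2)] that m(2) \<psi>' unfolding quotient_map_of_def by metis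
  have "\<rho> (g x) (g y) = \<rho> x y"
    by (rule noncontracting_self_map_isometric[of K])
       (use c(1) xy g \<rho>' le in \<open>auto simp: compact_pseudometric_def\<close>)
  then show ?thesis using \<rho>' xy by simp
qed

section \<open>Optimal correspondences and families of geodesics\<close>

lemma mdist_perturb:
  assumes "x \<in> mspace m" "x' \<in> mspace m" "y \<in> mspace m" "y' \<in> mspace m"
    and "mdist m x y < r" "mdist m x' y' < r"
  shows "\<bar>mdist m x x' - mdist m y y'\<bar> \<le> 2 * r"
proof -
  have "mdist m x x' \<le> mdist m x y + mdist m y y' + mdist m x' y'"
    using mdist_triangle[of x m y x'] mdist_triangle[of y m y' x'] assms by (simp add: mdist_commute)
  moreover have "mdist m y y' \<le> mdist m x y + mdist m x x' + mdist m x' y'"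
    using mdist_triangle[of y m x y'] mdist_triangle[of x m x' y'] assms by (simp add: mdist_commute)
  ultimately show ?thesis using assms by linarith
qed

text \<open>A correspondence of distortion at most 2 \<delta> + 2 / (k + 1) is coded by a pair of
  choice functions, one in each direction. These pairs form a compact product space in which the
  codes for k are closed, non-empty and decreasing in k, so some pair serves for all k. Closing up
  the relation it codes makes it compact and keeps the distortion.\<close>

lemma optimal_correspondence:
  fixes m n :: "real metric"
  assumes m: "compact_metric m" and n: "compact_metric n"
  obtains R where "R \<subseteq> mspace m \<times> mspace n" "fst ` R = mspace m" "snd ` R = mspace n"
    "\<And>x y x' y'. (x, y) \<in> R \<Longrightarrow> (x', y') \<in> R \<Longrightarrow> \<bar>mdist m x x' - mdist n y y'\<bar> \<le> 2 * GH_dist m n"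
    "sequentially_compact R (\<lambda>a b. max (mdist m (fst a) (fst b)) (mdist n (snd a) (snd b)))"
proof -
  define \<delta> where "\<delta> = GH_dist m n"
  define P where "P = prod_topology (product_topology (\<lambda>_. mtopology_of n) (mspace m))
    (product_topology (\<lambda>_. mtopology_of m) (mspace n))"
  have P: "compact_space P"
    using m n by (simp add: P_def compact_metric_def compact_space_prod_topology compact_space_product_topology)
  have top: "topspace P = (mspace m \<rightarrow>\<^sub>E mspace n) \<times> (mspace n \<rightarrow>\<^sub>E mspace m)"
    by (simp add: P_def PiE_def)
  \<comment> \<open>The coded relation is indexed by both spaces: \<open>Inl x\<close> names the
    pair (x, f x) and \<open>Inr y\<close> the pair (g y, y), where h = (f, g).\<close>
  define I where "I = Inl ` mspace m \<union> Inr ` mspace n"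
  define A where "A h i = (case i of Inl x \<Rightarrow> x | Inr y \<Rightarrow> snd h y)" for h :: "(real \<Rightarrow> real) \<times> (real \<Rightarrow> real)" and i
  define B where "B h i = (case i of Inl x \<Rightarrow> fst h x | Inr y \<Rightarrow> y)" for h :: "(real \<Rightarrow> real) \<times> (real \<Rightarrow> real)" and i
  have AB: "A h i \<in> mspace m" "B h i \<in> mspace n" if "h \<in> topspace P" "i \<in> I" for h i
    using that by (auto simp: A_def B_def I_def top)
  have contA: "continuous_map P (mtopology_of m) (\<lambda>h. A h i)" if i: "i \<in> I" for i
  proof (cases i)
    case (Inr y)
    then have "continuous_map P (mtopology_of m) (\<lambda>h. snd h y)"
      unfolding P_def using i
      by (intro continuous_map_compose[OF continuous_map_snd continuous_map_product_projection, unfolded o_def])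
         (auto simp: I_def)
    then show ?thesis using Inr by (simp add: A_def)
  qed (use i in \<open>auto simp: A_def I_def\<close>)
  have contB: "continuous_map P (mtopology_of n) (\<lambda>h. B h i)" if i: "i \<in> I" for i
  proof (cases i)
    case (Inl x)
    then have "continuous_map P (mtopology_of n) (\<lambda>h. fst h x)"
      unfolding P_def using i
      by (intro continuous_map_compose[OF continuous_map_fst continuous_map_product_projection, unfolded o_def])
         (auto simp: I_def)
    then show ?thesis using Inl by (simp add: B_def)
  qed (use i in \<open>auto simp: B_def I_def\<close>)
  define C where "C k = {h \<in> topspace P. \<forall>i\<in>I. \<forall>j\<in>I.
    \<bar>mdist m (A h i) (A h j) - mdist n (B h i) (B h j)\<bar> \<le> 2 * \<delta> + 2 / real (Suc k)}" for k
  have I: "I \<noteq> {}" using m by (auto simp: I_def compact_metric_def)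
  have cl: "closedin P (C k)" for k
  proof -
    have "closedin P {h \<in> topspace P. \<bar>mdist m (A h i) (A h j) - mdist n (B h i) (B h j)\<bar> \<in> {..2 * \<delta> + 2 / real (Suc k)}}"
      if "i \<in> I" "j \<in> I" for i j
    proof (rule closedin_continuous_map_preimage)
      show "continuous_map P euclideanreal (\<lambda>h. \<bar>mdist m (A h i) (A h j) - mdist n (B h i) (B h j)\<bar>)"
        using that contA contB
        by (intro continuous_map_real_abs continuous_map_diff continuous_map_mdist) auto
    qed auto
    moreover have "C k = \<Inter>((\<lambda>(i, j). {h \<in> topspace P. \<bar>mdist m (A h i) (A h j) - mdist n (B h i) (B h j)\<bar>
        \<in> {..2 * \<delta> + 2 / real (Suc k)}}) ` (I \<times> I))"
      using I by (auto simp: C_def)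
    ultimately show ?thesis
      using I by (auto intro!: closedin_Inter)
  qed
  have ne: "C k \<noteq> {}" for k
  proof -
    define r where "r = \<delta> + 1 / real (Suc k)"
    obtain c where c: "coupling m n c" "near m n c r"
      using GH_dist_lessD[OF m n, of r] by (auto simp: r_def \<delta>_def)
    obtain f where f: "\<And>x. x \<in> mspace m \<Longrightarrow> f x \<in> mspace n \<and> c x (f x) < r"
      using c(2) unfolding near_def by metis
    obtain g where g: "\<And>y. y \<in> mspace n \<Longrightarrow> g y \<in> mspace m \<and> c (g y) y < r"
      using c(2) unfolding near_def by metis
    define h where "h = (restrict f (mspace m), restrict g (mspace n))"
    have h: "h \<in> topspace P" using f g by (auto simp: h_def top)
    have r: "c (A h i) (B h i) \<le> r" if "i \<in> I" for i
      using that f g by (auto simp: A_def B_def I_def h_def intro: less_imp_le)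
    have "\<bar>mdist m (A h i) (A h j) - mdist n (B h i) (B h j)\<bar> \<le> 2 * \<delta> + 2 / real (Suc k)"
      if i: "i \<in> I" and j: "j \<in> I" for i j
    proof -
      have "mdist m (A h i) (A h j) \<le> c (A h i) (B h i) + c (A h j) (B h i)"
        "c (A h j) (B h i) \<le> c (A h j) (B h j) + mdist n (B h i) (B h j)"
        "mdist n (B h i) (B h j) \<le> c (A h i) (B h i) + c (A h i) (B h j)"
        "c (A h i) (B h j) \<le> mdist m (A h i) (A h j) + c (A h j) (B h j)"
        using c(1) AB[OF h i] AB[OF h j] unfolding coupling_def by blast+
      then have "\<bar>mdist m (A h i) (A h j) - mdist n (B h i) (B h j)\<bar> \<le> 2 * r"
        using r[OF i] r[OF j] by linarith
      then show ?thesis by (simp add: r_def algebra_simps)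
    qed
    then have "h \<in> C k" using h by (simp add: C_def)
    then show ?thesis by auto
  qed
  have "(\<Inter>k. C k) \<noteq> {}"
  proof (rule compact_space_imp_nest[OF P cl ne])
    show "decseq C"
    proof (rule decseq_SucI, rule subsetI)
      fix k h assume "h \<in> C (Suc k)"
      moreover have "2 * \<delta> + 2 / real (Suc (Suc k)) \<le> 2 * \<delta> + 2 / real (Suc k)"
        by (intro add_left_mono divide_left_mono) auto
      ultimately show "h \<in> C k"
        unfolding C_def by (blast intro: order_trans)
    qed
  qed
  then obtain h where h: "\<And>k. h \<in> C k" by auto
  then have hP: "h \<in> topspace P" by (auto simp: C_def)
  have dis: "\<bar>mdist m (A h i) (A h j) - mdist n (B h i) (B h j)\<bar> \<le> 2 * \<delta>" if "i \<in> I" "j \<in> I" for i j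
  proof (rule field_le_epsilon)
    fix e :: real assume "e > 0"
    then obtain k where "2 / real (Suc k) < e"
      using nat_approx_posE[of "e / 2"] by (auto simp: field_simps simp del: of_nat_Suc)
    then show "\<bar>mdist m (A h i) (A h j) - mdist n (B h i) (B h j)\<bar> \<le> 2 * \<delta> + e"
      using h[of k] that unfolding C_def by fastforce
  qed
  \<comment> \<open>The closure of the coded relation; the functions in h need not have closed
    graphs.\<close>
  define R where "R = {(x, y) \<in> mspace m \<times> mspace n. \<forall>\<epsilon>>0. \<exists>i\<in>I. mdist m x (A h i) < \<epsilon> \<and> mdist n y (B h i) < \<epsilon>}"
  have RI: "(A h i, B h i) \<in> R" if "i \<in> I" for i
    using that AB[OF hP that] by (auto simp: R_def mdist_self intro!: bexI[of _ i])
  show thesis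
  proof (rule that)
    show RS: "R \<subseteq> mspace m \<times> mspace n" by (auto simp: R_def)
    have "x \<in> fst ` R" if "x \<in> mspace m" for x
      using RI[of "Inl x"] that by (force simp: I_def A_def)
    then show "fst ` R = mspace m" using RS by auto
    have "y \<in> snd ` R" if "y \<in> mspace n" for y
      using RI[of "Inr y"] that by (force simp: I_def B_def)
    then show "snd ` R = mspace n" using RS by auto
    show "\<bar>mdist m x x' - mdist n y y'\<bar> \<le> 2 * GH_dist m n" if xy: "(x, y) \<in> R" "(x', y') \<in> R" for x y x' y'
    proof (rule field_le_epsilon)
      fix e :: real assume "e > 0"
      then have e4: "e / 4 > 0" by simp
      obtain i where i: "i \<in> I" "mdist m x (A h i) < e / 4" "mdist n y (B h i) < e / 4"
        using xy(1) e4 unfolding R_def by blast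
      obtain j where j: "j \<in> I" "mdist m x' (A h j) < e / 4" "mdist n y' (B h j) < e / 4"
        using xy(2) e4 unfolding R_def by blast
      note mem = AB[OF hP i(1)] AB[OF hP j(1)]
      have xy': "x \<in> mspace m" "x' \<in> mspace m" "y \<in> mspace n" "y' \<in> mspace n"
        using xy RS by auto
      have "\<bar>mdist m x x' - mdist m (A h i) (A h j)\<bar> \<le> 2 * (e / 4)"
        by (rule mdist_perturb) (use i j mem xy' in auto)
      moreover have "\<bar>mdist n y y' - mdist n (B h i) (B h j)\<bar> \<le> 2 * (e / 4)"
        by (rule mdist_perturb) (use i j mem xy' in auto)
      ultimately show "\<bar>mdist m x x' - mdist n y y'\<bar> \<le> 2 * GH_dist m n + e"
        using dis[OF i(1) j(1)] unfolding \<delta>_def by linarith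
    qed
    show "sequentially_compact R (\<lambda>a b. max (mdist m (fst a) (fst b)) (mdist n (snd a) (snd b)))"
      unfolding sequentially_compact_def
    proof (intro allI impI)
      fix \<sigma> :: "nat \<Rightarrow> real \<times> real" assume \<sigma>: "range \<sigma> \<subseteq> R"
      have \<sigma>R: "\<sigma> i \<in> R" for i using \<sigma> by auto
      then have \<sigma>': "fst (\<sigma> i) \<in> mspace m" "snd (\<sigma> i) \<in> mspace n" for i
        using subsetD[OF RS \<sigma>R[of i]] by (auto simp: mem_Times_iff)
      have scm: "sequentially_compact (mspace m) (mdist m)" and scn: "sequentially_compact (mspace n) (mdist n)"
        using m n by (simp_all add: compact_metric_iff_sequentially_compact)
      obtain x r where x: "x \<in> mspace m" "strict_mono r" "(\<lambda>i. mdist m (fst (\<sigma> (r i))) x) \<longlonglongrightarrow> 0"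
        by (rule sequentially_compactE[OF scm, of "\<lambda>i. fst (\<sigma> i)"]) (use \<sigma>' in auto)
      obtain y r' where y: "y \<in> mspace n" "strict_mono r'" "(\<lambda>i. mdist n (snd (\<sigma> (r (r' i)))) y) \<longlonglongrightarrow> 0"
        by (rule sequentially_compactE[OF scn, of "\<lambda>i. snd (\<sigma> (r i))"]) (use \<sigma>' in auto)
      have x': "(\<lambda>i. mdist m (fst (\<sigma> (r (r' i)))) x) \<longlonglongrightarrow> 0"
        using LIMSEQ_subseq_LIMSEQ[OF x(3) y(2)] by (simp add: o_def)
      have lim: "(\<lambda>i. max (mdist m (fst (\<sigma> (r (r' i)))) x) (mdist n (snd (\<sigma> (r (r' i)))) y)) \<longlonglongrightarrow> 0"
        using tendsto_max[OF x' y(3)] by simp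
      have "(x, y) \<in> R"
        unfolding R_def
      proof (intro CollectI case_prodI SigmaI conjI allI impI)
        fix \<epsilon> :: real assume "\<epsilon> > 0"
        then have "\<forall>\<^sub>F i in sequentially. max (mdist m (fst (\<sigma> (r (r' i)))) x) (mdist n (snd (\<sigma> (r (r' i)))) y) < \<epsilon> / 2"
          by (intro order_tendstoD(2)[OF lim]) simp
        then obtain i where i: "max (mdist m (fst (\<sigma> (r (r' i)))) x) (mdist n (snd (\<sigma> (r (r' i)))) y) < \<epsilon> / 2"
          by (auto simp: eventually_sequentially)
        have "\<forall>\<epsilon>>0. \<exists>j\<in>I. mdist m (fst (\<sigma> (r (r' i)))) (A h j) < \<epsilon> \<and> mdist n (snd (\<sigma> (r (r' i)))) (B h j) < \<epsilon>"
          using \<sigma>R[of "r (r' i)"] by (simp add: R_def case_prod_beta)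
        then obtain j where j: "j \<in> I" "mdist m (fst (\<sigma> (r (r' i)))) (A h j) < \<epsilon> / 2"
            "mdist n (snd (\<sigma> (r (r' i)))) (B h j) < \<epsilon> / 2"
          using half_gt_zero[OF \<open>\<epsilon> > 0\<close>] by blast
        have "mdist m x (A h j) < \<epsilon>" "mdist n y (B h j) < \<epsilon>"
          using mdist_triangle[of x m "fst (\<sigma> (r (r' i)))" "A h j"] mdist_triangle[of y n "snd (\<sigma> (r (r' i)))" "B h j"]
            i j x(1) y(1) \<sigma>' AB[OF hP j(1)] mdist_commute[of m x "fst (\<sigma> (r (r' i)))"]
            mdist_commute[of n y "snd (\<sigma> (r (r' i)))"]
          by auto
        then show "\<exists>i\<in>I. mdist m x (A h i) < \<epsilon> \<and> mdist n y (B h i) < \<epsilon>" using j by blast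
      qed (use x y in auto)
      then show "\<exists>k\<in>R. \<exists>r. strict_mono r \<and>
          (\<lambda>i. max (mdist m (fst (\<sigma> (r i))) (fst k)) (mdist n (snd (\<sigma> (r i))) (snd k))) \<longlonglongrightarrow> 0"
        using lim strict_mono_o[OF x(2) y(2)] by (intro bexI[of _ "(x, y)"] exI[of _ "r \<circ> r'"]) auto
    qed
  qed
qed

section \<open>At most continuum many geodesics\<close>

lemma compact_metric_dense_sequence:
  assumes "compact_metric m"
  obtains s :: "nat \<Rightarrow> 'a" where "\<And>i. s i \<in> mspace m" "\<And>x \<epsilon>. x \<in> mspace m \<Longrightarrow> \<epsilon> > 0 \<Longrightarrow> \<exists>i. mdist m (s i) x < \<epsilon>"
proof -
  interpret M: Metric_space "mspace m" "mdist m" by simp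
  have "M.mtotally_bounded (mspace m)"
    using assms by (simp add: compact_metric_def mtopology_of_def M.compactin_imp_mtotally_bounded compact_space_def)
  then have "\<forall>k. \<exists>F. finite F \<and> F \<subseteq> mspace m \<and> mspace m \<subseteq> (\<Union>x\<in>F. M.mball x (1 / real (Suc k)))"
    unfolding M.mtotally_bounded_def by (simp del: of_nat_Suc)
  then obtain F where F: "\<And>k. finite (F k)" "\<And>k. F k \<subseteq> mspace m"
      "\<And>k. mspace m \<subseteq> (\<Union>x\<in>F k. M.mball x (1 / real (Suc k)))"
    by metis
  define D where "D = (\<Union>k. F k)"
  have D: "countable D" "D \<subseteq> mspace m" using F by (auto simp: D_def intro: countable_finite)
  have dense: "\<exists>y\<in>D. mdist m y x < \<epsilon>" if "x \<in> mspace m" "\<epsilon> > 0" for x \<epsilon>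
  proof -
    obtain k where k: "1 / real (Suc k) < \<epsilon>" using nat_approx_posE[OF \<open>\<epsilon> > 0\<close>] by blast
    obtain y where y: "y \<in> F k" "mdist m y x < 1 / real (Suc k)"
      using F(3)[of k] \<open>x \<in> mspace m\<close> by (auto simp del: of_nat_Suc)
    then have "mdist m y x < \<epsilon>" using k by linarith
    then show ?thesis using y(1) by (auto simp: D_def)
  qed
  have "D \<noteq> {}" using dense[of _ 1] assms by (auto simp: compact_metric_def)
  show thesis
  proof (rule that[of "from_nat_into D"])
    show "from_nat_into D i \<in> mspace m" for i
      using from_nat_into[OF \<open>D \<noteq> {}\<close>, of i] D(2) by blast
    show "\<exists>i. mdist m (from_nat_into D i) x < \<epsilon>" if "x \<in> mspace m" "\<epsilon> > 0" for x \<epsilon>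
      using dense[OF that] from_nat_into_surj[OF D(1)] by metis
  qed
qed

text \<open>A dense sequence is fixed in every space. If the matrices agree, letting x and y
  correspond when both are within \<epsilon>/2 of terms with the same index gives a correspondence
  of distortion at most 2 \<epsilon>.\<close>

lemma gh_space_distance_matrix:
  obtains M :: "gh_space \<Rightarrow> nat \<Rightarrow> nat \<Rightarrow> real" where "inj M"
proof -
  have "\<exists>s :: nat \<Rightarrow> real. (\<forall>i. s i \<in> gh_points X) \<and>
      (\<forall>x \<epsilon>. x \<in> gh_points X \<longrightarrow> \<epsilon> > 0 \<longrightarrow> (\<exists>i. gh_mdist X (s i) x < \<epsilon>))" for X
    using compact_metric_dense_sequence[OF rep_gh_space_compact[of X]] by metis
  then obtain s :: "gh_space \<Rightarrow> nat \<Rightarrow> real" where s: "\<And>X i. s X i \<in> gh_points X"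
    "\<And>X x \<epsilon>. x \<in> gh_points X \<Longrightarrow> \<epsilon> > 0 \<Longrightarrow> \<exists>i. gh_mdist X (s X i) x < \<epsilon>"
    by metis
  define M where "M X i j = gh_mdist X (s X i) (s X j)" for X i j
  have "X = Y" if eq: "M X = M Y" for X Y
  proof -
    have "GH_dist (rep_gh_space X) (rep_gh_space Y) \<le> 0 + \<epsilon>" if "\<epsilon> > 0" for \<epsilon>
    proof -
      define m n where "m = rep_gh_space X" and "n = rep_gh_space Y"
      have sX: "s X i \<in> mspace m" and sY: "s Y i \<in> mspace n" for i using s(1) by (auto simp: m_def n_def)
      define R where "R = {(x, y) \<in> mspace m \<times> mspace n. \<exists>i. mdist m (s X i) x < \<epsilon> / 2 \<and> mdist n (s Y i) y < \<epsilon> / 2}"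
      have "GH_dist m n \<le> \<epsilon>"
      proof (rule GH_dist_le_distortion)
        show "compact_metric m" "compact_metric n" by (simp_all add: m_def n_def rep_gh_space_compact)
        show "R \<subseteq> mspace m \<times> mspace n" by (auto simp: R_def)
        have "\<exists>y. (x, y) \<in> R" if x: "x \<in> mspace m" for x
        proof -
          obtain i where "mdist m (s X i) x < \<epsilon> / 2" using s(2)[of x X "\<epsilon> / 2"] x \<open>\<epsilon> > 0\<close> by (auto simp: m_def)
          then show ?thesis using x sY[of i] \<open>\<epsilon> > 0\<close> by (intro exI[of _ "s Y i"]) (auto simp: R_def mdist_self intro!: exI[of _ i])
        qed
        then show "fst ` R = mspace m" by (force simp: R_def)
        have "\<exists>x. (x, y) \<in> R" if y: "y \<in> mspace n" for y
        proof -
          obtain i where "mdist n (s Y i) y < \<epsilon> / 2" using s(2)[of y Y "\<epsilon> / 2"] y \<open>\<epsilon> > 0\<close> by (auto simp: n_def)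
          then show ?thesis using y sX[of i] \<open>\<epsilon> > 0\<close> by (intro exI[of _ "s X i"]) (auto simp: R_def mdist_self intro!: exI[of _ i])
        qed
        then show "snd ` R = mspace n" by (force simp: R_def)
        fix x y x' y' assume "(x, y) \<in> R" "(x', y') \<in> R"
        then obtain i j where xy: "x \<in> mspace m" "x' \<in> mspace m" "y \<in> mspace n" "y' \<in> mspace n"
            "mdist m (s X i) x < \<epsilon> / 2" "mdist n (s Y i) y < \<epsilon> / 2"
            "mdist m (s X j) x' < \<epsilon> / 2" "mdist n (s Y j) y' < \<epsilon> / 2"
          unfolding R_def by blast
        have "mdist m (s X i) (s X j) = mdist n (s Y i) (s Y j)"
          using fun_cong[OF fun_cong[OF eq], of i j] by (simp add: M_def m_def n_def)
        moreover have "\<bar>mdist m x x' - mdist m (s X i) (s X j)\<bar> \<le> 2 * (\<epsilon> / 2)"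
          by (rule mdist_perturb) (use xy sX in \<open>auto simp: mdist_commute\<close>)
        moreover have "\<bar>mdist n y y' - mdist n (s Y i) (s Y j)\<bar> \<le> 2 * (\<epsilon> / 2)"
          by (rule mdist_perturb) (use xy sY in \<open>auto simp: mdist_commute\<close>)
        ultimately show "\<bar>mdist m x x' - mdist n y y'\<bar> \<le> 2 * \<epsilon>"
          by linarith
      qed
      then show ?thesis by (simp add: m_def n_def)
    qed
    then have "dist X Y \<le> 0"
      unfolding dist_gh_space_def by (rule field_le_epsilon)
    then show ?thesis by simp
  qed
  then have "inj M" by (rule injI)
  then show thesis by (rule that)
qed

lemma geodesics_lepoll_continuum: "geodesics X Y \<lesssim> (UNIV :: nat set set)" for X Y :: gh_space
proof -
  obtain M :: "gh_space \<Rightarrow> nat \<Rightarrow> nat \<Rightarrow> real" where M: "inj M"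
    by (rule gh_space_distance_matrix)
  \<comment> \<open>Matrix entries at rational times are recorded as cuts in the rationals, which
    turns a geodesic into a subset of a countable set.\<close>
  define G where "G \<gamma> = {(q :: rat, i, j, r :: rat). real_of_rat q \<in> {0..1} \<and> real_of_rat r < M (\<gamma> (real_of_rat q)) i j}"
    for \<gamma> :: "real \<Rightarrow> gh_space"
  have "inj_on G (geodesics X Y)"
  proof (rule inj_onI)
    fix \<gamma> \<gamma>' assume \<gamma>: "\<gamma> \<in> geodesics X Y" "\<gamma>' \<in> geodesics X Y" and eq: "G \<gamma> = G \<gamma>'"
    have rat: "\<gamma> (real_of_rat q) = \<gamma>' (real_of_rat q)" if q: "real_of_rat q \<in> {0..1}" for q
    proof -
      have "M (\<gamma> (real_of_rat q)) i j = M (\<gamma>' (real_of_rat q)) i j" for i j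
      proof -
        have "(q, i, j, r) \<in> G \<gamma> \<longleftrightarrow> (q, i, j, r) \<in> G \<gamma>'" for r by (simp add: eq)
        then have "real_of_rat r < M (\<gamma> (real_of_rat q)) i j \<longleftrightarrow> real_of_rat r < M (\<gamma>' (real_of_rat q)) i j" for r
          using q by (simp add: G_def)
        then show ?thesis
          by (metis linorder_neqE_linordered_idom of_rat_dense order_less_asym)
      qed
      then show ?thesis using M by (auto simp: inj_def fun_eq_iff)
    qed
    have "\<gamma> t = \<gamma>' t" if t: "t \<in> {0..1}" for t
    proof -
      have "dist (\<gamma> t) (\<gamma>' t) \<le> 0 + e" if "e > 0" for e
      proof -
        \<comment> \<open>Both curves move by at most d * dist X Y between t and the rational time;
          the added 1 keeps the denominator positive when X = Y.\<close>
        define d where "d = e / (2 * dist X Y + 1)"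
        have pos: "2 * dist X Y + 1 > 0" by (simp add: add_nonneg_pos)
        then have d: "d > 0" "d * (2 * dist X Y + 1) = e" using \<open>e > 0\<close> by (simp_all add: d_def)
        have "max 0 (t - d) < min 1 (t + d)" using t d(1) by auto
        then obtain q where q: "max 0 (t - d) < real_of_rat q" "real_of_rat q < min 1 (t + d)"
          using of_rat_dense by blast
        then have q01: "real_of_rat q \<in> {0..1}" and qt: "\<bar>t - real_of_rat q\<bar> \<le> d" by auto
        have "dist (\<gamma> t) (\<gamma>' t) \<le> dist (\<gamma> t) (\<gamma> (real_of_rat q)) + dist (\<gamma>' t) (\<gamma>' (real_of_rat q))"
          using rat[OF q01] dist_triangle2 by metis
        also have "\<dots> = 2 * (\<bar>t - real_of_rat q\<bar> * dist X Y)"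
          using \<gamma> t q01 by (simp add: geodesics_def)
        also have "\<dots> \<le> 2 * (d * dist X Y)" using qt by (simp add: mult_right_mono)
        also have "\<dots> \<le> e" using d by (simp add: algebra_simps)
        finally show ?thesis by simp
      qed
      then have "dist (\<gamma> t) (\<gamma>' t) \<le> 0" by (rule field_le_epsilon)
      then show ?thesis by simp
    qed
    then show "\<gamma> = \<gamma>'"
      using \<gamma> by (intro extensionalityI[of \<gamma> "{0..1}"]) (auto simp: geodesics_def)
  qed
  then have "inj_on (\<lambda>\<gamma>. to_nat ` G \<gamma>) (geodesics X Y)"
    by (auto simp: inj_on_def inj_image_eq_iff)
  then show ?thesis by (auto simp: lepoll_def)
qed

text \<open>Here l is the scale and t the time. The constant 2 * dist X Y is the distortion that
  corresponds to the Gromov-Hausdorff distance. Since a and b have the same images in X and Y, their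
  distance is \<zeta> alone. Compactness is left to \<open>compact_gh_family\<close>, because it
  concerns \<rho>, which can only be defined from the data assumed here.\<close>

locale gh_family =
  fixes X Y :: gh_space and K :: "'k set" and p q :: "'k \<Rightarrow> real" and \<zeta> :: "real \<Rightarrow> real \<Rightarrow> 'k \<Rightarrow> 'k \<Rightarrow> real"
    and a b :: 'k
  assumes pos: "dist X Y > 0"
    and p: "p ` K = gh_points X" and q: "q ` K = gh_points Y"
    and distortion: "\<And>x y. x \<in> K \<Longrightarrow> y \<in> K \<Longrightarrow>
      \<bar>gh_mdist X (p x) (p y) - gh_mdist Y (q x) (q y)\<bar> \<le> 2 * dist X Y"
    and \<zeta>: "\<And>l t. l \<in> {0<..1} \<Longrightarrow> t \<in> {0..1} \<Longrightarrow> pseudometric K (\<zeta> l t)"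
    and \<zeta>_lipschitz: "\<And>l s t x y. l \<in> {0<..1} \<Longrightarrow> s \<in> {0..1} \<Longrightarrow> t \<in> {0..1} \<Longrightarrow> x \<in> K \<Longrightarrow> y \<in> K \<Longrightarrow>
      \<bar>\<zeta> l s x y - \<zeta> l t x y\<bar> \<le> 2 * dist X Y * \<bar>s - t\<bar>"
    and \<zeta>_ends: "\<And>l x y. x \<in> K \<Longrightarrow> y \<in> K \<Longrightarrow> \<zeta> l 0 x y = 0" "\<And>l x y. x \<in> K \<Longrightarrow> y \<in> K \<Longrightarrow> \<zeta> l 1 x y = 0"
    and \<zeta>_mono: "\<And>l l' x y. 0 < l \<Longrightarrow> l \<le> l' \<Longrightarrow> x \<in> K \<Longrightarrow> y \<in> K \<Longrightarrow> \<zeta> l (1/2) x y \<le> \<zeta> l' (1/2) x y"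
    and ab: "a \<in> K" "b \<in> K" "p a = p b" "q a = q b"
    and \<zeta>_inj: "inj_on (\<lambda>l. \<zeta> l (1/2) a b) {0<..1}"
begin

definition \<rho> :: "real \<Rightarrow> real \<Rightarrow> 'k \<Rightarrow> 'k \<Rightarrow> real"
  where "\<rho> l t x y = max ((1 - t) * gh_mdist X (p x) (p y) + t * gh_mdist Y (q x) (q y)) (\<zeta> l t x y)"

lemma mem: "x \<in> K \<Longrightarrow> p x \<in> gh_points X" "x \<in> K \<Longrightarrow> q x \<in> gh_points Y"
  using p q by auto

lemma pseudometric_\<rho>:
  assumes l: "l \<in> {0<..1}" and t: "t \<in> {0..1}"
  shows "pseudometric K (\<rho> l t)"
proof (rule pseudometricI)
  note pm = pseudometricD[OF \<zeta>[OF l t]]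
  show "\<rho> l t x x = 0" if "x \<in> K" for x
    using that mem pm(1) by (simp add: \<rho>_def mdist_self)
  show "0 \<le> \<rho> l t x y" if "x \<in> K" "y \<in> K" for x y
    using pm(2)[OF that] by (simp add: \<rho>_def le_max_iff_disj)
  show "\<rho> l t x y = \<rho> l t y x" if "x \<in> K" "y \<in> K" for x y
    using pm(3)[OF that] by (simp add: \<rho>_def mdist_commute)
  show "\<rho> l t x z \<le> \<rho> l t x y + \<rho> l t y z" if "x \<in> K" "y \<in> K" "z \<in> K" for x y z
  proof -
    have "(1 - t) * gh_mdist X (p x) (p z) + t * gh_mdist Y (q x) (q z)
      \<le> (1 - t) * (gh_mdist X (p x) (p y) + gh_mdist X (p y) (p z))
        + t * (gh_mdist Y (q x) (q y) + gh_mdist Y (q y) (q z))"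
      using that mem t by (intro add_mono mult_left_mono mdist_triangle) auto
    also have "\<dots> = ((1 - t) * gh_mdist X (p x) (p y) + t * gh_mdist Y (q x) (q y))
        + ((1 - t) * gh_mdist X (p y) (p z) + t * gh_mdist Y (q y) (q z))"
      by (simp add: algebra_simps)
    also have "\<dots> \<le> \<rho> l t x y + \<rho> l t y z"
      unfolding \<rho>_def by (intro add_mono) auto
    finally have "(1 - t) * gh_mdist X (p x) (p z) + t * gh_mdist Y (q x) (q z)
      \<le> \<rho> l t x y + \<rho> l t y z" .
    moreover have "\<zeta> l t x z \<le> \<rho> l t x y + \<rho> l t y z"
      by (rule order_trans[OF pm(4)[OF that]]) (auto simp: \<rho>_def intro!: add_mono)
    ultimately show ?thesis by (simp add: \<rho>_def[of l t x z])
  qed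
qed

lemma \<rho>_diff_le:
  assumes l: "l \<in> {0<..1}" and s: "s \<in> {0..1}" and t: "t \<in> {0..1}" and x: "x \<in> K" and y: "y \<in> K"
  shows "\<bar>\<rho> l s x y - \<rho> l t x y\<bar> \<le> 2 * (\<bar>s - t\<bar> * dist X Y)"
proof -
  define d e where "d = gh_mdist X (p x) (p y)" and "e = gh_mdist Y (q x) (q y)"
  have "\<bar>((1 - s) * d + s * e) - ((1 - t) * d + t * e)\<bar> = \<bar>s - t\<bar> * \<bar>d - e\<bar>"
    by (simp add: abs_mult[symmetric] abs_minus_commute algebra_simps)
  also have "\<dots> \<le> \<bar>s - t\<bar> * (2 * dist X Y)"
    using distortion[OF x y] by (intro mult_left_mono) (auto simp: d_def e_def)
  finally show ?thesis
    using \<zeta>_lipschitz[OF l s t x y] unfolding \<rho>_def d_def[symmetric] e_def[symmetric]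
    by (simp add: max_def abs_le_iff mult_ac split: if_splits)
qed

lemma quotient_ends:
  "quotient_map_of (rep_gh_space X) K (\<rho> l 0) p" "quotient_map_of (rep_gh_space Y) K (\<rho> l 1) q"
  using p q \<zeta>_ends by (simp_all add: quotient_map_of_def \<rho>_def)

lemma gh_class_ends: "gh_class K (\<rho> l 0) = X" "gh_class K (\<rho> l 1) = Y"
  using quotient_ends by (blast intro: gh_class_rep)+

end

locale compact_gh_family = gh_family +
  assumes compact: "\<And>l t. l \<in> {0<..1} \<Longrightarrow> t \<in> {0<..<1} \<Longrightarrow> sequentially_compact K (\<rho> l t)"
begin

lemma compact_\<rho>:
  assumes l: "l \<in> {0<..1}" and t: "t \<in> {0..1}"
  shows "compact_pseudometric K (\<rho> l t)"
proof -
  have "sequentially_compact K (\<rho> l t)"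
  proof (cases "t \<in> {0<..<1}")
    case False
    then consider "t = 0" | "t = 1" using t by fastforce
    then show ?thesis
      using quotient_ends[of l] compact_metric_iff_quotient rep_gh_space_compact by cases blast+
  qed (use compact[OF l] in blast)
  then show ?thesis using ab(1) pseudometric_\<rho>[OF l t] by (auto simp: compact_pseudometric_def)
qed

definition scaled_path :: "real \<Rightarrow> real \<Rightarrow> gh_space"
  where "scaled_path l = restrict (\<lambda>t. gh_class K (\<rho> l t)) {0..1}"

lemma scaled_path_geodesic:
  assumes l: "l \<in> {0<..1}"
  shows "scaled_path l \<in> geodesics X Y"
proof -
  have le: "dist (scaled_path l s) (scaled_path l t) \<le> \<bar>s - t\<bar> * dist X Y" if "s \<in> {0..1}" "t \<in> {0..1}" for s t
    using dist_gh_class_le[OF compact_\<rho>[OF l that(1)] compact_\<rho>[OF l that(2)] \<rho>_diff_le[OF l that]] that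
    by (simp add: scaled_path_def)
  have ends: "scaled_path l 0 = X" "scaled_path l 1 = Y" by (simp_all add: scaled_path_def gh_class_ends)
  \<comment> \<open>Only the upper bound is computed. The outer pieces of the path have length at
    most s D and (1 - t) D, where D = dist X Y, so the triangle inequality leaves at least (t - s) D
    for the middle one.\<close>
  have eq: "dist (scaled_path l s) (scaled_path l t) = \<bar>s - t\<bar> * dist X Y" if st: "s \<in> {0..1}" "t \<in> {0..1}" "s \<le> t" for s t
  proof -
    have "dist X Y \<le> dist X (scaled_path l s) + dist (scaled_path l s) (scaled_path l t) + dist (scaled_path l t) Y"
      using dist_triangle[of X Y "scaled_path l s"] dist_triangle[of "scaled_path l s" Y "scaled_path l t"] by linarith
    moreover have "dist X (scaled_path l s) \<le> s * dist X Y" "dist (scaled_path l t) Y \<le> (1 - t) * dist X Y"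
      using le[of 0 s] le[of t 1] st by (simp_all add: ends)
    ultimately have "(t - s) * dist X Y \<le> dist (scaled_path l s) (scaled_path l t)" by (simp add: algebra_simps)
    then show ?thesis using le[OF st(1,2)] st(3) by simp
  qed
  have eq': "dist (scaled_path l s) (scaled_path l t) = \<bar>s - t\<bar> * dist X Y" if "s \<in> {0..1}" "t \<in> {0..1}" for s t
    using eq[OF that] eq[OF that(2,1)] by (cases s t rule: le_cases) (simp_all add: dist_commute abs_minus_commute)
  have "(dist X Y)-lipschitz_on {0..1} (scaled_path l)"
    using le by (intro lipschitz_onI) (auto simp: dist_real_def mult.commute)
  then have "continuous_on {0..1} (scaled_path l)" by (rule lipschitz_on_continuous_on)
  then show ?thesis using ends eq' by (auto simp: geodesics_def scaled_path_def)
qed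

text \<open>If two scales gave the same path, the pointwise comparable pseudometrics at time 1/2
  would have isometric quotients and hence be equal, also at the pair a, b.\<close>

lemma scaled_path_inj: "inj_on scaled_path {0<..1}"
proof (rule linorder_inj_onI)
  fix l l' :: real assume l: "l < l'" "l \<in> {0<..1}" "l' \<in> {0<..1}"
  show "scaled_path l \<noteq> scaled_path l'"
  proof
    assume "scaled_path l = scaled_path l'"
    then have "gh_class K (\<rho> l (1/2)) = gh_class K (\<rho> l' (1/2))"
      unfolding scaled_path_def by (drule_tac fun_cong[of _ _ "1/2"]) simp
    moreover have "\<rho> l (1/2) x y \<le> \<rho> l' (1/2) x y" if "x \<in> K" "y \<in> K" for x y
      unfolding \<rho>_def using l that by (intro max.mono \<zeta>_mono) auto
    ultimately have "\<rho> l (1/2) a b = \<rho> l' (1/2) a b"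
      using l ab by (intro gh_class_eq_imp_eq[of K] compact_\<rho>) auto
    moreover have "0 \<le> \<zeta> l (1/2) a b" "0 \<le> \<zeta> l' (1/2) a b"
      using pseudometricD(2)[OF \<zeta> ab(1,2)] l by auto
    \<comment> \<open>The convex combination vanishes at the pair a, b, so \<rho> is the maximum of
      0 and \<zeta> there.\<close>
    ultimately have "\<zeta> l (1/2) a b = \<zeta> l' (1/2) a b"
      using ab mem by (simp add: \<rho>_def mdist_self)
    then show False using inj_onD[OF \<zeta>_inj, of l l'] l by simp
  qed
qed auto

theorem geodesics_eqpoll_continuum:
  assumes "X \<in> S" "Y \<in> S" and S: "\<And>l t. l \<in> {0<..1} \<Longrightarrow> t \<in> {0<..<1} \<Longrightarrow> gh_class K (\<rho> l t) \<in> S"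
  shows "{\<gamma> \<in> geodesics X Y. \<gamma> ` {0..1} \<subseteq> S} \<approx> (UNIV :: nat set set)"
proof (rule lepoll_antisym)
  show "{\<gamma> \<in> geodesics X Y. \<gamma> ` {0..1} \<subseteq> S} \<lesssim> (UNIV :: nat set set)"
    by (rule lepoll_trans[OF subset_imp_lepoll geodesics_lepoll_continuum]) blast
  have "scaled_path l ` {0..1} \<subseteq> S" if "l \<in> {0<..1}" for l
  proof -
    have "gh_class K (\<rho> l t) \<in> S" if "t \<in> {0..1}" for t
    proof (cases "t \<in> {0<..<1}")
      case False
      then have "t = 0 \<or> t = 1" using that by fastforce
      then show ?thesis using gh_class_ends assms(1,2) by auto
    qed (use S \<open>l \<in> {0<..1}\<close> in blast)
    then show ?thesis by (auto simp: scaled_path_def)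
  qed
  then have "scaled_path ` {0<..1} \<subseteq> {\<gamma> \<in> geodesics X Y. \<gamma> ` {0..1} \<subseteq> S}"
    using scaled_path_geodesic by blast
  then have "{0<..1::real} \<lesssim> {\<gamma> \<in> geodesics X Y. \<gamma> ` {0..1} \<subseteq> S}"
    using scaled_path_inj by (auto simp: lepoll_def)
  moreover have "(UNIV :: nat set set) \<approx> {0<..1::real}"
    by (rule eqpoll_trans[OF nat_sets_eqpoll_reals eqpoll_sym[OF eqpoll_real_subset[of 0 1]]]) auto
  ultimately show "(UNIV :: nat set set) \<lesssim> {\<gamma> \<in> geodesics X Y. \<gamma> ` {0..1} \<subseteq> S}"
    by (rule lepoll_trans1[rotated])
qed

end

section \<open>Spaces of infinite dimension\<close>

lemma optimal_correspondence_gh_space: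
  obtains R where "R \<subseteq> gh_points X \<times> gh_points Y"
    "fst ` R = gh_points X" "snd ` R = gh_points Y"
    "\<forall>x\<in>R. \<forall>y\<in>R. \<bar>gh_mdist X (fst x) (fst y) - gh_mdist Y (snd x) (snd y)\<bar> \<le> 2 * dist X Y"
    "sequentially_compact R (\<lambda>x y. max (gh_mdist X (fst x) (fst y)) (gh_mdist Y (snd x) (snd y)))"
proof (rule optimal_correspondence[OF rep_gh_space_compact rep_gh_space_compact])
  fix R
  assume R: "R \<subseteq> gh_points X \<times> gh_points Y"
    "fst ` R = gh_points X" "snd ` R = gh_points Y"
    and dis: "\<And>x y x' y'. (x, y) \<in> R \<Longrightarrow> (x', y') \<in> R \<Longrightarrow>
      \<bar>gh_mdist X x x' - gh_mdist Y y y'\<bar> \<le> 2 * GH_dist (rep_gh_space X) (rep_gh_space Y)"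
    and c: "sequentially_compact R (\<lambda>x y. max (gh_mdist X (fst x) (fst y)) (gh_mdist Y (snd x) (snd y)))"
  have "\<forall>x\<in>R. \<forall>y\<in>R. \<bar>gh_mdist X (fst x) (fst y) - gh_mdist Y (snd x) (snd y)\<bar> \<le> 2 * dist X Y"
    using dis by (auto simp: dist_gh_space_def)
  then show thesis by (rule that[OF R _ c])
qed

section \<open>Constructions of compact pseudometrics\<close>

lemma pseudometric_max:
  assumes "pseudometric K \<alpha>" "pseudometric K \<beta>"
  shows "pseudometric K (\<lambda>x y. max (\<alpha> x y) (\<beta> x y))"
proof (rule pseudometricI)
  show "max (\<alpha> x z) (\<beta> x z) \<le> max (\<alpha> x y) (\<beta> x y) + max (\<alpha> y z) (\<beta> y z)"
    if "x \<in> K" "y \<in> K" "z \<in> K" for x y z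
    using pseudometricD(4)[OF assms(1) that] pseudometricD(4)[OF assms(2) that] by linarith
qed (use pseudometricD[OF assms(1)] pseudometricD[OF assms(2)] in \<open>auto simp: le_max_iff_disj\<close>)

lemma pseudometric_pullback:
  assumes "pseudometric L \<alpha>" "\<And>x. x \<in> K \<Longrightarrow> f x \<in> L"
  shows "pseudometric K (\<lambda>x y. \<alpha> (f x) (f y))"
  using pseudometricD[OF assms(1)] assms(2) by (intro pseudometricI) auto

lemma pseudometric_scale:
  assumes "pseudometric K \<alpha>" "c \<ge> 0"
  shows "pseudometric K (\<lambda>x y. c * \<alpha> x y)"
proof (rule pseudometricI)
  show "c * \<alpha> x z \<le> c * \<alpha> x y + c * \<alpha> y z" if "x \<in> K" "y \<in> K" "z \<in> K" for x y z
    using mult_left_mono[OF pseudometricD(4)[OF assms(1) that] assms(2)] by (simp add: algebra_simps)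
qed (use pseudometricD[OF assms(1)] assms(2) in auto)

lemma pseudometric_mdist: "pseudometric (mspace m) (mdist m)"
  by (intro pseudometricI) (auto simp: mdist_self mdist_commute mdist_triangle)

lemma pseudometric_discrete: "pseudometric UNIV (\<lambda>x y. of_bool (x \<noteq> y))"
  by (intro pseudometricI) auto

lemma sequentially_compact_Times:
  assumes A: "sequentially_compact A \<alpha>" and B: "sequentially_compact B \<beta>"
  shows "sequentially_compact (A \<times> B) (\<lambda>x y. max (\<alpha> (fst x) (fst y)) (\<beta> (snd x) (snd y)))"
  unfolding sequentially_compact_def
proof (intro allI impI)
  fix \<sigma> :: "nat \<Rightarrow> 'a \<times> 'b" assume "range \<sigma> \<subseteq> A \<times> B"
  then have \<sigma>: "\<sigma> i \<in> A \<times> B" for i by auto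
  obtain x r where x: "x \<in> A" "strict_mono r" "(\<lambda>i. \<alpha> (fst (\<sigma> (r i))) x) \<longlonglongrightarrow> 0"
    by (rule sequentially_compactE[OF A, of "\<lambda>i. fst (\<sigma> i)"]) (use \<sigma> in \<open>auto simp: mem_Times_iff\<close>)
  obtain y r' where y: "y \<in> B" "strict_mono r'" "(\<lambda>i. \<beta> (snd (\<sigma> (r (r' i)))) y) \<longlonglongrightarrow> 0"
    by (rule sequentially_compactE[OF B, of "\<lambda>i. snd (\<sigma> (r i))"]) (use \<sigma> in \<open>auto simp: mem_Times_iff\<close>)
  have "(\<lambda>i. \<alpha> (fst (\<sigma> (r (r' i)))) x) \<longlonglongrightarrow> 0"
    using LIMSEQ_subseq_LIMSEQ[OF x(3) y(2)] by (simp add: o_def)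
  then have "(\<lambda>i. max (\<alpha> (fst (\<sigma> (r (r' i)))) x) (\<beta> (snd (\<sigma> (r (r' i)))) y)) \<longlonglongrightarrow> 0"
    using tendsto_max[OF _ y(3)] by fastforce
  then show "\<exists>k\<in>A \<times> B. \<exists>r. strict_mono r \<and>
      (\<lambda>i. max (\<alpha> (fst (\<sigma> (r i))) (fst k)) (\<beta> (snd (\<sigma> (r i))) (snd k))) \<longlonglongrightarrow> 0"
    using x y strict_mono_o[OF x(2) y(2)] by (intro bexI[of _ "(x, y)"] exI[of _ "r \<circ> r'"]) auto
qed

lemma sequentially_compact_mono:
  assumes K: "sequentially_compact K \<alpha>"
    and le: "\<And>x y. x \<in> K \<Longrightarrow> y \<in> K \<Longrightarrow> 0 \<le> \<beta> x y" "\<And>x y. x \<in> K \<Longrightarrow> y \<in> K \<Longrightarrow> \<beta> x y \<le> C * \<alpha> x y"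
  shows "sequentially_compact K \<beta>"
  unfolding sequentially_compact_def
proof (intro allI impI)
  fix \<sigma> :: "nat \<Rightarrow> 'a" assume "range \<sigma> \<subseteq> K"
  then have \<sigma>: "\<sigma> i \<in> K" for i by auto
  obtain k r where k: "k \<in> K" "strict_mono r" "(\<lambda>i. \<alpha> (\<sigma> (r i)) k) \<longlonglongrightarrow> 0"
    by (rule sequentially_compactE[OF K, of \<sigma>]) (use \<sigma> in auto)
  have "(\<lambda>i. C * \<alpha> (\<sigma> (r i)) k) \<longlonglongrightarrow> 0"
    using tendsto_mult_right_zero[OF k(3)] by simp
  then have "(\<lambda>i. \<beta> (\<sigma> (r i)) k) \<longlonglongrightarrow> 0"
    by (rule real_tendsto_sandwich[where f = "\<lambda>_. 0", rotated 3]) (use le \<sigma> k(1) in auto)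
  then show "\<exists>k\<in>K. \<exists>r. strict_mono r \<and> (\<lambda>i. \<beta> (\<sigma> (r i)) k) \<longlonglongrightarrow> 0"
    using k by blast
qed

lemma sequentially_compact_finite:
  assumes "finite K" "\<And>x. x \<in> K \<Longrightarrow> \<alpha> x x = 0"
  shows "sequentially_compact K \<alpha>"
  unfolding sequentially_compact_def
proof (intro allI impI)
  fix \<sigma> :: "nat \<Rightarrow> 'a" assume \<sigma>: "range \<sigma> \<subseteq> K"
  then obtain i0 where i0: "infinite {i \<in> UNIV. \<sigma> i = \<sigma> i0}"
    using pigeonhole_infinite[of UNIV \<sigma>] finite_subset[OF \<sigma> assms(1)] by auto
  define r where "r = enumerate {i. \<sigma> i = \<sigma> i0}"
  have "\<sigma> (r i) = \<sigma> i0" "strict_mono r" for i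
    using enumerate_in_set[of "{i. \<sigma> i = \<sigma> i0}" i] i0 strict_mono_enumerate[of "{i. \<sigma> i = \<sigma> i0}"]
    by (auto simp: r_def)
  moreover have "\<sigma> i0 \<in> K" using \<sigma> by auto
  ultimately show "\<exists>k\<in>K. \<exists>r. strict_mono r \<and> (\<lambda>i. \<alpha> (\<sigma> (r i)) k) \<longlonglongrightarrow> 0"
    using assms(2) by (intro bexI[of _ "\<sigma> i0"] exI[of _ r]) auto
qed

text \<open>
  The metrics \<open>c n * W n\<close> glued together at the base points \<open>b n\<close>, inside their \<open>\<ell>\<^sup>\<infinity>\<close> product. It is only a
  pseudometric, since \<open>c n\<close> may vanish.
\<close>

definition wedge_dist :: "(nat \<Rightarrow> 'a metric) \<Rightarrow> (nat \<Rightarrow> 'a) \<Rightarrow> (nat \<Rightarrow> real) \<Rightarrow> nat \<times> 'a \<Rightarrow> nat \<times> 'a \<Rightarrow> real"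
  where "wedge_dist W b c x y = (if fst x = fst y then c (fst x) * mdist (W (fst x)) (snd x) (snd y)
    else max (c (fst x) * mdist (W (fst x)) (snd x) (b (fst x))) (c (fst y) * mdist (W (fst y)) (snd y) (b (fst y))))"

lemma pseudometric_wedge:
  assumes b: "\<And>n. b n \<in> mspace (W n)" and c: "\<And>n. 0 \<le> c n"
  shows "pseudometric (SIGMA n:UNIV. mspace (W n)) (wedge_dist W b c)"
proof (rule pseudometricI)
  fix x y z assume xyz: "x \<in> (SIGMA n:UNIV. mspace (W n))" "y \<in> (SIGMA n:UNIV. mspace (W n))" "z \<in> (SIGMA n:UNIV. mspace (W n))"
  obtain n u where x: "x = (n, u)" "u \<in> mspace (W n)" using xyz(1) by auto
  obtain n' u' where y: "y = (n', u')" "u' \<in> mspace (W n')" using xyz(2) by auto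
  obtain n'' u'' where z: "z = (n'', u'')" "u'' \<in> mspace (W n'')" using xyz(3) by auto
  have tri: "c k * mdist (W k) v v'' \<le> c k * mdist (W k) v v' + c k * mdist (W k) v' v''"
    if "v \<in> mspace (W k)" "v' \<in> mspace (W k)" "v'' \<in> mspace (W k)" for k v v' v''
    using mult_left_mono[OF mdist_triangle[OF that] c[of k]] by (simp add: algebra_simps)
  have nn: "0 \<le> c k * mdist (W k) v v'" for k v v' using c by simp
  show "wedge_dist W b c x z \<le> wedge_dist W b c x y + wedge_dist W b c y z"
  proof (cases "n = n''")
    case True
    show ?thesis
    proof (cases "n' = n")
      case True
      then show ?thesis using \<open>n = n''\<close> x y z tri[of u n u' u''] by (simp add: wedge_dist_def)
    next
      case False
      then show ?thesis using \<open>n = n''\<close> x y z tri[of u n "b n" u''] b[of n] mdist_commute[of "W n" "b n" u'']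
        by (auto simp: wedge_dist_def)
    qed
  next
    case False
    then consider "n' = n" "n' \<noteq> n''" | "n' = n''" "n' \<noteq> n" | "n' \<noteq> n" "n' \<noteq> n''" by auto
    then show ?thesis
    proof cases
      case 1
      then show ?thesis using False x y z tri[of u n u' "b n"] b[of n] nn[of n u u']
        by (auto simp: wedge_dist_def le_max_iff_disj)
    next
      case 2
      then show ?thesis using False x y z tri[of u'' n'' u' "b n''"] b[of n''] nn[of n'' u' u'']
        mdist_commute[of "W n''" u'' u']
        by (auto simp: wedge_dist_def le_max_iff_disj)
    next
      case 3
      then show ?thesis using False x y z nn[of n' u' "b n'"]
        by (auto simp: wedge_dist_def le_max_iff_disj)
    qed
  qed
qed (use b c in \<open>auto simp: wedge_dist_def mdist_self mdist_commute max.commute le_max_iff_disj\<close>)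

text \<open>Either infinitely many terms lie in pieces of scale 0, which are collapsed to the base
  point, or infinitely many lie in a single one of the finitely many other pieces, which is
  compact.\<close>

lemma sequentially_compact_wedge:
  assumes W: "\<And>n. compact_metric (W n)" and b: "\<And>n. b n \<in> mspace (W n)" and fin: "finite {n. c n \<noteq> 0}"
  shows "sequentially_compact (SIGMA n:UNIV. mspace (W n)) (wedge_dist W b c)"
  unfolding sequentially_compact_def
proof (intro allI impI)
  fix \<sigma> :: "nat \<Rightarrow> nat \<times> 'a" assume "range \<sigma> \<subseteq> (SIGMA n:UNIV. mspace (W n))"
  then have \<sigma>: "snd (\<sigma> i) \<in> mspace (W (fst (\<sigma> i)))" for i
    by (metis (no_types, lifting) SigmaE range_subsetD fst_conv snd_conv)
  show "\<exists>k\<in>(SIGMA n:UNIV. mspace (W n)). \<exists>r. strict_mono r \<and> (\<lambda>i. wedge_dist W b c (\<sigma> (r i)) k) \<longlonglongrightarrow> 0"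
  proof (cases "infinite {i. c (fst (\<sigma> i)) = 0}")
    case True
    define r where "r = enumerate {i. c (fst (\<sigma> i)) = 0}"
    have r: "strict_mono r" "c (fst (\<sigma> (r i))) = 0" for i
      using enumerate_in_set[OF True, of i] strict_mono_enumerate[OF True] by (auto simp: r_def)
    \<comment> \<open>The point (0, b 0) stands for the common base point whatever c 0 is: both legs
      of the distance vanish.\<close>
    have "wedge_dist W b c (\<sigma> (r i)) (0, b 0) = 0" for i
      using r(2)[of i] b[of 0] by (auto simp: wedge_dist_def mdist_self)
    then show ?thesis using r(1) b by (intro bexI[of _ "(0, b 0)"] exI[of _ r]) auto
  next
    case False
    then have inf: "infinite {i. c (fst (\<sigma> i)) \<noteq> 0}"
      using finite_Collect_not[of "\<lambda>i. c (fst (\<sigma> i)) \<noteq> 0"] by auto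
    have "finite ((fst \<circ> \<sigma>) ` {i. c (fst (\<sigma> i)) \<noteq> 0})"
      by (rule finite_subset[OF _ fin]) auto
    then obtain i0 where i0: "infinite {i \<in> {i. c (fst (\<sigma> i)) \<noteq> 0}. (fst \<circ> \<sigma>) i = (fst \<circ> \<sigma>) i0}"
      using pigeonhole_infinite[OF inf] by blast
    define n where "n = fst (\<sigma> i0)"
    have inf': "infinite {i. fst (\<sigma> i) = n}"
      by (rule infinite_super[OF _ i0]) (auto simp: n_def)
    define r where "r = enumerate {i. fst (\<sigma> i) = n}"
    have r: "strict_mono r" "fst (\<sigma> (r i)) = n" for i
      using enumerate_in_set[OF inf', of i] strict_mono_enumerate[OF inf'] by (auto simp: r_def)
    have sc: "sequentially_compact (mspace (W n)) (mdist (W n))"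
      using W by (simp add: compact_metric_iff_sequentially_compact)
    obtain k r' where k: "k \<in> mspace (W n)" "strict_mono r'" "(\<lambda>i. mdist (W n) (snd (\<sigma> (r (r' i)))) k) \<longlonglongrightarrow> 0"
      by (rule sequentially_compactE[OF sc, of "\<lambda>i. snd (\<sigma> (r i))"]) (use \<sigma> r(2) in metis, auto)
    have "(\<lambda>i. wedge_dist W b c (\<sigma> (r (r' i))) (n, k)) \<longlonglongrightarrow> 0"
      using tendsto_mult_right_zero[OF k(3), of "c n"] by (simp add: wedge_dist_def r(2))
    then show ?thesis
      using k(1) strict_mono_o[OF r(1) k(2)] by (intro bexI[of _ "(n, k)"] exI[of _ "r \<circ> r'"]) auto
  qed
qed

lemma mdist_le_diameter:
  assumes "m_diameter m \<le> ennreal \<epsilon>" "0 \<le> \<epsilon>" "x \<in> mspace m" "y \<in> mspace m"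
  shows "mdist m x y \<le> \<epsilon>"
proof -
  have "ennreal (mdist m x y) \<le> m_diameter m"
    unfolding m_diameter_def using assms(3,4) by (intro SUP_upper2[of x] SUP_upper2[of y]) auto
  then show ?thesis using assms(1,2) by (metis ennreal_le_iff order_trans)
qed

text \<open>The image of m0 in the quotient is compact, hence closed, so the monotonicity of D on
  closed subsets applies to it.\<close>

lemma dimension_infinite_embedding:
  assumes D: "dimensional_function D" and K: "compact_pseudometric K \<rho>"
    and m0: "compact_metric m0" "D (abs_gh_space m0) = \<infinity>"
    and f: "\<And>x. x \<in> mspace m0 \<Longrightarrow> f x \<in> K" "\<And>x y. x \<in> mspace m0 \<Longrightarrow> y \<in> mspace m0 \<Longrightarrow> \<rho> (f x) (f y) = mdist m0 x y"
  shows "D (gh_class K \<rho>) = \<infinity>"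
proof -
  obtain m :: "real metric" and \<phi> where m: "compact_metric m" "quotient_map_of m K \<rho> \<phi>"
    using quotient_exists[OF K] by metis
  define A where "A = (\<phi> \<circ> f) ` mspace m0"
  have A: "A \<subseteq> mspace m" "A \<noteq> {}"
    using m(2) f(1) m0(1) by (auto simp: A_def quotient_map_of_def compact_metric_def)
  have q: "quotient_map_of (submetric m A) (mspace m0) (mdist m0) (\<phi> \<circ> f)"
    using A m(2) f by (auto simp: quotient_map_of_def A_def)
  have c: "compact_metric (submetric m A)"
    using m0(1) compact_metric_iff_quotient[OF q] compact_metric_iff_sequentially_compact[of m0] by blast
  have "compactin (mtopology_of m) A"
    using c A(1) by (simp add: compactin_subspace compact_metric_def mtopology_of_submetric)
  moreover have "Hausdorff_space (mtopology_of m)"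
    using Metric_space.Hausdorff_space_mtopology[OF Metric_space_mspace_mdist] by (simp add: mtopology_of_def)
  ultimately have "closedin (mtopology_of m) A" by (rule compactin_imp_closedin[rotated])
  then have "D (abs_gh_space (submetric m A)) \<le> D (abs_gh_space m)"
    using D m(1) A(2) by (auto simp: dimensional_function_def)
  moreover have "abs_gh_space (submetric m A) = abs_gh_space m0"
    using gh_class_eqI[OF c q] gh_class_eqI[OF m0(1) quotient_map_of_self] by simp
  ultimately show ?thesis
    using m0(2) gh_class_eqI[OF m] by (simp add: top_unique)
qed

text \<open>
  A dimensional function need not be invariant under scaling, so at every time an unscaled copy of a
  space of infinite dimension has to be present. The functions \<open>hat n\<close> cover \<open>(0, 1/2]\<close> by the sets
  where they are 1, and the slope of \<open>hat n\<close> is compensated by the small diameter of the \<open>n\<close>-th space.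
\<close>

definition hat :: "nat \<Rightarrow> real \<Rightarrow> real"
  where "hat n u = max 0 (1 - 2 ^ (n + 3) * max 0 (max (1 / 2 ^ (n + 2) - u) (u - 1 / 2 ^ (n + 1))))"

lemma hat_nonneg: "0 \<le> hat n u"
  by (simp add: hat_def)

lemma hat_lipschitz: "\<bar>hat n u - hat n v\<bar> \<le> 2 ^ (n + 3) * \<bar>u - v\<bar>"
proof -
  define a b L where "a = 1 / (2::real) ^ (n + 2)" and "b = 1 / (2::real) ^ (n + 1)" and "L = (2::real) ^ (n + 3)"
  define g where "g x = max 0 (max (a - x) (x - b))" for x
  have "\<bar>L * g u - L * g v\<bar> = L * \<bar>g u - g v\<bar>"
    by (simp add: L_def abs_mult flip: right_diff_distrib)
  also have "\<dots> \<le> L * \<bar>u - v\<bar>"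
    by (intro mult_left_mono) (auto simp: g_def L_def)
  finally have "\<bar>max 0 (1 - L * g u) - max 0 (1 - L * g v)\<bar> \<le> L * \<bar>u - v\<bar>" by linarith
  then show ?thesis unfolding hat_def a_def b_def L_def g_def .
qed

text \<open>The slope 2^(n+3) is twice what is needed to fall from 1 to 0 between 1/2^(n+2) and 0.
  This makes \<zeta> vanish at times 0 and 1.\<close>

lemma hat_0: "hat n 0 = 0"
proof -
  have "max 0 (max (1 / 2 ^ (n + 2) - 0) (0 - 1 / 2 ^ (n + 1))) = 1 / (2::real) ^ (n + 2)"
  proof -
    have "0 < 1 / (2::real) ^ (n + 2)" "0 < 1 / (2::real) ^ (n + 1)" by simp_all
    then show ?thesis by linarith
  qed
  moreover have "2 ^ (n + 3) * (1 / 2 ^ (n + 2)) = (2 :: real)" by (simp add: field_simps power_add)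
  ultimately show ?thesis unfolding hat_def by simp
qed

text \<open>\<open>hat n\<close> vanishes beyond 5/8 (1/2)^n, so only finitely many hats reach a
  given u > 0. Compactness of the wedge at interior times rests on this.\<close>

lemma hat_finite:
  assumes "u > 0"
  shows "finite {n. hat n u \<noteq> 0}"
proof -
  obtain N where N: "(1/2) ^ N < u" using real_arch_pow_inv[OF assms, of "1/2"] by auto
  have "n < N" if "hat n u \<noteq> 0" for n
  proof (rule ccontr)
    assume "\<not> n < N"
    then have "(1/2::real) ^ n \<le> (1/2) ^ N" by (intro power_decreasing) auto
    then have "u - 1 / 2 ^ (n + 1) > (1/2) ^ n - 1 / 2 ^ (n + 1)" using N by linarith
    \<comment> \<open>A point above (1/2)^n lies more than 4 / 2^(n+3) beyond the plateau, while the
      hat reaches 0 already at 1 / 2^(n+3).\<close>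
    also have "(1/2) ^ n - 1 / 2 ^ (n + 1) = 4 * (1 / (2::real) ^ (n + 3))"
      by (simp add: field_simps power_add)
    finally have "2 ^ (n + 3) * (u - 1 / 2 ^ (n + 1)) > 4"
      by (simp add: field_simps)
    also have "2 ^ (n + 3) * (u - 1 / 2 ^ (n + 1)) \<le>
        2 ^ (n + 3) * max 0 (max (1 / 2 ^ (n + 2) - u) (u - 1 / 2 ^ (n + 1)))" (is "_ \<le> ?r")
      by (intro mult_left_mono) auto
    finally have r: "4 < ?r" .
    have "max 0 (1 - r) = 0" if "4 < r" for r :: real using that by simp
    then have "hat n u = 0" unfolding hat_def using r by blast
    then show False using that by simp
  qed
  then have "{n. hat n u \<noteq> 0} \<subseteq> {..<N}" by blast
  then show ?thesis by (rule finite_subset) simp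
qed

lemma hat_eq_1:
  assumes "0 < u" "u \<le> 1/2"
  obtains n where "hat n u = 1"
proof -
  obtain N where N: "(1/2) ^ N < u" using real_arch_pow_inv[OF assms(1), of "1/2"] by auto
  define n where "n = (LEAST n. (1/2) ^ (n + 2) \<le> u)"
  have "(1/2) ^ (N + 2) \<le> u"
    by (rule order_trans[OF power_decreasing[of N] less_imp_le[OF N]]) auto
  then have 1: "(1/2) ^ (n + 2) \<le> u" unfolding n_def by (rule LeastI)
  have 2: "u \<le> (1/2) ^ (n + 1)"
  proof (cases n)
    case (Suc k)
    then have "\<not> (1/2) ^ (k + 2) \<le> u" unfolding n_def by (intro not_less_Least) simp
    then show ?thesis using Suc by simp
  qed (use assms in simp)
  have "max 0 (max (1 / 2 ^ (n + 2) - u) (u - 1 / 2 ^ (n + 1))) = 0"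
    using 1 2 by (simp add: power_one_over)
  then have "hat n u = 1" by (simp add: hat_def)
  then show thesis by (rule that)
qed

theorem infinite_dimensional_geodesics:
  assumes D: "dimensional_function D" and X: "X \<in> infinite_dimensional D" and Y: "Y \<in> infinite_dimensional D"
    and pos: "dist X Y > 0"
  shows "{\<gamma> \<in> geodesics X Y. \<gamma> ` {0..1} \<subseteq> infinite_dimensional D} \<approx> (UNIV :: nat set set)"
proof -
  define m n where "m = rep_gh_space X" and "n = rep_gh_space Y"
  obtain R where R: "R \<subseteq> mspace m \<times> mspace n" "fst ` R = mspace m" "snd ` R = mspace n"
    "\<forall>x\<in>R. \<forall>y\<in>R. \<bar>mdist m (fst x) (fst y) - mdist n (snd x) (snd y)\<bar> \<le> 2 * dist X Y"
    "sequentially_compact R (\<lambda>x y. max (mdist m (fst x) (fst y)) (mdist n (snd x) (snd y)))"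
    unfolding m_def n_def by (rule optimal_correspondence_gh_space)
  have "fst ` R \<noteq> {}"
    unfolding R(2) using rep_gh_space_compact[of X] by (simp add: compact_metric_def m_def)
  then obtain x0 where x0: "x0 \<in> R" by auto
  \<comment> \<open>The factor 2^(k+3) cancels the Lipschitz constant of \<open>hat k\<close>, so
    every piece of the wedge changes at rate at most dist X Y.\<close>
  define \<epsilon> where "\<epsilon> k = dist X Y / 2 ^ (k + 3)" for k
  have \<epsilon>: "\<epsilon> k > 0" for k using pos by (simp add: \<epsilon>_def)
  have "\<exists>w. compact_metric w \<and> D (abs_gh_space w) = \<infinity> \<and> m_diameter w \<le> ennreal (\<epsilon> k)" for k
    using D \<epsilon>[of k] unfolding dimensional_function_def by blast
  then obtain W where W: "\<And>k. compact_metric (W k)" "\<And>k. D (abs_gh_space (W k)) = \<infinity>" "\<And>k. m_diameter (W k) \<le> ennreal (\<epsilon> k)"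
    by metis
  have "\<exists>x. x \<in> mspace (W k)" for k using W(1)[of k] by (auto simp: compact_metric_def)
  then obtain b where b: "\<And>k. b k \<in> mspace (W k)" by metis
  define \<Sigma> where "\<Sigma> = (SIGMA k:UNIV. mspace (W k))"
  \<comment> \<open>The wedge \<Sigma> must stay at its true size and cannot be scaled by l; the
    two-point factor is there to carry l.\<close>
  define K where "K = R \<times> \<Sigma> \<times> (UNIV :: bool set)"
  define \<tau> :: "real \<Rightarrow> real" where "\<tau> t = min t (1 - t)" for t
  define \<omega> where "\<omega> t = wedge_dist W b (\<lambda>k. hat k (\<tau> t))" for t
  define \<eta> where "\<eta> l t x y = l * dist X Y * \<tau> t * of_bool (x \<noteq> y)" for l t and x y :: bool
  define \<zeta> where "\<zeta> l t x y = max (\<omega> t (fst (snd x)) (fst (snd y))) (\<eta> l t (snd (snd x)) (snd (snd y)))"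
    for l t and x y :: "(real \<times> real) \<times> (nat \<times> real) \<times> bool"
  have \<omega>: "pseudometric \<Sigma> (\<omega> t)" for t
    unfolding \<omega>_def \<Sigma>_def by (intro pseudometric_wedge b hat_nonneg)
  have \<tau>: "0 \<le> \<tau> t" if "t \<in> {0..1}" for t using that by (auto simp: \<tau>_def)
  have \<tau>_lip: "\<bar>\<tau> s - \<tau> t\<bar> \<le> \<bar>s - t\<bar>" for s t by (auto simp: \<tau>_def)
  have hat_diff: "\<bar>hat k (\<tau> s) * mdist (W k) u v - hat k (\<tau> t) * mdist (W k) u v\<bar> \<le> dist X Y * \<bar>s - t\<bar>"
    if "u \<in> mspace (W k)" "v \<in> mspace (W k)" for k u v s t
  proof -
    have "\<bar>hat k (\<tau> s) * mdist (W k) u v - hat k (\<tau> t) * mdist (W k) u v\<bar> = \<bar>hat k (\<tau> s) - hat k (\<tau> t)\<bar> * mdist (W k) u v"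
      by (simp add: abs_mult flip: left_diff_distrib)
    also have "\<dots> \<le> (2 ^ (k + 3) * \<bar>s - t\<bar>) * \<epsilon> k"
      using order_trans[OF hat_lipschitz[of k "\<tau> s" "\<tau> t"] mult_left_mono[OF \<tau>_lip[of s t], of "2 ^ (k + 3)"]]
        mdist_le_diameter[OF W(3) less_imp_le[OF \<epsilon>] that]
      by (intro mult_mono) auto
    also have "\<dots> = dist X Y * \<bar>s - t\<bar>" by (simp add: \<epsilon>_def)
    finally show ?thesis .
  qed
  have \<omega>_lip: "\<bar>\<omega> s x y - \<omega> t x y\<bar> \<le> dist X Y * \<bar>s - t\<bar>" if "x \<in> \<Sigma>" "y \<in> \<Sigma>" for s t x y
    using that hat_diff[of "snd x" "fst x" "snd y" s t] hat_diff[of "snd x" "fst x" "b (fst x)" s t]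
      hat_diff[of "snd y" "fst y" "b (fst y)" s t] b
    by (auto simp: \<omega>_def wedge_dist_def \<Sigma>_def)
  have \<eta>_lip: "\<bar>\<eta> l s x y - \<eta> l t x y\<bar> \<le> dist X Y * \<bar>s - t\<bar>" if "l \<in> {0<..1}" for l s t x y
  proof -
    have "\<bar>\<eta> l s x y - \<eta> l t x y\<bar> = l * dist X Y * of_bool (x \<noteq> y) * \<bar>\<tau> s - \<tau> t\<bar>"
      using that by (simp add: \<eta>_def abs_mult flip: right_diff_distrib)
    also have "\<dots> \<le> 1 * dist X Y * 1 * \<bar>s - t\<bar>"
      using that \<tau>_lip by (intro mult_mono) auto
    finally show ?thesis by simp
  qed
  have \<eta>: "pseudometric UNIV (\<eta> l t)" if "l \<in> {0<..1}" "t \<in> {0..1}" for l t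
    unfolding \<eta>_def using that \<tau> by (intro pseudometric_scale pseudometric_discrete) auto
  have "(0, b 0) \<in> \<Sigma>" using b by (simp add: \<Sigma>_def)
  then have fstK: "fst ` K = R" by (auto simp: K_def)
  have KD: "fst x \<in> R" "fst (snd x) \<in> \<Sigma>" if "x \<in> K" for x using that by (auto simp: K_def)
  interpret gh_family X Y K "\<lambda>x. fst (fst x)" "\<lambda>x. snd (fst x)" \<zeta> "(x0, (0, b 0), False)" "(x0, (0, b 0), True)"
  proof
    show "(\<lambda>x. fst (fst x)) ` K = gh_points X" "(\<lambda>x. snd (fst x)) ` K = gh_points Y"
      using R(2,3) unfolding m_def n_def fstK[symmetric] image_image by simp_all
    show "\<bar>gh_mdist X (fst (fst x)) (fst (fst y)) - gh_mdist Y (snd (fst x)) (snd (fst y))\<bar>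
        \<le> 2 * dist X Y" if "x \<in> K" "y \<in> K" for x y
      using R(4) KD[OF that(1)] KD[OF that(2)] by (simp add: m_def n_def)
    show "pseudometric K (\<zeta> l t)" if "l \<in> {0<..1}" "t \<in> {0..1}" for l t
      unfolding \<zeta>_def
      by (intro pseudometric_max pseudometric_pullback[OF \<omega>, of _ "\<lambda>x. fst (snd x)"]
          pseudometric_pullback[OF \<eta>[OF that], of _ "\<lambda>x. snd (snd x)"]) (auto simp: KD)
    show "\<bar>\<zeta> l s x y - \<zeta> l t x y\<bar> \<le> 2 * dist X Y * \<bar>s - t\<bar>"
      if "l \<in> {0<..1}" "s \<in> {0..1}" "t \<in> {0..1}" "x \<in> K" "y \<in> K" for l s t x y
      using \<omega>_lip[OF KD(2)[OF that(4)] KD(2)[OF that(5)], of s t] \<eta>_lip[OF that(1), of s "snd (snd x)" "snd (snd y)" t]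
      unfolding \<zeta>_def by linarith
    show "\<zeta> l 0 x y = 0" "\<zeta> l 1 x y = 0" for l x y
      by (simp_all add: \<zeta>_def \<omega>_def \<eta>_def \<tau>_def wedge_dist_def hat_0)
    show "\<zeta> l (1/2) x y \<le> \<zeta> l' (1/2) x y" if "0 < l" "l \<le> l'" for l l' x y
      unfolding \<zeta>_def \<eta>_def using that by (intro max.mono order_refl mult_right_mono \<tau>) auto
    show "(x0, (0, b 0), False) \<in> K" "(x0, (0, b 0), True) \<in> K"
      using x0 b by (auto simp: K_def \<Sigma>_def)
    show "inj_on (\<lambda>l. \<zeta> l (1/2) (x0, (0, b 0), False) (x0, (0, b 0), True)) {0<..1}"
      using pos b by (auto simp: inj_on_def \<zeta>_def \<eta>_def \<omega>_def wedge_dist_def mdist_self \<tau>_def max_def split: if_splits)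
  qed (use pos in auto)
  have base: "sequentially_compact K (\<lambda>x y. max (max (mdist m (fst (fst x)) (fst (fst y))) (mdist n (snd (fst x)) (snd (fst y))))
      (max (\<omega> t (fst (snd x)) (fst (snd y))) (of_bool (snd (snd x) \<noteq> snd (snd y)))))" if "t \<in> {0<..<1}" for t
    unfolding K_def \<Sigma>_def \<omega>_def
    by (intro sequentially_compact_Times[OF R(5)]
        sequentially_compact_Times[where \<alpha> = "wedge_dist W b (\<lambda>k. hat k (\<tau> t))" and \<beta> = "\<lambda>x y. of_bool (x \<noteq> y)"]
        sequentially_compact_wedge W b hat_finite sequentially_compact_finite) (use that in \<open>auto simp: \<tau>_def\<close>)
  interpret compact_gh_family X Y K "\<lambda>x. fst (fst x)" "\<lambda>x. snd (fst x)" \<zeta> "(x0, (0, b 0), False)" "(x0, (0, b 0), True)"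
  proof
    show "sequentially_compact K (\<rho> l t)" if l: "l \<in> {0<..1}" and t: "t \<in> {0<..<1}" for l t
    proof (rule sequentially_compact_mono[OF base[OF t]])
      fix x y assume xy: "x \<in> K" "y \<in> K"
      show "0 \<le> \<rho> l t x y" using pseudometricD(2)[OF pseudometric_\<rho>[OF l] xy] t by simp
      define d e where "d = mdist m (fst (fst x)) (fst (fst y))" and "e = mdist n (snd (fst x)) (snd (fst y))"
      define o1 z where "o1 = \<omega> t (fst (snd x)) (fst (snd y))" and "z = (of_bool (snd (snd x) \<noteq> snd (snd y)) :: real)"
      \<comment> \<open>All parts of \<rho> except \<eta> are bounded by the product distance
        itself, and \<eta> by dist X Y times it.\<close>
      define C where "C = 1 + dist X Y"
      have C: "C \<ge> 1" by (simp add: C_def)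
      have M: "0 \<le> max (max d e) (max o1 z)" by (auto simp: d_def le_max_iff_disj)
      have "(1 - t) * d + t * e \<le> max d e"
        using t by (intro convex_bound_le) auto
      then have 1: "(1 - t) * d + t * e \<le> max (max d e) (max o1 z)" by linarith
      have "l * dist X Y * \<tau> t * z \<le> 1 * dist X Y * 1 * z"
        using l t \<tau>[of t] by (intro mult_mono mult_nonneg_nonneg) (auto simp: z_def \<tau>_def)
      also have "\<dots> \<le> C * max (max d e) (max o1 z)"
        using C M by (intro mult_mono) (auto simp: C_def z_def)
      finally have 2: "\<eta> l t (snd (snd x)) (snd (snd y)) \<le> C * max (max d e) (max o1 z)"
        by (simp add: \<eta>_def z_def)
      have 3: "r \<le> C * max (max d e) (max o1 z)" if "r \<le> max (max d e) (max o1 z)" for r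
        by (rule order_trans[OF that]) (use mult_right_mono[OF C M] in \<open>simp only: mult_1\<close>)
      have "\<rho> l t x y \<le> C * max (max d e) (max o1 z)"
        using 3[OF 1] 2 3[of o1] unfolding \<rho>_def \<zeta>_def m_def[symmetric] n_def[symmetric] d_def[symmetric] e_def[symmetric] o1_def[symmetric]
        by simp
      then show "\<rho> l t x y \<le> C * max (max (mdist m (fst (fst x)) (fst (fst y))) (mdist n (snd (fst x)) (snd (fst y))))
          (max (\<omega> t (fst (snd x)) (fst (snd y))) (of_bool (snd (snd x) \<noteq> snd (snd y))))"
        by (simp add: d_def e_def o1_def z_def)
    qed
  qed
  show ?thesis
  proof (rule geodesics_eqpoll_continuum[OF X Y])
    fix l t :: real assume l: "l \<in> {0<..1}" and t: "t \<in> {0<..<1}"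
    have "0 < \<tau> t" "\<tau> t \<le> 1/2" using t by (auto simp: \<tau>_def min_def)
    then obtain k where k: "hat k (\<tau> t) = 1" using hat_eq_1 by blast
    have "D (gh_class K (\<rho> l t)) = \<infinity>"
    proof (rule dimension_infinite_embedding[OF D compact_\<rho> W(1,2)])
      \<comment> \<open>With the point x0 of R and the bit fixed, only the wedge contributes to
        \<rho>, and where \<open>hat k\<close> is 1 it reproduces the metric of W k exactly.\<close>
      show "(x0, (k, w), False) \<in> K" if "w \<in> mspace (W k)" for w
        using that x0 by (auto simp: K_def \<Sigma>_def)
      show "\<rho> l t (x0, (k, w), False) (x0, (k, w'), False) = mdist (W k) w w'" for w w'
        using x0 R(1) k by (auto simp: \<rho>_def \<zeta>_def \<omega>_def \<eta>_def wedge_dist_def m_def n_def mdist_self)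
    qed (use l t in auto)
    then show "gh_class K (\<rho> l t) \<in> infinite_dimensional D" by (simp add: infinite_dimensional_def)
  qed
qed

section \<open>Doubling, uniform disconnectedness and uniform perfectness of pseudometrics\<close>

text \<open>The three notions are formulated for a distance function on K itself, so that they can
  be decided before points at distance 0 are identified.\<close>

definition pm_doubling :: "'k set \<Rightarrow> ('k \<Rightarrow> 'k \<Rightarrow> real) \<Rightarrow> bool"
  where "pm_doubling K \<alpha> \<longleftrightarrow> (\<exists>N. \<forall>x\<in>K. \<forall>r>0. \<exists>F\<subseteq>K. finite F \<and> card F \<le> N \<and>
    (\<forall>y\<in>K. \<alpha> x y \<le> r \<longrightarrow> (\<exists>z\<in>F. \<alpha> z y \<le> r / 2)))"

text \<open>An arbitrary bound s on the steps replaces their maximum; this also admits constant and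
  one-term sequences, for which there may be no maximum.\<close>

definition pm_uniformly_disconnected :: "'k set \<Rightarrow> ('k \<Rightarrow> 'k \<Rightarrow> real) \<Rightarrow> bool"
  where "pm_uniformly_disconnected K \<alpha> \<longleftrightarrow> (\<exists>\<delta>>0. \<forall>(n::nat) z s. (\<forall>i\<le>n. z i \<in> K) \<longrightarrow> 0 \<le> s \<longrightarrow>
    (\<forall>i<n. \<alpha> (z i) (z (Suc i)) \<le> s) \<longrightarrow> \<delta> * \<alpha> (z 0) (z n) \<le> s)"

text \<open>The condition that r is less than the diameter is expressed by two points, which avoids
  extended-real suprema.\<close>

definition pm_uniformly_perfect :: "'k set \<Rightarrow> ('k \<Rightarrow> 'k \<Rightarrow> real) \<Rightarrow> bool"
  where "pm_uniformly_perfect K \<alpha> \<longleftrightarrow> (\<exists>c\<in>{0<..<1}. \<forall>x\<in>K. \<forall>r>0. (\<exists>u\<in>K. \<exists>v\<in>K. r < \<alpha> u v) \<longrightarrow>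
    (\<exists>y\<in>K. c * r \<le> \<alpha> x y \<and> \<alpha> x y \<le> r))"

section \<open>Invariance of the three notions under quotients\<close>

lemma doubling_iff_pm: "doubling m \<longleftrightarrow> pm_doubling (mspace m) (mdist m)"
proof -
  have "mcball_of m x r \<subseteq> (\<Union>y\<in>F. mcball_of m y (r / 2)) \<longleftrightarrow>
      (\<forall>y\<in>mspace m. mdist m x y \<le> r \<longrightarrow> (\<exists>z\<in>F. mdist m z y \<le> r / 2))"
    if "x \<in> mspace m" "F \<subseteq> mspace m" for x r F
    using that by (auto simp: subset_iff)
  then show ?thesis
    unfolding doubling_def doubling_with_def pm_doubling_def
    by (intro ex_cong1 ball_cong all_cong refl) (metis (no_types, lifting))
qed

lemma uniformly_disconnected_iff_pm: "uniformly_disconnected m \<longleftrightarrow> pm_uniformly_disconnected (mspace m) (mdist m)"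
proof -
  have "uniformly_disconnected_with m \<delta> \<longleftrightarrow> (\<forall>(n::nat) z s. (\<forall>i\<le>n. z i \<in> mspace m) \<longrightarrow> 0 \<le> s \<longrightarrow>
      (\<forall>i<n. mdist m (z i) (z (Suc i)) \<le> s) \<longrightarrow> \<delta> * mdist m (z 0) (z n) \<le> s)" (is "_ \<longleftrightarrow> ?R") for \<delta>
  proof
    assume ud: "uniformly_disconnected_with m \<delta>"
    show ?R
    proof (intro allI impI)
      fix n :: nat and z s
      assume z: "\<forall>i\<le>n. z i \<in> mspace m" and s: "0 \<le> s" "\<forall>i<n. mdist m (z i) (z (Suc i)) \<le> s"
      show "\<delta> * mdist m (z 0) (z n) \<le> s"
      proof (cases "z 0 = z n")
        case True
        then show ?thesis using z s(1) by (simp add: mdist_self)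
      next
        case False
        then have n: "n > 0" by (metis gr0I)
        have mem: "\<forall>i\<in>{1..n + 1}. z (i - 1) \<in> mspace m" using z by auto
        have "\<exists>i\<in>{1..n + 1}. \<exists>j\<in>{1..n + 1}. z (i - 1) \<noteq> z (j - 1)"
          using False by (intro bexI[of _ 1] bexI[of _ "n + 1"]) auto
        then have "\<delta> * mdist m (z (1 - 1)) (z (n + 1 - 1)) \<le> (MAX i\<in>{1..n + 1 - 1}. mdist m (z (i - 1)) (z (i + 1 - 1)))"
          using ud[unfolded uniformly_disconnected_with_def, rule_format, of "n + 1" "\<lambda>i. z (i - 1)"] mem by blast
        also have "\<dots> \<le> s"
        proof (intro Max.boundedI)
          fix a assume "a \<in> (\<lambda>i. mdist m (z (i - 1)) (z (i + 1 - 1))) ` {1..n + 1 - 1}"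
          then obtain i where i: "i \<in> {1..n}" "a = mdist m (z (i - 1)) (z i)" by auto
          then have "i - 1 < n" "Suc (i - 1) = i" by auto
          then show "a \<le> s" using s(2) i(2) by metis
        qed (use n in auto)
        finally show ?thesis by simp
      qed
    qed
  next
    assume R: ?R
    show "uniformly_disconnected_with m \<delta>"
      unfolding uniformly_disconnected_with_def
    proof (intro allI impI, elim conjE)
      fix N :: nat and z
      assume z: "\<forall>i\<in>{1..N}. z i \<in> mspace m" and ne: "\<exists>i\<in>{1..N}. \<exists>j\<in>{1..N}. z i \<noteq> z j"
      have N: "N \<ge> 2"
      proof (rule ccontr)
        assume "\<not> N \<ge> 2"
        then have "{1..N} \<subseteq> {1}" by auto
        then show False using ne by auto
      qed
      define s where "s = (MAX i\<in>{1..N - 1}. mdist m (z i) (z (i + 1)))"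
      have le: "mdist m (z (i + 1)) (z (Suc i + 1)) \<le> s" if "i < N - 1" for i
        unfolding s_def using that by (intro Max_ge) (auto intro!: image_eqI[of _ _ "i + 1"])
      have "0 \<le> s" using order_trans[OF mdist_nonneg le[of 0]] N by simp
      then have "\<delta> * mdist m (z (0 + 1)) (z (N - 1 + 1)) \<le> s"
        using R[rule_format, of "N - 1" "\<lambda>i. z (i + 1)" s] le z N by auto
      then show "\<delta> * mdist m (z 1) (z N) \<le> s" using N by simp
    qed
  qed
  then show ?thesis
    unfolding uniformly_disconnected_def pm_uniformly_disconnected_def by simp
qed

lemma uniformly_perfect_iff_pm: "uniformly_perfect m \<longleftrightarrow> pm_uniformly_perfect (mspace m) (mdist m)"
proof -
  have "ennreal r < m_diameter m \<longleftrightarrow> (\<exists>u\<in>mspace m. \<exists>v\<in>mspace m. r < mdist m u v)" if "r > 0" for r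
    using that by (simp add: m_diameter_def less_SUP_iff ennreal_less_iff)
  then show ?thesis
    by (simp add: uniformly_perfect_def uniformly_perfect_with_def pm_uniformly_perfect_def)
qed

text \<open>The hypotheses hold both for a quotient map with a section and with the roles of the two
  exchanged, so one lemma yields both directions of \<open>pm_properties_quotient\<close>. The
  adjunction \<open>adj\<close> carries ball centres and witnesses across.\<close>

lemma pm_properties_transfer:
  assumes f: "\<And>x. x \<in> K \<Longrightarrow> f x \<in> L" and g: "\<And>y. y \<in> L \<Longrightarrow> g y \<in> K"
    and iso: "\<And>y y'. y \<in> L \<Longrightarrow> y' \<in> L \<Longrightarrow> \<alpha> (g y) (g y') = \<beta> y y'"
    and adj: "\<And>x y. x \<in> K \<Longrightarrow> y \<in> L \<Longrightarrow> \<alpha> x (g y) = \<beta> (f x) y" "\<And>x y. x \<in> K \<Longrightarrow> y \<in> L \<Longrightarrow> \<alpha> (g y) x = \<beta> y (f x)"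
  shows "pm_doubling K \<alpha> \<Longrightarrow> pm_doubling L \<beta>"
    and "pm_uniformly_disconnected K \<alpha> \<Longrightarrow> pm_uniformly_disconnected L \<beta>"
    and "pm_uniformly_perfect K \<alpha> \<Longrightarrow> pm_uniformly_perfect L \<beta>"
proof -
  show "pm_doubling L \<beta>" if "pm_doubling K \<alpha>"
  proof -
    obtain N where N: "\<And>x r. x \<in> K \<Longrightarrow> r > 0 \<Longrightarrow> \<exists>F\<subseteq>K. finite F \<and> card F \<le> N \<and>
        (\<forall>y\<in>K. \<alpha> x y \<le> r \<longrightarrow> (\<exists>z\<in>F. \<alpha> z y \<le> r / 2))"
      using \<open>pm_doubling K \<alpha>\<close> unfolding pm_doubling_def by metis
    show ?thesis
      unfolding pm_doubling_def
    proof (intro exI[of _ N] ballI allI impI)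
      fix x r assume x: "x \<in> L" and r: "(r::real) > 0"
      obtain F where F: "F \<subseteq> K" "finite F" "card F \<le> N"
          "\<And>y. y \<in> K \<Longrightarrow> \<alpha> (g x) y \<le> r \<Longrightarrow> \<exists>z\<in>F. \<alpha> z y \<le> r / 2"
        using N[OF g[OF x] r] by metis
      have "\<exists>z\<in>f ` F. \<beta> z y \<le> r / 2" if y: "y \<in> L" "\<beta> x y \<le> r" for y
      proof -
        obtain z where "z \<in> F" "\<alpha> z (g y) \<le> r / 2" using F(4)[OF g[OF y(1)]] iso[OF x y(1)] y(2) by auto
        then show ?thesis using adj(1)[of z y] F(1) y(1) by (intro bexI[of _ "f z"]) auto
      qed
      moreover have "f ` F \<subseteq> L" using F(1) f by auto
      moreover have "card (f ` F) \<le> N" using card_image_le[OF F(2), of f] F(3) by linarith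
      ultimately show "\<exists>F\<subseteq>L. finite F \<and> card F \<le> N \<and> (\<forall>y\<in>L. \<beta> x y \<le> r \<longrightarrow> (\<exists>z\<in>F. \<beta> z y \<le> r / 2))"
        using F(2) by (intro exI[of _ "f ` F"]) auto
    qed
  qed
  show "pm_uniformly_disconnected L \<beta>" if "pm_uniformly_disconnected K \<alpha>"
  proof -
    obtain \<delta> where \<delta>: "\<delta> > 0" "\<And>n z s. (\<forall>i\<le>n. z i \<in> K) \<Longrightarrow> 0 \<le> s \<Longrightarrow>
        (\<forall>i<n. \<alpha> (z i) (z (Suc i)) \<le> s) \<Longrightarrow> \<delta> * \<alpha> (z 0) (z (n::nat)) \<le> s"
      using \<open>pm_uniformly_disconnected K \<alpha>\<close> unfolding pm_uniformly_disconnected_def by metis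
    show ?thesis
      unfolding pm_uniformly_disconnected_def
    proof (intro exI[of _ \<delta>] conjI \<delta>(1) allI impI)
      fix n :: nat and z s
      assume z: "\<forall>i\<le>n. z i \<in> L" "0 \<le> s" "\<forall>i<n. \<beta> (z i) (z (Suc i)) \<le> s"
      then have "\<delta> * \<alpha> (g (z 0)) (g (z n)) \<le> s"
        using \<delta>(2)[of n "\<lambda>i. g (z i)" s] g iso by simp
      then show "\<delta> * \<beta> (z 0) (z n) \<le> s" using z(1) iso by simp
    qed
  qed
  show "pm_uniformly_perfect L \<beta>" if "pm_uniformly_perfect K \<alpha>"
  proof -
    obtain c where c: "c \<in> {0<..<1}" "\<And>x r. x \<in> K \<Longrightarrow> r > 0 \<Longrightarrow> \<exists>u\<in>K. \<exists>v\<in>K. r < \<alpha> u v \<Longrightarrow>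
        \<exists>y\<in>K. c * r \<le> \<alpha> x y \<and> \<alpha> x y \<le> r"
      using \<open>pm_uniformly_perfect K \<alpha>\<close> unfolding pm_uniformly_perfect_def by metis
    show ?thesis
      unfolding pm_uniformly_perfect_def
    proof (intro bexI[OF _ c(1)] ballI allI impI)
      fix x and r :: real assume x: "x \<in> L" and r: "r > 0" "\<exists>u\<in>L. \<exists>v\<in>L. r < \<beta> u v"
      then have "\<exists>u\<in>K. \<exists>v\<in>K. r < \<alpha> u v" using iso g by metis
      then obtain y where "y \<in> K" "c * r \<le> \<alpha> (g x) y \<and> \<alpha> (g x) y \<le> r"
        using c(2)[OF g[OF x] r(1)] by blast
      then show "\<exists>y\<in>L. c * r \<le> \<beta> x y \<and> \<beta> x y \<le> r" using adj(2)[of y x] f x by auto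
    qed
  qed
qed

lemma pm_properties_quotient:
  assumes "quotient_map_of m K \<alpha> \<phi>"
  shows "doubling m \<longleftrightarrow> pm_doubling K \<alpha>"
    and "uniformly_disconnected m \<longleftrightarrow> pm_uniformly_disconnected K \<alpha>"
    and "uniformly_perfect m \<longleftrightarrow> pm_uniformly_perfect K \<alpha>"
proof -
  define g where "g = inv_into K \<phi>"
  have \<phi>: "\<And>x. x \<in> K \<Longrightarrow> \<phi> x \<in> mspace m" "\<And>x y. x \<in> K \<Longrightarrow> y \<in> K \<Longrightarrow> mdist m (\<phi> x) (\<phi> y) = \<alpha> x y"
    using assms by (auto simp: quotient_map_of_def)
  have g: "g y \<in> K" "\<phi> (g y) = y" if "y \<in> mspace m" for y
    using that assms by (auto simp: g_def quotient_map_of_def inv_into_into f_inv_into_f)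
  have *: "\<alpha> x (g y) = mdist m (\<phi> x) y" "\<alpha> (g y) x = mdist m y (\<phi> x)" if "x \<in> K" "y \<in> mspace m" for x y
    using \<phi>(2)[of x "g y"] \<phi>(2)[of "g y" x] g[OF that(2)] that(1) by simp_all
  have iso: "\<alpha> (g y) (g y') = mdist m y y'" if "y \<in> mspace m" "y' \<in> mspace m" for y y'
    using *[OF g(1)[OF that(1)] that(2)] g(2)[OF that(1)] by simp
  have **: "mdist m y (\<phi> x) = \<alpha> (g y) x" "mdist m (\<phi> x) y = \<alpha> x (g y)" if "y \<in> mspace m" "x \<in> K" for x y
    using * that by simp_all
  note t1 = pm_properties_transfer[of K \<phi> "mspace m" g \<alpha> "mdist m", OF \<phi>(1) g(1) iso *]
  note t2 = pm_properties_transfer[of "mspace m" g K \<phi> "mdist m" \<alpha>, OF g(1) \<phi>(1) \<phi>(2) **]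
  show "doubling m \<longleftrightarrow> pm_doubling K \<alpha>"
    unfolding doubling_iff_pm using t1(1) t2(1) by blast
  show "uniformly_disconnected m \<longleftrightarrow> pm_uniformly_disconnected K \<alpha>"
    unfolding uniformly_disconnected_iff_pm using t1(2) t2(2) by blast
  show "uniformly_perfect m \<longleftrightarrow> pm_uniformly_perfect K \<alpha>"
    unfolding uniformly_perfect_iff_pm using t1(3) t2(3) by blast
qed

text \<open>Membership only provides some representative with P. Every representative of the class
  is again a quotient of K, and on quotients P is decided by Q.\<close>

lemma gh_class_in_gh_spaces_with:
  assumes K: "compact_pseudometric K \<alpha>" and P: "\<And>m \<phi>. quotient_map_of m K \<alpha> \<phi> \<Longrightarrow> P m \<longleftrightarrow> Q"
  shows "gh_class K \<alpha> \<in> gh_spaces_with P \<longleftrightarrow> Q"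
proof -
  obtain m :: "real metric" and \<phi> where m: "compact_metric m" "quotient_map_of m K \<alpha> \<phi>"
    using quotient_exists[OF K] by metis
  have eq: "gh_class K \<alpha> = abs_gh_space m" by (rule gh_class_eqI[OF m])
  show ?thesis
  proof
    assume "gh_class K \<alpha> \<in> gh_spaces_with P"
    then obtain m' where m': "compact_metric m'" "P m'" "abs_gh_space m = abs_gh_space m'"
      by (auto simp: gh_spaces_with_def eq)
    then have "isometric m m'" using m(1) by (simp add: gh_class_eq_iff)
    then show Q using quotient_map_of_trans[OF m(2)] P m'(2) by blast
  next
    assume Q
    then show "gh_class K \<alpha> \<in> gh_spaces_with P"
      using P[OF m(2)] m(1) by (auto simp: gh_spaces_with_def eq)
  qed
qed

lemma gh_class_properties:
  assumes "compact_pseudometric K \<alpha>"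
  shows "gh_class K \<alpha> \<in> gh_spaces_with doubling \<longleftrightarrow> pm_doubling K \<alpha>"
    and "gh_class K \<alpha> \<in> gh_spaces_with uniformly_disconnected \<longleftrightarrow> pm_uniformly_disconnected K \<alpha>"
    and "gh_class K \<alpha> \<in> gh_spaces_with uniformly_perfect \<longleftrightarrow> pm_uniformly_perfect K \<alpha>"
  by (rule gh_class_in_gh_spaces_with[OF assms]; erule pm_properties_quotient)+

lemma gh_space_as_class:
  "compact_pseudometric (gh_points X) (gh_mdist X)"
  "gh_class (gh_points X) (gh_mdist X) = X"
  using rep_gh_space_compact[of X] gh_class_rep[OF quotient_map_of_self]
  by (simp_all add: compact_pseudometric_def compact_metric_iff_sequentially_compact pseudometric_mdist)

text \<open>Doubling and uniform disconnectedness are inherited from X and Y; uniform perfectness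
  will instead be supplied by the factor of binary sequences.\<close>

lemma pullback_properties:
  assumes "p ` K = gh_points X"
  shows "X \<in> gh_spaces_with doubling \<longleftrightarrow> pm_doubling K (\<lambda>x y. gh_mdist X (p x) (p y))"
    and "X \<in> gh_spaces_with uniformly_disconnected \<longleftrightarrow> pm_uniformly_disconnected K (\<lambda>x y. gh_mdist X (p x) (p y))"
proof -
  have q: "quotient_map_of (rep_gh_space X) K (\<lambda>x y. gh_mdist X (p x) (p y)) p"
    using assms by (simp add: quotient_map_of_def)
  show "X \<in> gh_spaces_with doubling \<longleftrightarrow> pm_doubling K (\<lambda>x y. gh_mdist X (p x) (p y))"
    using gh_class_properties(1)[OF gh_space_as_class(1)[of X]] pm_properties_quotient(1)[OF q]
    by (simp add: gh_space_as_class(2) doubling_iff_pm)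
  show "X \<in> gh_spaces_with uniformly_disconnected \<longleftrightarrow> pm_uniformly_disconnected K (\<lambda>x y. gh_mdist X (p x) (p y))"
    using gh_class_properties(2)[OF gh_space_as_class(1)[of X]] pm_properties_quotient(2)[OF q]
    by (simp add: gh_space_as_class(2) uniformly_disconnected_iff_pm)
qed

section \<open>Permanence of doubling\<close>

lemma pm_doubling_iterate:
  assumes "pm_doubling K \<alpha>"
  shows "\<exists>N. \<forall>x\<in>K. \<forall>r>0. \<exists>F\<subseteq>K. finite F \<and> card F \<le> N \<and> (\<forall>y\<in>K. \<alpha> x y \<le> r \<longrightarrow> (\<exists>z\<in>F. \<alpha> z y \<le> r / 2 ^ j))"
proof (induction j)
  case 0
  show ?case
    by (rule exI[of _ 1]) (auto intro!: exI[of _ "{x}" for x])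
next
  case (Suc j)
  then obtain M where M: "\<And>x r. x \<in> K \<Longrightarrow> r > 0 \<Longrightarrow> \<exists>F\<subseteq>K. finite F \<and> card F \<le> M \<and>
      (\<forall>y\<in>K. \<alpha> x y \<le> r \<longrightarrow> (\<exists>z\<in>F. \<alpha> z y \<le> r / 2 ^ j))" by metis
  obtain N where N: "\<And>x r. x \<in> K \<Longrightarrow> r > 0 \<Longrightarrow> \<exists>F\<subseteq>K. finite F \<and> card F \<le> N \<and>
      (\<forall>y\<in>K. \<alpha> x y \<le> r \<longrightarrow> (\<exists>z\<in>F. \<alpha> z y \<le> r / 2))"
    using assms unfolding pm_doubling_def by metis
  show ?case
  proof (intro exI[of _ "M * N"] ballI allI impI)
    fix x and r :: real assume x: "x \<in> K" and r: "r > 0"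
    obtain F where F: "F \<subseteq> K" "finite F" "card F \<le> M" "\<And>y. y \<in> K \<Longrightarrow> \<alpha> x y \<le> r \<Longrightarrow> \<exists>z\<in>F. \<alpha> z y \<le> r / 2 ^ j"
      using M[OF x r] by metis
    have "\<forall>z\<in>F. \<exists>G\<subseteq>K. finite G \<and> card G \<le> N \<and> (\<forall>y\<in>K. \<alpha> z y \<le> r / 2 ^ j \<longrightarrow> (\<exists>z\<in>G. \<alpha> z y \<le> r / 2 ^ j / 2))"
    proof
      fix z assume "z \<in> F"
      then have "z \<in> K" using F(1) by auto
      moreover have "r / 2 ^ j > 0" using r by simp
      ultimately show "\<exists>G\<subseteq>K. finite G \<and> card G \<le> N \<and> (\<forall>y\<in>K. \<alpha> z y \<le> r / 2 ^ j \<longrightarrow> (\<exists>z\<in>G. \<alpha> z y \<le> r / 2 ^ j / 2))"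
        by (rule N)
    qed
    then obtain G where G: "\<And>z. z \<in> F \<Longrightarrow> G z \<subseteq> K" "\<And>z. z \<in> F \<Longrightarrow> finite (G z)" "\<And>z. z \<in> F \<Longrightarrow> card (G z) \<le> N"
        "\<And>z y. z \<in> F \<Longrightarrow> y \<in> K \<Longrightarrow> \<alpha> z y \<le> r / 2 ^ j \<Longrightarrow> \<exists>w\<in>G z. \<alpha> w y \<le> r / 2 ^ j / 2"
      by metis
    have "card (\<Union>z\<in>F. G z) \<le> (\<Sum>z\<in>F. card (G z))" by (rule card_UN_le[OF F(2)])
    also have "\<dots> \<le> card F * N" using sum_bounded_above[of F "\<lambda>z. card (G z)" N] G(3) by simp
    also have "\<dots> \<le> M * N" using F(3) by simp
    finally have "card (\<Union>z\<in>F. G z) \<le> M * N" .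
    moreover have "\<exists>w\<in>(\<Union>z\<in>F. G z). \<alpha> w y \<le> r / 2 ^ Suc j" if "y \<in> K" "\<alpha> x y \<le> r" for y
      using F(4)[OF that] G(4)[OF _ that(1)] by (force simp: field_simps)
    ultimately show "\<exists>F\<subseteq>K. finite F \<and> card F \<le> M * N \<and> (\<forall>y\<in>K. \<alpha> x y \<le> r \<longrightarrow> (\<exists>z\<in>F. \<alpha> z y \<le> r / 2 ^ Suc j))"
      using F(2) G(1,2) by (intro exI[of _ "\<Union>z\<in>F. G z"]) auto
  qed
qed

lemma pm_doubling_bilipschitz:
  assumes d: "pm_doubling K \<alpha>"
    and le: "\<And>x y. x \<in> K \<Longrightarrow> y \<in> K \<Longrightarrow> \<alpha> x y \<le> C * \<beta> x y" "\<And>x y. x \<in> K \<Longrightarrow> y \<in> K \<Longrightarrow> \<beta> x y \<le> C' * \<alpha> x y"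
    and C: "C > 0" "C' > 0"
  shows "pm_doubling K \<beta>"
proof -
  \<comment> \<open>A \<beta>-ball of radius r lies in an \<alpha>-ball of radius C r. Pieces of
    \<alpha>-radius C r / 2^j have \<beta>-radius at most C C' r / 2^j, which must not exceed
    r/2.\<close>
  obtain j where j: "2 * C * C' < 2 ^ j" using real_arch_pow[of 2 "2 * C * C'"] by auto
  obtain N where N: "\<And>x r. x \<in> K \<Longrightarrow> r > 0 \<Longrightarrow> \<exists>F\<subseteq>K. finite F \<and> card F \<le> N \<and>
      (\<forall>y\<in>K. \<alpha> x y \<le> r \<longrightarrow> (\<exists>z\<in>F. \<alpha> z y \<le> r / 2 ^ j))"
    using pm_doubling_iterate[OF d, of j] by metis
  show ?thesis
    unfolding pm_doubling_def
  proof (intro exI[of _ N] ballI allI impI)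
    fix x and r :: real assume x: "x \<in> K" and r: "r > 0"
    obtain F where F: "F \<subseteq> K" "finite F" "card F \<le> N" "\<And>y. y \<in> K \<Longrightarrow> \<alpha> x y \<le> C * r \<Longrightarrow> \<exists>z\<in>F. \<alpha> z y \<le> C * r / 2 ^ j"
      using N[OF x, of "C * r"] C r by (metis mult_pos_pos)
    have "\<exists>z\<in>F. \<beta> z y \<le> r / 2" if y: "y \<in> K" "\<beta> x y \<le> r" for y
    proof -
      have "\<alpha> x y \<le> C * r" using le(1)[OF x y(1)] mult_left_mono[OF y(2), of C] C by linarith
      then obtain z where z: "z \<in> F" "\<alpha> z y \<le> C * r / 2 ^ j" using F(4) y by blast
      then have "\<beta> z y \<le> C' * (C * r / 2 ^ j)"
        using le(2)[of z y] F(1) y(1) mult_left_mono[OF z(2), of C'] C by auto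
      also have "\<dots> \<le> r / 2" using j r mult_right_mono[OF less_imp_le[OF j], of r] by (simp add: field_simps)
      finally show ?thesis using z(1) by blast
    qed
    then show "\<exists>F\<subseteq>K. finite F \<and> card F \<le> N \<and> (\<forall>y\<in>K. \<beta> x y \<le> r \<longrightarrow> (\<exists>z\<in>F. \<beta> z y \<le> r / 2))"
      using F by blast
  qed
qed

text \<open>The ball is covered by intersections of an \<alpha>-ball and a \<beta>-ball. Each
  intersection that meets K is recentred at one of its own points, which doubles the radius; hence
  the balls of radius r/4.\<close>

lemma pm_doubling_max:
  assumes "pm_doubling K \<alpha>" "pm_doubling K \<beta>" "pseudometric K \<alpha>" "pseudometric K \<beta>"
  shows "pm_doubling K (\<lambda>x y. max (\<alpha> x y) (\<beta> x y))"
proof -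
  obtain M where M: "\<And>x r. x \<in> K \<Longrightarrow> r > 0 \<Longrightarrow> \<exists>F\<subseteq>K. finite F \<and> card F \<le> M \<and>
      (\<forall>y\<in>K. \<alpha> x y \<le> r \<longrightarrow> (\<exists>z\<in>F. \<alpha> z y \<le> r / 2 ^ 2))"
    using pm_doubling_iterate[OF assms(1), of 2] by metis
  obtain N where N: "\<And>x r. x \<in> K \<Longrightarrow> r > 0 \<Longrightarrow> \<exists>F\<subseteq>K. finite F \<and> card F \<le> N \<and>
      (\<forall>y\<in>K. \<beta> x y \<le> r \<longrightarrow> (\<exists>z\<in>F. \<beta> z y \<le> r / 2 ^ 2))"
    using pm_doubling_iterate[OF assms(2), of 2] by metis
  show ?thesis
    unfolding pm_doubling_def
  proof (intro exI[of _ "M * N"] ballI allI impI)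
    fix x and r :: real assume x: "x \<in> K" and r: "r > 0"
    obtain F where F: "F \<subseteq> K" "finite F" "card F \<le> M" "\<And>y. y \<in> K \<Longrightarrow> \<alpha> x y \<le> r \<Longrightarrow> \<exists>z\<in>F. \<alpha> z y \<le> r / 4"
      using M[OF x r] by auto
    obtain G where G: "G \<subseteq> K" "finite G" "card G \<le> N" "\<And>y. y \<in> K \<Longrightarrow> \<beta> x y \<le> r \<Longrightarrow> \<exists>z\<in>G. \<beta> z y \<le> r / 4"
      using N[OF x r] by auto
    define w where "w ab = (SOME y. y \<in> K \<and> \<alpha> (fst ab) y \<le> r / 4 \<and> \<beta> (snd ab) y \<le> r / 4)" for ab
    define H where "H = w ` {ab \<in> F \<times> G. \<exists>y\<in>K. \<alpha> (fst ab) y \<le> r / 4 \<and> \<beta> (snd ab) y \<le> r / 4}"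
    have w: "w ab \<in> K \<and> \<alpha> (fst ab) (w ab) \<le> r / 4 \<and> \<beta> (snd ab) (w ab) \<le> r / 4"
      if "\<exists>y\<in>K. \<alpha> (fst ab) y \<le> r / 4 \<and> \<beta> (snd ab) y \<le> r / 4" for ab
      unfolding w_def by (rule someI_ex) (use that in blast)
    have "card H \<le> card (F \<times> G)"
      unfolding H_def using F(2) G(2)
      by (intro order_trans[OF card_image_le card_mono]) auto
    also have "\<dots> \<le> M * N" using F(3) G(3) by (simp add: card_cartesian_product mult_le_mono)
    finally have "card H \<le> M * N" .
    moreover have "finite H" "H \<subseteq> K" using F(2) G(2) w by (auto simp: H_def)
    moreover have "\<exists>z\<in>H. max (\<alpha> z y) (\<beta> z y) \<le> r / 2" if y: "y \<in> K" "max (\<alpha> x y) (\<beta> x y) \<le> r" for y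
    proof -
      obtain a b where ab: "a \<in> F" "\<alpha> a y \<le> r / 4" "b \<in> G" "\<beta> b y \<le> r / 4"
        using F(4)[OF y(1)] G(4)[OF y(1)] y(2) by auto
      then have ex: "\<exists>y\<in>K. \<alpha> (fst (a, b)) y \<le> r / 4 \<and> \<beta> (snd (a, b)) y \<le> r / 4" using y(1) by auto
      have mem: "a \<in> K" "b \<in> K" "w (a, b) \<in> K" using ab F(1) G(1) w[OF ex] by auto
      have "\<alpha> (w (a, b)) y \<le> r / 2"
        using pseudometricD(4)[OF assms(3) mem(3,1) y(1)] pseudometricD(3)[OF assms(3) mem(3,1)] w[OF ex] ab by simp
      moreover have "\<beta> (w (a, b)) y \<le> r / 2"
        using pseudometricD(4)[OF assms(4) mem(3,2) y(1)] pseudometricD(3)[OF assms(4) mem(3,2)] w[OF ex] ab by simp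
      moreover have "w (a, b) \<in> H" unfolding H_def using ab ex by blast
      ultimately show ?thesis by (intro bexI[of _ "w (a, b)"]) auto
    qed
    ultimately show "\<exists>F\<subseteq>K. finite F \<and> card F \<le> M * N \<and> (\<forall>y\<in>K. max (\<alpha> x y) (\<beta> x y) \<le> r \<longrightarrow> (\<exists>z\<in>F. max (\<alpha> z y) (\<beta> z y) \<le> r / 2))"
      by blast
  qed
qed

text \<open>A ball of radius r/4 contains at most one point of a set whose distances exceed r/2.
  This packing bound is the form in which doubling is refuted.\<close>

lemma pm_doubling_separated:
  assumes "pm_doubling K \<alpha>" and pm: "pseudometric K \<alpha>"
  shows "\<exists>N. \<forall>x\<in>K. \<forall>r>0. \<forall>A\<subseteq>K. (\<forall>a\<in>A. \<alpha> x a \<le> r) \<longrightarrow>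
    (\<forall>a\<in>A. \<forall>b\<in>A. a \<noteq> b \<longrightarrow> r / 2 < \<alpha> a b) \<longrightarrow> card A \<le> N"
proof -
  obtain N where N: "\<And>x r. x \<in> K \<Longrightarrow> r > 0 \<Longrightarrow> \<exists>F\<subseteq>K. finite F \<and> card F \<le> N \<and>
      (\<forall>y\<in>K. \<alpha> x y \<le> r \<longrightarrow> (\<exists>z\<in>F. \<alpha> z y \<le> r / 2 ^ 2))"
    using pm_doubling_iterate[OF assms(1), of 2] by metis
  show ?thesis
  proof (intro exI[of _ N] ballI allI impI)
    fix x and r :: real and A
    assume x: "x \<in> K" and r: "r > 0" and A: "A \<subseteq> K" "\<forall>a\<in>A. \<alpha> x a \<le> r"
      and sep: "\<forall>a\<in>A. \<forall>b\<in>A. a \<noteq> b \<longrightarrow> r / 2 < \<alpha> a b"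
    obtain F where F: "F \<subseteq> K" "finite F" "card F \<le> N" "\<And>y. y \<in> K \<Longrightarrow> \<alpha> x y \<le> r \<Longrightarrow> \<exists>z\<in>F. \<alpha> z y \<le> r / 4"
      using N[OF x r] by auto
    have "\<forall>a\<in>A. \<exists>z\<in>F. \<alpha> z a \<le> r / 4" using F(4) A by blast
    then obtain h where h: "\<And>a. a \<in> A \<Longrightarrow> h a \<in> F" "\<And>a. a \<in> A \<Longrightarrow> \<alpha> (h a) a \<le> r / 4" by metis
    have "inj_on h A"
    proof (rule inj_onI, rule ccontr)
      fix a b assume ab: "a \<in> A" "b \<in> A" "h a = h b" "a \<noteq> b"
      have mem: "a \<in> K" "b \<in> K" "h a \<in> K" using ab A(1) h(1) F(1) by auto
      show False
        using sep[rule_format, OF ab(1,2,4)] pseudometricD(4)[OF pm mem(1,3,2)] pseudometricD(3)[OF pm mem(1,3)] h(2)[OF ab(1)] h(2)[OF ab(2)] ab(3)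
        by simp
    qed
    then show "card A \<le> N"
      using card_inj_on_le[of h A F] h(1) F(2,3) by (meson image_subsetI order_trans)
  qed
qed

text \<open>One point of each colour class serves as a centre. Colours are easier to exhibit than
  centres, which would have to lie in the given set K.\<close>

lemma pm_doublingI:
  assumes "\<And>x r. x \<in> K \<Longrightarrow> r > 0 \<Longrightarrow> \<exists>(c :: 'k \<Rightarrow> 'c) V. finite V \<and> card V \<le> N \<and> (\<forall>y\<in>K. \<alpha> x y \<le> r \<longrightarrow> c y \<in> V) \<and>
    (\<forall>y\<in>K. \<forall>z\<in>K. \<alpha> x y \<le> r \<longrightarrow> \<alpha> x z \<le> r \<longrightarrow> c y = c z \<longrightarrow> \<alpha> y z \<le> r / 2)"
  shows "pm_doubling K \<alpha>"
  unfolding pm_doubling_def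
proof (intro exI[of _ N] ballI allI impI)
  fix x and r :: real assume x: "x \<in> K" and r: "r > 0"
  obtain c :: "'k \<Rightarrow> 'c" and V where V: "finite V" "card V \<le> N" "\<And>y. y \<in> K \<Longrightarrow> \<alpha> x y \<le> r \<Longrightarrow> c y \<in> V"
      "\<And>y z. y \<in> K \<Longrightarrow> z \<in> K \<Longrightarrow> \<alpha> x y \<le> r \<Longrightarrow> \<alpha> x z \<le> r \<Longrightarrow> c y = c z \<Longrightarrow> \<alpha> y z \<le> r / 2"
    using assms[OF x r] by metis
  define B where "B = {y \<in> K. \<alpha> x y \<le> r}"
  define F where "F = inv_into B c ` (c ` B)"
  have cB: "c ` B \<subseteq> V" using V(3) by (auto simp: B_def)
  have F: "F \<subseteq> B" by (auto simp: F_def inv_into_into)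
  have "card F \<le> N"
    unfolding F_def using card_image_le[of "c ` B" "inv_into B c"] card_mono[OF V(1) cB] V(2) finite_subset[OF cB V(1)]
    by linarith
  moreover have "finite F" unfolding F_def using finite_subset[OF cB V(1)] by simp
  moreover have "\<exists>z\<in>F. \<alpha> z y \<le> r / 2" if "y \<in> K" "\<alpha> x y \<le> r" for y
  proof -
    have y: "y \<in> B" using that by (simp add: B_def)
    then have z: "inv_into B c (c y) \<in> F" "c (inv_into B c (c y)) = c y"
      by (auto simp: F_def f_inv_into_f)
    then have "\<alpha> (inv_into B c (c y)) y \<le> r / 2"
      using V(4)[of "inv_into B c (c y)" y] F y by (auto simp: B_def)
    then show ?thesis using z(1) by blast
  qed
  ultimately show "\<exists>F\<subseteq>K. finite F \<and> card F \<le> N \<and> (\<forall>y\<in>K. \<alpha> x y \<le> r \<longrightarrow> (\<exists>z\<in>F. \<alpha> z y \<le> r / 2))"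
    using F by (intro exI[of _ F]) (auto simp: B_def)
qed

lemma pm_doubling_real: "pm_doubling K (\<lambda>x y. \<bar>f x - f y\<bar> :: real)"
proof (rule pm_doublingI[of _ 5])
  fix x and r :: real assume r: "r > 0"
  \<comment> \<open>The colour is the cell of length r/2 relative to f x. Points within r of f x lie
    in one of the five cells numbered -2 to 2.\<close>
  define c where "c y = \<lfloor>(f y - f x) / (r / 2)\<rfloor>" for y
  have "c y \<in> {-2..2}" if "\<bar>f x - f y\<bar> \<le> r" for y
  proof -
    have "-2 \<le> (f y - f x) / (r / 2)" "(f y - f x) / (r / 2) \<le> 2"
      using that r by (auto simp: field_simps)
    then show ?thesis unfolding c_def by (simp add: le_floor_iff floor_le_iff)
  qed
  moreover have "\<bar>f y - f z\<bar> \<le> r / 2" if "c y = c z" for y z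
  proof -
    have "\<bar>(f y - f x) / (r / 2) - (f z - f x) / (r / 2)\<bar> < 1"
      using that unfolding c_def by linarith
    also have "(f y - f x) / (r / 2) - (f z - f x) / (r / 2) = (f y - f z) / (r / 2)"
      by (simp add: diff_divide_distrib)
    finally have "\<bar>f y - f z\<bar> / (r / 2) < 1" using r by (simp only: abs_divide abs_of_pos half_gt_zero)
    then show ?thesis using r by (simp only: divide_less_eq_1_pos half_gt_zero less_imp_le)
  qed
  ultimately show "\<exists>(c :: _ \<Rightarrow> int) V. finite V \<and> card V \<le> 5 \<and> (\<forall>y\<in>K. \<bar>f x - f y\<bar> \<le> r \<longrightarrow> c y \<in> V) \<and>
      (\<forall>y\<in>K. \<forall>z\<in>K. \<bar>f x - f y\<bar> \<le> r \<longrightarrow> \<bar>f x - f z\<bar> \<le> r \<longrightarrow> c y = c z \<longrightarrow> \<bar>f y - f z\<bar> \<le> r / 2)"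
    by (intro exI[of _ c] exI[of _ "{-2..2}"]) auto
qed

section \<open>Permanence of uniform disconnectedness and uniform perfectness\<close>

lemma pm_uniformly_disconnected_bilipschitz:
  assumes "pm_uniformly_disconnected K \<alpha>"
    and le: "\<And>x y. x \<in> K \<Longrightarrow> y \<in> K \<Longrightarrow> \<alpha> x y \<le> C * \<beta> x y" "\<And>x y. x \<in> K \<Longrightarrow> y \<in> K \<Longrightarrow> \<beta> x y \<le> C' * \<alpha> x y"
    and C: "C > 0" "C' > 0"
  shows "pm_uniformly_disconnected K \<beta>"
proof -
  obtain \<delta> where \<delta>: "\<delta> > 0" "\<And>n z s. (\<forall>i\<le>n. z i \<in> K) \<Longrightarrow> 0 \<le> s \<Longrightarrow>
      (\<forall>i<n. \<alpha> (z i) (z (Suc i)) \<le> s) \<Longrightarrow> \<delta> * \<alpha> (z 0) (z (n::nat)) \<le> s"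
    using assms(1) unfolding pm_uniformly_disconnected_def by metis
  show ?thesis
    unfolding pm_uniformly_disconnected_def
  proof (intro exI[of _ "\<delta> / (C * C')"] conjI allI impI)
    fix n :: nat and z s
    assume z: "\<forall>i\<le>n. z i \<in> K" "0 \<le> s" "\<forall>i<n. \<beta> (z i) (z (Suc i)) \<le> s"
    have "\<alpha> (z i) (z (Suc i)) \<le> C * s" if "i < n" for i
    proof -
      have "\<alpha> (z i) (z (Suc i)) \<le> C * \<beta> (z i) (z (Suc i))" using le(1) z(1) that by simp
      also have "\<dots> \<le> C * s" using z(3) that C by (intro mult_left_mono) auto
      finally show ?thesis .
    qed
    then have 1: "\<delta> * \<alpha> (z 0) (z n) \<le> C * s"
      using \<delta>(2)[of n z "C * s"] z C by simp
    have "\<delta> * \<beta> (z 0) (z n) \<le> \<delta> * (C' * \<alpha> (z 0) (z n))"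
      using le(2) z(1) \<delta>(1) by (intro mult_left_mono) auto
    also have "\<dots> \<le> C' * (C * s)" using mult_left_mono[OF 1, of C'] C by (simp add: mult_ac)
    finally show "\<delta> / (C * C') * \<beta> (z 0) (z n) \<le> s" using C by (simp add: field_simps)
  qed (use \<delta>(1) C in simp)
qed

lemma pm_uniformly_disconnected_max:
  assumes "pm_uniformly_disconnected K \<alpha>" "pm_uniformly_disconnected K \<beta>"
    and nn: "\<And>x y. x \<in> K \<Longrightarrow> y \<in> K \<Longrightarrow> 0 \<le> \<alpha> x y" "\<And>x y. x \<in> K \<Longrightarrow> y \<in> K \<Longrightarrow> 0 \<le> \<beta> x y"
  shows "pm_uniformly_disconnected K (\<lambda>x y. max (\<alpha> x y) (\<beta> x y))"
proof -
  obtain \<delta> where \<delta>: "\<delta> > 0" "\<And>n z s. (\<forall>i\<le>n. z i \<in> K) \<Longrightarrow> 0 \<le> s \<Longrightarrow>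
      (\<forall>i<n. \<alpha> (z i) (z (Suc i)) \<le> s) \<Longrightarrow> \<delta> * \<alpha> (z 0) (z (n::nat)) \<le> s"
    using assms(1) unfolding pm_uniformly_disconnected_def by metis
  obtain \<epsilon> where \<epsilon>: "\<epsilon> > 0" "\<And>n z s. (\<forall>i\<le>n. z i \<in> K) \<Longrightarrow> 0 \<le> s \<Longrightarrow>
      (\<forall>i<n. \<beta> (z i) (z (Suc i)) \<le> s) \<Longrightarrow> \<epsilon> * \<beta> (z 0) (z (n::nat)) \<le> s"
    using assms(2) unfolding pm_uniformly_disconnected_def by metis
  show ?thesis
    unfolding pm_uniformly_disconnected_def
  proof (intro exI[of _ "min \<delta> \<epsilon>"] conjI allI impI)
    fix n :: nat and z s
    assume z: "\<forall>i\<le>n. z i \<in> K" "0 \<le> s" "\<forall>i<n. max (\<alpha> (z i) (z (Suc i))) (\<beta> (z i) (z (Suc i))) \<le> s"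
    have "min \<delta> \<epsilon> * \<alpha> (z 0) (z n) \<le> \<delta> * \<alpha> (z 0) (z n)" "min \<delta> \<epsilon> * \<beta> (z 0) (z n) \<le> \<epsilon> * \<beta> (z 0) (z n)"
      using nn z(1) by (auto intro!: mult_right_mono)
    moreover have "\<delta> * \<alpha> (z 0) (z n) \<le> s" "\<epsilon> * \<beta> (z 0) (z n) \<le> s"
      using \<delta>(2)[of n z s] \<epsilon>(2)[of n z s] z by auto
    ultimately show "min \<delta> \<epsilon> * max (\<alpha> (z 0) (z n)) (\<beta> (z 0) (z n)) \<le> s"
      by (simp add: max_def)
  qed (use \<delta>(1) \<epsilon>(1) in simp)
qed

lemma pm_uniformly_disconnected_ultrametric:
  assumes "\<And>x. x \<in> K \<Longrightarrow> \<alpha> x x = 0"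
    and um: "\<And>x y z. x \<in> K \<Longrightarrow> y \<in> K \<Longrightarrow> z \<in> K \<Longrightarrow> \<alpha> x z \<le> max (\<alpha> x y) (\<alpha> y z)"
  shows "pm_uniformly_disconnected K \<alpha>"
  unfolding pm_uniformly_disconnected_def
proof (intro exI[of _ 1] conjI allI impI)
  fix n :: nat and z s
  assume z: "\<forall>i\<le>n. z i \<in> K" "0 \<le> s" "\<forall>i<n. \<alpha> (z i) (z (Suc i)) \<le> s"
  have "\<alpha> (z 0) (z k) \<le> s" if "k \<le> n" for k
    using that
  proof (induction k)
    case (Suc k)
    have "\<alpha> (z 0) (z (Suc k)) \<le> max (\<alpha> (z 0) (z k)) (\<alpha> (z k) (z (Suc k)))"
      using z(1) Suc.prems by (intro um) auto
    also have "\<dots> \<le> s" using Suc z(3) by simp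
    finally show ?case .
  qed (use assms(1) z in simp)
  then show "1 * \<alpha> (z 0) (z n) \<le> s" by simp
qed simp

lemma pm_uniformly_perfect_bilipschitz:
  assumes "pm_uniformly_perfect K \<alpha>"
    and le: "\<And>x y. x \<in> K \<Longrightarrow> y \<in> K \<Longrightarrow> \<alpha> x y \<le> C * \<beta> x y" "\<And>x y. x \<in> K \<Longrightarrow> y \<in> K \<Longrightarrow> \<beta> x y \<le> C' * \<alpha> x y"
    and C: "C \<ge> 1" "C' \<ge> 1"
  shows "pm_uniformly_perfect K \<beta>"
proof -
  obtain c where c: "c \<in> {0<..<1}" "\<And>x r. x \<in> K \<Longrightarrow> r > 0 \<Longrightarrow> \<exists>u\<in>K. \<exists>v\<in>K. r < \<alpha> u v \<Longrightarrow>
      \<exists>y\<in>K. c * r \<le> \<alpha> x y \<and> \<alpha> x y \<le> r"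
    using assms(1) unfolding pm_uniformly_perfect_def by metis
  have CC: "C * C' \<ge> 1" using mult_mono[OF C] C by simp
  show ?thesis
    unfolding pm_uniformly_perfect_def
  proof (intro bexI[of _ "c / (C * C')"] ballI allI impI)
    fix x and r :: real assume x: "x \<in> K" and r: "r > 0" "\<exists>u\<in>K. \<exists>v\<in>K. r < \<beta> u v"
    then obtain u v where uv: "u \<in> K" "v \<in> K" "r < \<beta> u v" by blast
    \<comment> \<open>The radius r / C' is used for \<alpha>, so that the witness stays within
      \<beta>-distance r.\<close>
    then have "r / C' < \<alpha> u v" using le(2)[OF uv(1,2)] C by (simp add: field_simps)
    then obtain y where y: "y \<in> K" "c * (r / C') \<le> \<alpha> x y" "\<alpha> x y \<le> r / C'"
      using c(2)[OF x, of "r / C'"] r(1) C uv by auto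
    have "\<beta> x y \<le> r" using le(2)[OF x y(1)] mult_left_mono[OF y(3), of C'] C by simp
    moreover have "c / (C * C') * r \<le> \<beta> x y"
      using le(1)[OF x y(1)] y(2) C order_trans[of "c * r" "C' * \<alpha> x y" "C' * (C * \<beta> x y)"]
      by (simp add: field_simps)
    ultimately show "\<exists>y\<in>K. c / (C * C') * r \<le> \<beta> x y \<and> \<beta> x y \<le> r" using y(1) by blast
  next
    have "c < C * C'" using CC c(1) by auto
    then show "c / (C * C') \<in> {0<..<1}" using c(1) C by auto
  qed
qed

section \<open>Products with binary sequences\<close>

lemma sequentially_compact_Un:
  assumes A: "sequentially_compact A \<alpha>" and B: "sequentially_compact B \<alpha>"
  shows "sequentially_compact (A \<union> B) \<alpha>"
proof -
  have *: "\<exists>k\<in>A. \<exists>r. strict_mono r \<and> (\<lambda>i. \<alpha> (\<sigma> (r i)) k) \<longlonglongrightarrow> 0"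
    if A: "sequentially_compact A \<alpha>" and inf: "infinite {i. \<sigma> i \<in> A}" for A and \<sigma> :: "nat \<Rightarrow> 'a"
  proof -
    define r where "r = enumerate {i. \<sigma> i \<in> A}"
    have r: "strict_mono r" "\<sigma> (r i) \<in> A" for i
      using enumerate_in_set[OF inf, of i] strict_mono_enumerate[OF inf] by (auto simp: r_def)
    obtain k r' where "k \<in> A" "strict_mono r'" "(\<lambda>i. \<alpha> (\<sigma> (r (r' i))) k) \<longlonglongrightarrow> 0"
      by (rule sequentially_compactE[OF A, of "\<lambda>i. \<sigma> (r i)"]) (use r in auto)
    then show ?thesis
      using strict_mono_o[OF r(1)] by (intro bexI[of _ k] exI[of _ "r \<circ> r'"]) auto
  qed
  show ?thesis
    unfolding sequentially_compact_def
  proof (intro allI impI)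
    fix \<sigma> :: "nat \<Rightarrow> 'a" assume \<sigma>: "range \<sigma> \<subseteq> A \<union> B"
    have "{i. \<sigma> i \<in> A} \<union> {i. \<sigma> i \<in> B} = UNIV" using \<sigma> by auto
    then have "infinite {i. \<sigma> i \<in> A} \<or> infinite {i. \<sigma> i \<in> B}"
      by (metis finite_Un infinite_UNIV_nat)
    then show "\<exists>k\<in>A \<union> B. \<exists>r. strict_mono r \<and> (\<lambda>i. \<alpha> (\<sigma> (r i)) k) \<longlonglongrightarrow> 0"
      using *[OF A, of \<sigma>] *[OF B, of \<sigma>] by blast
  qed
qed

lemma sequentially_compact_interval: "sequentially_compact {0..1::real} (\<lambda>x y. \<bar>x - y\<bar>)"
  unfolding sequentially_compact_def
proof (intro allI impI)
  fix \<sigma> :: "nat \<Rightarrow> real" assume "range \<sigma> \<subseteq> {0..1}"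
  then have "\<forall>n. \<sigma> n \<in> {0..1}" by (auto simp: image_subset_iff)
  then obtain l r where l: "l \<in> {0..1}" "strict_mono r" "(\<sigma> \<circ> r) \<longlonglongrightarrow> l"
    using compact_imp_seq_compact[OF compact_Icc] unfolding seq_compact_def by metis
  then have "(\<lambda>i. \<bar>\<sigma> (r i) - l\<bar>) \<longlonglongrightarrow> 0"
    by (simp add: o_def LIM_zero tendsto_rabs_zero)
  then show "\<exists>k\<in>{0..1}. \<exists>r. strict_mono r \<and> (\<lambda>i. \<bar>\<sigma> (r i) - k\<bar>) \<longlonglongrightarrow> 0"
    using l by blast
qed

lemma decreasing_infinite_sets_choice:
  fixes A :: "nat \<Rightarrow> nat set"
  assumes "\<And>n. infinite (A n)"
  obtains r where "strict_mono r" "\<And>n. r n \<in> A n"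
proof -
  have "\<exists>r. \<forall>n. r n \<in> A n \<and> r n < r (Suc n)"
  proof (rule dependent_nat_choice)
    show "\<exists>x. x \<in> A 0" using assms[of 0] by (metis ex_in_conv finite.emptyI)
    show "\<exists>y. y \<in> A (Suc n) \<and> x < y" for x n
      using assms[of "Suc n"] by (auto simp: infinite_nat_iff_unbounded)
  qed
  then show thesis using that by (auto simp: strict_mono_Suc_iff)
qed

definition agree :: "nat \<Rightarrow> (nat \<Rightarrow> bool) \<Rightarrow> (nat \<Rightarrow> bool) \<Rightarrow> bool"
  where "agree n b c \<longleftrightarrow> (\<forall>i<n. b i = c i)"

text \<open>The construction of Koenig's lemma: infinitely many indices are kept at each level, and
  on the kept ones the entries so far are constant.\<close>

primrec branch :: "(nat \<Rightarrow> nat \<Rightarrow> bool) \<Rightarrow> nat \<Rightarrow> nat set" where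
  "branch \<sigma> 0 = UNIV"
| "branch \<sigma> (Suc n) = (if infinite {i \<in> branch \<sigma> n. \<sigma> i n} then {i \<in> branch \<sigma> n. \<sigma> i n} else {i \<in> branch \<sigma> n. \<not> \<sigma> i n})"

lemma infinite_branch: "infinite (branch \<sigma> n)"
proof (induction n)
  case (Suc n)
  have "branch \<sigma> n = {i \<in> branch \<sigma> n. \<sigma> i n} \<union> {i \<in> branch \<sigma> n. \<not> \<sigma> i n}" by auto
  then have "infinite {i \<in> branch \<sigma> n. \<sigma> i n} \<or> infinite {i \<in> branch \<sigma> n. \<not> \<sigma> i n}"
    using Suc by (metis finite_Un)
  then show ?case by auto
qed simp

text \<open>A diagonal choice of indices from the branches. This is the sequential compactness of
  the binary sequences, with prefixes in place of a metric.\<close>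

lemma agreeing_subsequence:
  fixes \<sigma> :: "nat \<Rightarrow> nat \<Rightarrow> bool"
  obtains r c where "strict_mono r" "\<And>n. agree n (\<sigma> (r n)) c"
proof -
  obtain r where r: "strict_mono r" "\<And>n. r n \<in> branch \<sigma> n"
    by (rule decreasing_infinite_sets_choice[of "branch \<sigma>", OF infinite_branch]) (rule that)
  define c where "c n = infinite {i \<in> branch \<sigma> n. \<sigma> i n}" for n
  have "agree n (\<sigma> i) c" if "i \<in> branch \<sigma> n" for i n
    using that
  proof (induction n)
    case (Suc n)
    then have "i \<in> branch \<sigma> n" "\<sigma> i n = c n" by (auto simp: c_def split: if_splits)
    then show ?case using Suc.IH by (auto simp: agree_def less_Suc_eq)
  qed (simp add: agree_def)
  then show thesis using that r by blast
qed

text \<open>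
  The geometric weights \<open>g n = (1/2) ^ n\<close> make the space of binary sequences doubling. It is not doubling
  for \<open>g n = 1 / (n + 1)\<close>, as the \<open>n\<close> coordinates after the \<open>n\<close>-th then live at comparable scales.
\<close>

definition prefix_dist :: "(nat \<Rightarrow> real) \<Rightarrow> (nat \<Rightarrow> bool) \<Rightarrow> (nat \<Rightarrow> bool) \<Rightarrow> real"
  where "prefix_dist g b c = (if b = c then 0 else g (LEAST n. b n \<noteq> c n))"

text \<open>\<open>g_half\<close> excludes gaps of more than a factor 2 between consecutive scales,
  which is the source of uniform perfectness; \<open>g_lim\<close> is the source of
  compactness.\<close>

locale prefix_weight =
  fixes g :: "nat \<Rightarrow> real"
  assumes g_pos: "\<And>n. 0 < g n" and g_0: "g 0 = 1" and g_Suc: "\<And>n. g (Suc n) \<le> g n"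
    and g_half: "\<And>n. g n \<le> 2 * g (Suc n)" and g_lim: "g \<longlonglongrightarrow> 0"
begin

lemma g_antimono: "m \<le> n \<Longrightarrow> g n \<le> g m"
  by (rule decseqD[OF decseq_SucI]) (rule g_Suc)

lemma g_le_1: "g n \<le> 1"
  using g_antimono[of 0 n] g_0 by simp

lemma prefix_dist_le: "agree n b c \<Longrightarrow> prefix_dist g b c \<le> g n"
proof -
  assume agree: "agree n b c"
  show ?thesis
  proof (cases "b = c")
    case False
    then have "\<exists>n. b n \<noteq> c n" by auto
    then have "b (LEAST n. b n \<noteq> c n) \<noteq> c (LEAST n. b n \<noteq> c n)" by (rule LeastI_ex)
    then have "n \<le> (LEAST n. b n \<noteq> c n)" using agree by (auto simp: agree_def not_less[symmetric])
    then show ?thesis using False g_antimono by (simp add: prefix_dist_def)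
  qed (use g_pos[of n] in \<open>simp add: prefix_dist_def\<close>)
qed

lemma prefix_dist_ge: "\<not> agree (Suc n) b c \<Longrightarrow> g n \<le> prefix_dist g b c"
proof -
  assume "\<not> agree (Suc n) b c"
  then obtain i where i: "i \<le> n" "b i \<noteq> c i" by (auto simp: agree_def less_Suc_eq_le)
  then have "(LEAST n. b n \<noteq> c n) \<le> n" using Least_le[of "\<lambda>n. b n \<noteq> c n" i] by linarith
  then show ?thesis using i(2) g_antimono by (auto simp: prefix_dist_def)
qed

lemma prefix_dist_nonneg: "0 \<le> prefix_dist g b c"
  using g_pos by (simp add: prefix_dist_def less_imp_le)

lemma prefix_dist_le_1: "prefix_dist g b c \<le> 1"
  using g_le_1 by (simp add: prefix_dist_def)

lemma prefix_dist_pos: "b \<noteq> c \<Longrightarrow> 0 < prefix_dist g b c"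
  using g_pos by (simp add: prefix_dist_def)

text \<open>At the first place where a and c differ, b differs from one of them. That place may be a
  later difference of the new pair, but then their distance is only larger.\<close>

lemma prefix_dist_ultrametric: "prefix_dist g a c \<le> max (prefix_dist g a b) (prefix_dist g b c)"
proof (cases "a = c")
  case False
  define k where "k = (LEAST n. a n \<noteq> c n)"
  have "a k \<noteq> c k" unfolding k_def by (rule LeastI_ex) (use False in auto)
  then have "\<not> agree (Suc k) a b \<or> \<not> agree (Suc k) b c" by (auto simp: agree_def)
  then have "g k \<le> prefix_dist g a b \<or> g k \<le> prefix_dist g b c" using prefix_dist_ge by blast
  moreover have "prefix_dist g a c = g k" using False by (simp add: prefix_dist_def k_def)
  ultimately show ?thesis by linarith
next
  case True
  then have "prefix_dist g a c = 0" by (simp add: prefix_dist_def)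
  then show ?thesis using prefix_dist_nonneg[of a b] by linarith
qed

lemma pseudometric_prefix_dist: "pseudometric UNIV (prefix_dist g)"
proof (rule pseudometricI)
  show "prefix_dist g x y = prefix_dist g y x" for x y
    by (auto simp: prefix_dist_def eq_commute[of "x _"])
  show "prefix_dist g x z \<le> prefix_dist g x y + prefix_dist g y z" for x y z
    using prefix_dist_ultrametric[of x z y] prefix_dist_nonneg[of x y] prefix_dist_nonneg[of y z] by linarith
qed (use prefix_dist_nonneg in \<open>auto simp: prefix_dist_def\<close>)

text \<open>Every point thus has others at exactly the distances g n, the witnesses for uniform
  perfectness.\<close>

lemma prefix_dist_flip: "prefix_dist g b (b(n := \<not> b n)) = g n"
proof -
  have "agree n b (b(n := \<not> b n))" "\<not> agree (Suc n) b (b(n := \<not> b n))"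
    by (auto simp: agree_def)
  then show ?thesis using prefix_dist_le prefix_dist_ge by (metis antisym)
qed

lemma agree_imp_tendsto:
  assumes "\<And>n. agree n (\<sigma> n) c"
  shows "(\<lambda>n. prefix_dist g (\<sigma> n) c) \<longlonglongrightarrow> 0"
  by (rule real_tendsto_sandwich[OF _ _ tendsto_const g_lim]) (auto simp: prefix_dist_nonneg prefix_dist_le assms)

lemma tendsto_imp_agree:
  assumes "(\<lambda>n. prefix_dist g (\<sigma> n) c) \<longlonglongrightarrow> 0"
  shows "\<forall>\<^sub>F n in sequentially. agree k (\<sigma> n) c"
proof (rule eventually_mono[OF order_tendstoD(2)[OF assms g_pos[of k]]])
  fix n assume "prefix_dist g (\<sigma> n) c < g k"
  then have "agree (Suc k) (\<sigma> n) c" using prefix_dist_ge by (meson not_less)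
  then show "agree k (\<sigma> n) c" by (simp add: agree_def)
qed

lemma sequentially_compact_prefix_dist: "sequentially_compact UNIV (prefix_dist g)"
  unfolding sequentially_compact_def
proof (intro allI impI)
  fix \<sigma> :: "nat \<Rightarrow> nat \<Rightarrow> bool"
  obtain r c where "strict_mono r" "\<And>n. agree n (\<sigma> (r n)) c"
    by (rule agreeing_subsequence[of \<sigma>]) (rule that)
  then show "\<exists>k\<in>UNIV. \<exists>r. strict_mono r \<and> (\<lambda>i. prefix_dist g (\<sigma> (r i)) k) \<longlonglongrightarrow> 0"
    using agree_imp_tendsto[of "\<lambda>n. \<sigma> (r n)" c] by blast
qed

lemma scale_exists:
  assumes "0 < r" "r \<le> 1"
  obtains n where "g n \<le> r" "r \<le> 2 * g n"
proof -
  obtain N where N: "g N < r"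
    using order_tendstoD(2)[OF g_lim assms(1)] by (auto simp: eventually_sequentially)
  define n where "n = (LEAST n. g n \<le> r)"
  have 1: "g n \<le> r" unfolding n_def by (rule LeastI[of _ N]) (use N in simp)
  have "r \<le> 2 * g n"
  proof (cases n)
    case (Suc k)
    then have "\<not> g k \<le> r" unfolding n_def by (intro not_less_Least) simp
    then show ?thesis using g_half[of k] Suc by simp
  qed (use g_0 assms in simp)
  then show thesis using 1 that by blast
qed

end

lemma prefix_weight_geometric: "prefix_weight (\<lambda>n. (1/2) ^ n)"
  by unfold_locales (auto intro: LIMSEQ_realpow_zero)

lemma prefix_weight_harmonic: "prefix_weight (\<lambda>n. 1 / (real n + 1))"
proof
  show "(\<lambda>n. 1 / (real n + 1)) \<longlonglongrightarrow> 0"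
    using LIMSEQ_inverse_real_of_nat by (simp add: inverse_eq_divide add.commute)
qed (auto simp: field_simps)

text \<open>For the least n with (1/2)^n \<le> r/2, points within r of x share its first n - 1
  entries. The entry with index n - 1 then splits the ball into two parts of diameter at most
  (1/2)^n.\<close>

lemma pm_doubling_prefix_dist: "pm_doubling K (\<lambda>x y. prefix_dist (\<lambda>n. (1/2) ^ n) (h x) (h y))"
proof (rule pm_doublingI[of _ 2])
  interpret prefix_weight "\<lambda>n. (1/2::real) ^ n" by (rule prefix_weight_geometric)
  fix x and r :: real assume r: "r > 0"
  define n where "n = (LEAST n. (1/2::real) ^ n \<le> r / 2)"
  obtain N where "(1/2) ^ N < r / 2" using real_arch_pow_inv[of "r / 2" "1/2"] r by auto
  then have n: "(1/2) ^ n \<le> r / 2"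
    unfolding n_def by (rule LeastI[of "\<lambda>n. (1/2::real) ^ n \<le> r / 2" N, OF less_imp_le])
  have "prefix_dist (\<lambda>n. (1/2) ^ n) (h y) (h z) \<le> r / 2"
    if y: "prefix_dist (\<lambda>n. (1/2) ^ n) (h x) (h y) \<le> r" and z: "prefix_dist (\<lambda>n. (1/2) ^ n) (h x) (h z) \<le> r"
      and eq: "h y (n - 1) = h z (n - 1)" for y z
  proof -
    have *: "agree (n - 1) (h x) (h w)" if w: "prefix_dist (\<lambda>n. (1/2) ^ n) (h x) (h w) \<le> r" for w
    \<comment> \<open>For n \<le> 1 the prefix has length n - 1 = 0, with truncated subtraction when
      n = 0, so there is nothing to show.\<close>
    proof (cases "n \<le> 1")
      case False
      then obtain k where k: "n = Suc (Suc k)" by (metis One_nat_def not_less_eq_eq old.nat.exhaust le_SucE not0_implies_Suc le0)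
      then have "\<not> (1/2::real) ^ Suc k \<le> r / 2" unfolding n_def by (intro not_less_Least) simp
      then have "prefix_dist (\<lambda>n. (1/2) ^ n) (h x) (h w) < (1/2) ^ k" using w by simp
      then have "agree (Suc k) (h x) (h w)" using prefix_dist_ge[of k "h x" "h w"] by linarith
      then show ?thesis using k by simp
    qed (simp add: agree_def)
    have "agree n (h y) (h z)"
      unfolding agree_def
    proof (intro allI impI)
      fix i assume "i < n"
      then have "i < n - 1 \<or> i = n - 1" by auto
      then show "h y i = h z i" using *[OF y] *[OF z] eq by (auto simp: agree_def)
    qed
    then show ?thesis using prefix_dist_le n by (meson order_trans)
  qed
  then show "\<exists>(c :: _ \<Rightarrow> bool) V. finite V \<and> card V \<le> 2 \<and> (\<forall>y\<in>K. prefix_dist (\<lambda>n. (1/2) ^ n) (h x) (h y) \<le> r \<longrightarrow> c y \<in> V) \<and>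
    (\<forall>y\<in>K. \<forall>z\<in>K. prefix_dist (\<lambda>n. (1/2) ^ n) (h x) (h y) \<le> r \<longrightarrow> prefix_dist (\<lambda>n. (1/2) ^ n) (h x) (h z) \<le> r \<longrightarrow>
      c y = c z \<longrightarrow> prefix_dist (\<lambda>n. (1/2) ^ n) (h y) (h z) \<le> r / 2)"
    by (intro exI[of _ "\<lambda>y. h y (n - 1)"] exI[of _ UNIV]) (auto simp: card_UNIV_bool)
qed

text \<open>A point ((x, y), b, s) consists of a pair of corresponding points, a binary sequence and
  a real height s. The height leaves room for an interval or for an isolated point.\<close>

definition cantor_base :: "(nat \<Rightarrow> real) \<Rightarrow> gh_space \<Rightarrow> gh_space \<Rightarrow>
    (real \<times> real) \<times> (nat \<Rightarrow> bool) \<times> real \<Rightarrow> (real \<times> real) \<times> (nat \<Rightarrow> bool) \<times> real \<Rightarrow> real"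
  where "cantor_base g X Y x y =
    max (max (gh_mdist X (fst (fst x)) (fst (fst y))) (gh_mdist Y (snd (fst x)) (snd (fst y))))
      (max (prefix_dist g (fst (snd x)) (fst (snd y))) \<bar>snd (snd x) - snd (snd y)\<bar>)"

text \<open>Heights up to 2 keep the vertical distance at most 2, just what the Lipschitz bound 2 *
  dist X Y on \<zeta> allows.\<close>

locale cantor_family = prefix_weight g for g +
  fixes X Y :: gh_space and K :: "((real \<times> real) \<times> (nat \<Rightarrow> bool) \<times> real) set" and a b
  assumes dist_pos: "dist X Y > 0"
    and fstK: "(\<lambda>x. fst (fst x)) ` K = gh_points X" "(\<lambda>x. snd (fst x)) ` K = gh_points Y"
    and K_distortion: "\<And>x y. x \<in> K \<Longrightarrow> y \<in> K \<Longrightarrow> \<bar>gh_mdist X (fst (fst x)) (fst (fst y))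
      - gh_mdist Y (snd (fst x)) (snd (fst y))\<bar> \<le> 2 * dist X Y"
    and height: "\<And>x. x \<in> K \<Longrightarrow> 0 \<le> snd (snd x) \<and> snd (snd x) \<le> 2"
    and compact_base: "sequentially_compact K (cantor_base g X Y)"
    and fibre: "a \<in> K" "b \<in> K" "fst a = fst b" "a \<noteq> b"
begin

definition vertical :: "(real \<times> real) \<times> (nat \<Rightarrow> bool) \<times> real \<Rightarrow> (real \<times> real) \<times> (nat \<Rightarrow> bool) \<times> real \<Rightarrow> real"
  where "vertical x y = max (prefix_dist g (fst (snd x)) (fst (snd y))) \<bar>snd (snd x) - snd (snd y)\<bar>"

definition \<tau> :: "real \<Rightarrow> real" where "\<tau> t = min t (1 - t)"

definition \<zeta> :: "real \<Rightarrow> real \<Rightarrow> (real \<times> real) \<times> (nat \<Rightarrow> bool) \<times> real \<Rightarrow> (real \<times> real) \<times> (nat \<Rightarrow> bool) \<times> real \<Rightarrow> real"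
  where "\<zeta> l t x y = l * dist X Y * \<tau> t * vertical x y"

lemma \<tau>_bounds: "t \<in> {0..1} \<Longrightarrow> 0 \<le> \<tau> t" "t \<in> {0<..<1} \<Longrightarrow> 0 < \<tau> t" "\<tau> t \<le> 1 / 2"
  by (auto simp: \<tau>_def min_def)

lemma pseudometric_vertical: "pseudometric K vertical"
  unfolding vertical_def
proof (rule pseudometric_max)
  show "pseudometric K (\<lambda>x y. prefix_dist g (fst (snd x)) (fst (snd y)))"
    by (rule pseudometric_pullback[OF pseudometric_prefix_dist, of _ "\<lambda>x. fst (snd x)"]) simp
  show "pseudometric K (\<lambda>x y. \<bar>snd (snd x) - snd (snd y)\<bar>)"
    by (intro pseudometricI) auto
qed

lemma vertical_le_2: "x \<in> K \<Longrightarrow> y \<in> K \<Longrightarrow> vertical x y \<le> 2"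
  using prefix_dist_le_1[of "fst (snd x)" "fst (snd y)"] height[of x] height[of y] by (auto simp: vertical_def)

lemma vertical_nonneg: "0 \<le> vertical x y"
  by (auto simp: vertical_def le_max_iff_disj)

lemma base_eq: "cantor_base g X Y x y =
    max (max (gh_mdist X (fst (fst x)) (fst (fst y))) (gh_mdist Y (snd (fst x)) (snd (fst y)))) (vertical x y)"
  by (simp add: cantor_base_def vertical_def)

sublocale gh_family X Y K "\<lambda>x. fst (fst x)" "\<lambda>x. snd (fst x)" \<zeta> a b
proof
  show "pseudometric K (\<zeta> l t)" if "l \<in> {0<..1}" "t \<in> {0..1}" for l t
    unfolding \<zeta>_def using that \<tau>_bounds(1) by (intro pseudometric_scale pseudometric_vertical) auto
  show "\<bar>\<zeta> l s x y - \<zeta> l t x y\<bar> \<le> 2 * dist X Y * \<bar>s - t\<bar>"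
    if "l \<in> {0<..1}" "s \<in> {0..1}" "t \<in> {0..1}" "x \<in> K" "y \<in> K" for l s t x y
  proof -
    have "\<bar>\<zeta> l s x y - \<zeta> l t x y\<bar> = \<bar>(l * dist X Y * vertical x y) * (\<tau> s - \<tau> t)\<bar>"
      by (simp add: \<zeta>_def algebra_simps)
    also have "\<dots> = l * dist X Y * vertical x y * \<bar>\<tau> s - \<tau> t\<bar>"
      using that vertical_nonneg by (simp add: abs_mult)
    also have "\<dots> \<le> 1 * dist X Y * 2 * \<bar>s - t\<bar>"
    proof (intro mult_mono)
      show "\<bar>\<tau> s - \<tau> t\<bar> \<le> \<bar>s - t\<bar>" by (auto simp: \<tau>_def)
    qed (use that vertical_le_2 vertical_nonneg in auto)
    finally show ?thesis by simp
  qed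
  show "\<zeta> l 0 x y = 0" "\<zeta> l 1 x y = 0" for l x y
    by (simp_all add: \<zeta>_def \<tau>_def)
  show "\<zeta> l (1/2) x y \<le> \<zeta> l' (1/2) x y" if "0 < l" "l \<le> l'" for l l' x y
    unfolding \<zeta>_def using that vertical_nonneg \<tau>_bounds(1) by (intro mult_right_mono) auto
  have "vertical a b > 0"
  proof (cases "fst (snd a) = fst (snd b)")
    case True
    then have "snd (snd a) \<noteq> snd (snd b)" using fibre(3,4) by (metis prod.expand)
    then show ?thesis by (simp add: vertical_def less_max_iff_disj)
  qed (simp add: vertical_def less_max_iff_disj prefix_dist_pos)
  then show "inj_on (\<lambda>l. \<zeta> l (1/2) a b) {0<..1}"
    using dist_pos by (auto simp: inj_on_def \<zeta>_def \<tau>_def)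
qed (use fstK K_distortion dist_pos fibre in auto)

lemma \<rho>_le_base:
  assumes l: "l \<in> {0<..1}" and t: "t \<in> {0..1}"
  shows "\<rho> l t x y \<le> (1 + dist X Y) * cantor_base g X Y x y"
proof -
  define d e where "d = gh_mdist X (fst (fst x)) (fst (fst y))"
    and "e = gh_mdist Y (snd (fst x)) (snd (fst y))"
  define M where "M = cantor_base g X Y x y"
  have M: "d \<le> M" "e \<le> M" "vertical x y \<le> M" by (simp_all add: M_def base_eq d_def e_def)
  have M0: "0 \<le> M" using M(3) vertical_nonneg[of x y] by linarith
  have "(1 - t) * d + t * e \<le> M" using t M by (intro convex_bound_le) auto
  also have "\<dots> \<le> (1 + dist X Y) * M" using M0 by (simp add: algebra_simps)
  finally have 1: "(1 - t) * d + t * e \<le> (1 + dist X Y) * M" .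
  have "l * dist X Y * \<tau> t * vertical x y \<le> 1 * dist X Y * 1 * M"
    using l \<tau>_bounds(1)[OF t] \<tau>_bounds(3)[of t] vertical_nonneg M by (intro mult_mono mult_nonneg_nonneg) auto
  also have "\<dots> \<le> (1 + dist X Y) * M" using M0 by (simp add: algebra_simps)
  finally show ?thesis using 1 by (simp add: \<rho>_def \<zeta>_def d_def e_def M_def)
qed

text \<open>The inverse bi-Lipschitz constant. Both t and 1 - t are at least \<tau> t, so the
  distances in X and Y are at most \<rho> / \<tau> t; the vertical distance is at most \<rho> / (l D
  \<tau> t) with D = dist X Y. The sum of the two constants bounds the maximum.\<close>

definition C where "C l t = (1 + 1 / (l * dist X Y)) / \<tau> t"

lemma C_ge_1:
  assumes l: "l \<in> {0<..1}" and t: "t \<in> {0<..<1}"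
  shows "C l t \<ge> 1"
proof -
  have "\<tau> t \<le> 1 + 1 / (l * dist X Y)"
  proof -
    have "0 \<le> 1 / (l * dist X Y)" using l by simp
    then show ?thesis using \<tau>_bounds(3)[of t] by linarith
  qed
  then show ?thesis using \<tau>_bounds(2)[OF t] by (simp add: C_def)
qed

lemma base_le_\<rho>:
  assumes l: "l \<in> {0<..1}" and t: "t \<in> {0<..<1}" and xy: "x \<in> K" "y \<in> K"
  shows "cantor_base g X Y x y \<le> C l t * \<rho> l t x y"
proof -
  define d e where "d = gh_mdist X (fst (fst x)) (fst (fst y))"
    and "e = gh_mdist Y (snd (fst x)) (snd (fst y))"
  have d: "0 \<le> d" "0 \<le> e" by (simp_all add: d_def e_def)
  define m where "m = \<rho> l t x y"
  have m: "(1 - t) * d + t * e \<le> m" "l * dist X Y * \<tau> t * vertical x y \<le> m"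
    by (simp_all add: m_def \<rho>_def \<zeta>_def d_def e_def)
  note \<tau> = \<tau>_bounds(2)[OF t]
  have k: "0 < l * dist X Y" using l dist_pos by simp
  have "\<tau> t * d \<le> (1 - t) * d" "\<tau> t * e \<le> t * e" "0 \<le> (1 - t) * d" "0 \<le> t * e"
    using d t by (auto simp: \<tau>_def intro!: mult_right_mono)
  then have "\<tau> t * d \<le> m" "\<tau> t * e \<le> m" "0 \<le> m" using m(1) by linarith+
  then have 1: "d \<le> m / \<tau> t" "e \<le> m / \<tau> t" using \<tau> by (simp_all add: field_simps)
  have 2: "vertical x y \<le> m / (l * dist X Y * \<tau> t)" using m(2) k \<tau> by (subst pos_le_divide_eq) (auto simp: mult.commute)
  have "C l t * m = m / \<tau> t + m / (l * dist X Y * \<tau> t)"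
    by (simp add: C_def add_divide_distrib distrib_right)
  moreover have "0 \<le> m / \<tau> t" "0 \<le> m / (l * dist X Y * \<tau> t)" using \<open>0 \<le> m\<close> k \<tau> by simp_all
  ultimately show ?thesis using 1 2 by (simp add: base_eq d_def[symmetric] e_def[symmetric] m_def[symmetric])
qed

sublocale compact_gh_family X Y K "\<lambda>x. fst (fst x)" "\<lambda>x. snd (fst x)" \<zeta> a b
proof
  show "sequentially_compact K (\<rho> l t)" if "l \<in> {0<..1}" "t \<in> {0<..<1}" for l t
    by (rule sequentially_compact_mono[OF compact_base])
       (use \<rho>_le_base[of l t] pseudometricD(2)[OF pseudometric_\<rho>[of l t]] that in auto)
qed

lemma properties:
  assumes l: "l \<in> {0<..1}" and t: "t \<in> {0<..<1}"
  shows "gh_class K (\<rho> l t) \<in> gh_spaces_with doubling \<longleftrightarrow> pm_doubling K (cantor_base g X Y)"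
    and "gh_class K (\<rho> l t) \<in> gh_spaces_with uniformly_disconnected \<longleftrightarrow> pm_uniformly_disconnected K (cantor_base g X Y)"
    and "gh_class K (\<rho> l t) \<in> gh_spaces_with uniformly_perfect \<longleftrightarrow> pm_uniformly_perfect K (cantor_base g X Y)"
proof -
  have t': "t \<in> {0..1}" using t by auto
  note c = compact_\<rho>[OF l t'] and le1 = \<rho>_le_base[OF l t'] and le2 = base_le_\<rho>[OF l t]
  have C1: "1 + dist X Y \<ge> 1" "C l t \<ge> 1" using C_ge_1[OF l t] by auto
  then have C0: "1 + dist X Y > 0" "C l t > 0" by linarith+
  show "gh_class K (\<rho> l t) \<in> gh_spaces_with doubling \<longleftrightarrow> pm_doubling K (cantor_base g X Y)"
    unfolding gh_class_properties(1)[OF c]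
    using pm_doubling_bilipschitz[of K "\<rho> l t" _ "cantor_base g X Y", OF _ le1 le2 C0]
      pm_doubling_bilipschitz[of K "cantor_base g X Y" _ "\<rho> l t", OF _ le2 le1 C0(2,1)] by blast
  show "gh_class K (\<rho> l t) \<in> gh_spaces_with uniformly_disconnected \<longleftrightarrow> pm_uniformly_disconnected K (cantor_base g X Y)"
    unfolding gh_class_properties(2)[OF c]
    using pm_uniformly_disconnected_bilipschitz[of K "\<rho> l t" _ "cantor_base g X Y", OF _ le1 le2 C0]
      pm_uniformly_disconnected_bilipschitz[of K "cantor_base g X Y" _ "\<rho> l t", OF _ le2 le1 C0(2,1)] by blast
  show "gh_class K (\<rho> l t) \<in> gh_spaces_with uniformly_perfect \<longleftrightarrow> pm_uniformly_perfect K (cantor_base g X Y)"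
    unfolding gh_class_properties(3)[OF c]
    using pm_uniformly_perfect_bilipschitz[of K "\<rho> l t" _ "cantor_base g X Y", OF _ le1 le2 C1]
      pm_uniformly_perfect_bilipschitz[of K "cantor_base g X Y" _ "\<rho> l t", OF _ le2 le1 C1(2,1)] by blast
qed

end

section \<open>Geodesics through the sets X(u, v, w)\<close>

theorem X_set_geodesics:
  assumes X: "X \<in> X_set u v w" and Y: "Y \<in> X_set u v w" and pos: "dist X Y > 0"
  shows "{\<gamma> \<in> geodesics X Y. \<gamma> ` {0..1} \<subseteq> X_set u v w} \<approx> (UNIV :: nat set set)"
proof -
  obtain R where R: "R \<subseteq> gh_points X \<times> gh_points Y"
    "fst ` R = gh_points X" "snd ` R = gh_points Y"
    "\<forall>x\<in>R. \<forall>y\<in>R. \<bar>gh_mdist X (fst x) (fst y) - gh_mdist Y (snd x) (snd y)\<bar> \<le> 2 * dist X Y"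
    "sequentially_compact R (\<lambda>x y. max (gh_mdist X (fst x) (fst y)) (gh_mdist Y (snd x) (snd y)))"
    by (rule optimal_correspondence_gh_space)
  have "fst ` R \<noteq> {}"
    unfolding R(2) using rep_gh_space_compact[of X] by (simp add: compact_metric_def)
  then obtain x0 where x0: "x0 \<in> R" by auto
  \<comment> \<open>\<open>g\<close> decides doubling, the interval or point \<open>J\<close> uniform disconnectedness, and the isolated point in \<open>P\<close>
    destroys uniform perfectness, which the binary sequences otherwise provide.\<close>
  define g :: "nat \<Rightarrow> real" where "g = (if u = 0 then (\<lambda>n. 1 / (real n + 1)) else (\<lambda>n. (1/2) ^ n))"
  define J :: "real set" where "J = (if v = 0 then {0..1} else {0})"
  define P :: "((real \<times> real) \<times> (nat \<Rightarrow> bool) \<times> real) set"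
    where "P = (if w = 0 then {(x0, \<lambda>_. False, 2)} else {})"
  define K where "K = R \<times> UNIV \<times> J \<union> P"
  define o1 o2 :: "(real \<times> real) \<times> (nat \<Rightarrow> bool) \<times> real" where "o1 = (x0, \<lambda>_. False, 0)" and "o2 = (x0, \<lambda>_. True, 0)"
  have K: "fst x \<in> R" "snd (snd x) \<in> J \<or> x = (x0, \<lambda>_. False, 2) \<and> w = 0" if "x \<in> K" for x
    using that x0 by (auto simp: K_def P_def split: if_splits)
  have J: "0 \<in> J" "J \<subseteq> {0..1}" by (auto simp: J_def)
  then have KI: "(x0, b, 0) \<in> K" for b using x0 by (simp add: K_def)
  have fstK: "fst ` K = R"
    using x0 J(1) by (auto simp: K_def P_def image_Un split: if_splits)
  interpret g: prefix_weight g
    unfolding g_def using prefix_weight_geometric prefix_weight_harmonic by simp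
  have compactA: "sequentially_compact (R \<times> UNIV \<times> J) (cantor_base g X Y)"
  proof -
    have "sequentially_compact J (\<lambda>x y. \<bar>x - y\<bar>)"
      unfolding J_def using sequentially_compact_interval sequentially_compact_finite[of "{0::real}" "\<lambda>x y. \<bar>x - y\<bar>"] by simp
    then show ?thesis
      using sequentially_compact_Times[OF R(5) sequentially_compact_Times[OF g.sequentially_compact_prefix_dist]]
      by (simp add: cantor_base_def[abs_def])
  qed
  interpret cantor_family g X Y K o1 o2
  proof
    show "(\<lambda>x. fst (fst x)) ` K = gh_points X" "(\<lambda>x. snd (fst x)) ` K = gh_points Y"
      using R(2,3) unfolding fstK[symmetric] image_image by simp_all
    show "0 \<le> snd (snd x) \<and> snd (snd x) \<le> 2" if "x \<in> K" for x
      using K(2)[OF that] J(2) by fastforce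
    have "sequentially_compact P (cantor_base g X Y)"
      using x0 R(1) by (intro sequentially_compact_finite) (auto simp: P_def cantor_base_def prefix_dist_def mdist_self split: if_splits)
    then show "sequentially_compact K (cantor_base g X Y)"
      unfolding K_def by (intro sequentially_compact_Un compactA)
    show "o1 \<in> K" "o2 \<in> K" using KI by (simp_all add: o1_def o2_def)
    show "fst o1 = fst o2" "o1 \<noteq> o2" by (auto simp: o1_def o2_def fun_eq_iff)
  qed (use R(4) K(1) pos in auto)
  let ?X = "\<lambda>x y. gh_mdist X (fst (fst x)) (fst (fst y))"
  let ?Y = "\<lambda>x y. gh_mdist Y (snd (fst x)) (snd (fst y))"
  let ?p = "\<lambda>x y. prefix_dist g (fst (snd x)) (fst (snd y))"
  let ?h = "\<lambda>x y. \<bar>snd (snd x) - snd (snd y)\<bar>"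
  have base: "cantor_base g X Y = (\<lambda>x y. max (max (?X x y) (?Y x y)) (max (?p x y) (?h x y)))"
    by (intro ext) (simp add: cantor_base_def)
  have pms: "pseudometric K ?X" "pseudometric K ?Y" "pseudometric K ?p" "pseudometric K ?h"
    using mem pseudometric_pullback[OF pseudometric_mdist, of K "\<lambda>x. fst (fst x)" "rep_gh_space X"]
      pseudometric_pullback[OF pseudometric_mdist, of K "\<lambda>x. snd (fst x)" "rep_gh_space Y"]
      pseudometric_pullback[OF g.pseudometric_prefix_dist, of K "\<lambda>x. fst (snd x)"]
    by (auto intro!: pseudometricI)
  have pm_base: "pseudometric K (cantor_base g X Y)"
    unfolding base by (intro pseudometric_max pms)
  have base_fibre: "cantor_base g X Y (x, b, s) (x, b', s') = max (prefix_dist g b b') \<bar>s - s'\<bar>" if "x \<in> R" for x b b' s s'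
    using subsetD[OF R(1) that] g.prefix_dist_nonneg[of b b'] by (auto simp: cantor_base_def mdist_self mem_Times_iff max_def)
  have base_ge: "?h x y \<le> cantor_base g X Y x y" for x y by (simp add: cantor_base_def)
  have doubling: "pm_doubling K (cantor_base g X Y)" if u: "u = 1"
  proof -
    have "X \<in> gh_spaces_with doubling" "Y \<in> gh_spaces_with doubling"
      using X Y u by (simp_all add: X_set_def E_set_def)
    then have "pm_doubling K ?X" "pm_doubling K ?Y"
      using pullback_properties(1)[OF p] pullback_properties(1)[OF q] by simp_all
    moreover have "pm_doubling K ?p"
      using pm_doubling_prefix_dist[of K "\<lambda>x. fst (snd x)"] u by (simp add: g_def)
    ultimately show ?thesis
      unfolding base by (intro pm_doubling_max pseudometric_max pms pm_doubling_real)
  qed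
  have not_doubling: "\<not> pm_doubling K (cantor_base g X Y)" if u: "u = 0"
  proof
    assume "pm_doubling K (cantor_base g X Y)"
    then obtain N where N: "\<forall>x\<in>K. \<forall>r>0. \<forall>A\<subseteq>K. (\<forall>a\<in>A. cantor_base g X Y x a \<le> r) \<longrightarrow>
        (\<forall>a\<in>A. \<forall>b\<in>A. a \<noteq> b \<longrightarrow> r / 2 < cantor_base g X Y a b) \<longrightarrow> card A \<le> N"
      using pm_doubling_separated[OF _ pm_base] by blast
    \<comment> \<open>The 2^(N+1) sequences supported on {N..2N} are packed into the ball of radius
      g N around the zero sequence.\<close>
    define F :: "nat set \<Rightarrow> (real \<times> real) \<times> (nat \<Rightarrow> bool) \<times> real" where "F S = (x0, \<lambda>i. i \<in> S, 0)" for S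
    have F: "cantor_base g X Y (F S) (F T) = prefix_dist g (\<lambda>i. i \<in> S) (\<lambda>i. i \<in> T)" for S T
      using x0 g.prefix_dist_nonneg by (simp add: F_def base_fibre max_absorb1)
    have inj: "inj F" by (auto simp: inj_def F_def fun_eq_iff)
    have "card (F ` Pow {N..2 * N}) \<le> N"
    proof (rule N[rule_format, of "F {}" "g N"])
      show "F {} \<in> K" "F ` Pow {N..2 * N} \<subseteq> K" using KI by (auto simp: F_def)
      show "cantor_base g X Y (F {}) a \<le> g N" if "a \<in> F ` Pow {N..2 * N}" for a
        using that by (fastforce simp: F agree_def intro!: g.prefix_dist_le)
      show "g N / 2 < cantor_base g X Y a b" if "a \<in> F ` Pow {N..2 * N}" "b \<in> F ` Pow {N..2 * N}" "a \<noteq> b" for a b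
      proof -
        obtain S T where ST: "S \<subseteq> {N..2 * N}" "T \<subseteq> {N..2 * N}" "a = F S" "b = F T" using \<open>a \<in> _\<close> \<open>b \<in> _\<close> by auto
        then have "S \<noteq> T" using \<open>a \<noteq> b\<close> by blast
        then obtain i where i: "i \<in> S \<longleftrightarrow> i \<notin> T" by blast
        then have "i \<le> 2 * N" using ST(1,2) by auto
        then have "g (2 * N) \<le> prefix_dist g (\<lambda>i. i \<in> S) (\<lambda>i. i \<in> T)"
          using i by (intro g.prefix_dist_ge) (auto simp: agree_def less_Suc_eq_le)
        \<comment> \<open>For harmonic weights this reads 1 / (2N + 2) < 1 / (2N + 1); geometric
          weights would fail here for N > 0.\<close>
        moreover have "g N / 2 < g (2 * N)" by (simp add: g_def u field_simps)
        ultimately show ?thesis using ST by (simp add: F)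
      qed
    qed (rule g.g_pos)
    moreover have "card (F ` Pow {N..2 * N}) = 2 ^ Suc N"
      using inj_on_subset[OF inj, of "Pow {N..2 * N}"] by (simp add: card_image card_Pow)
    ultimately show False using less_exp[of "Suc N"] by linarith
  qed
  have ud: "pm_uniformly_disconnected K (cantor_base g X Y)" if v: "v = 1"
  proof -
    have "X \<in> gh_spaces_with uniformly_disconnected" "Y \<in> gh_spaces_with uniformly_disconnected"
      using X Y v by (simp_all add: X_set_def E_set_def)
    then have "pm_uniformly_disconnected K ?X" "pm_uniformly_disconnected K ?Y"
      using pullback_properties(2)[OF p] pullback_properties(2)[OF q] by simp_all
    moreover have "pm_uniformly_disconnected K ?p"
      by (rule pm_uniformly_disconnected_ultrametric) (auto simp: g.prefix_dist_ultrametric prefix_dist_def[of g x x for x])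
    moreover have "pm_uniformly_disconnected K ?h"
    proof (rule pm_uniformly_disconnected_ultrametric)
      \<comment> \<open>For v = 1 only the heights 0 and 2 occur, and on two values the usual
        distance is an ultrametric.\<close>
      have *: "snd (snd x) = 0 \<or> snd (snd x) = 2" if "x \<in> K" for x using K(2)[OF that] v by (auto simp: J_def)
      show "?h x z \<le> max (?h x y) (?h y z)" if "x \<in> K" "y \<in> K" "z \<in> K" for x y z
        using *[OF that(1)] *[OF that(2)] *[OF that(3)] by (elim disjE) simp_all
    qed simp
    ultimately show ?thesis
      unfolding base by (intro pm_uniformly_disconnected_max) (auto simp: g.prefix_dist_nonneg le_max_iff_disj)
  qed
  have not_ud: "\<not> pm_uniformly_disconnected K (cantor_base g X Y)" if v: "v = 0"
  proof
    assume "pm_uniformly_disconnected K (cantor_base g X Y)"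
    then obtain \<delta> where \<delta>: "\<delta> > 0" "\<And>n z s. (\<forall>i\<le>n. z i \<in> K) \<Longrightarrow> 0 \<le> s \<Longrightarrow>
        (\<forall>i<n. cantor_base g X Y (z i) (z (Suc i)) \<le> s) \<Longrightarrow> \<delta> * cantor_base g X Y (z 0) (z (n::nat)) \<le> s"
      unfolding pm_uniformly_disconnected_def by metis
    \<comment> \<open>With n = k + 1, a chain of n steps of length 1/n climbs from height 0 to
      height 1.\<close>
    obtain k where k: "1 / real (Suc k) < \<delta>" using nat_approx_posE[OF \<delta>(1)] by blast
    define n where "n = Suc k"
    define z :: "nat \<Rightarrow> (real \<times> real) \<times> (nat \<Rightarrow> bool) \<times> real" where "z i = (x0, \<lambda>_. False, real i / real n)" for i
    have z: "cantor_base g X Y (z i) (z j) = \<bar>real i / real n - real j / real n\<bar>" for i j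
      using x0 by (simp add: z_def base_fibre prefix_dist_def)
    have "\<delta> * cantor_base g X Y (z 0) (z n) \<le> 1 / real n"
    proof (rule \<delta>(2))
      show "\<forall>i\<le>n. z i \<in> K" using x0 v by (auto simp: z_def K_def J_def n_def)
      show "\<forall>i<n. cantor_base g X Y (z i) (z (Suc i)) \<le> 1 / real n"
        by (simp add: z diff_divide_distrib[symmetric])
    qed simp
    then show False using k by (simp add: z n_def)
  qed
  have up: "pm_uniformly_perfect K (cantor_base g X Y)" if w: "w = 1"
  proof -
    obtain B where B: "B > 0" "\<And>x y. x \<in> gh_points X \<Longrightarrow> y \<in> gh_points X \<Longrightarrow> gh_mdist X x y \<le> B"
      by (rule compact_metric_bounded[OF rep_gh_space_compact[of X]]) (rule that)
    obtain B' where B': "B' > 0" "\<And>x y. x \<in> gh_points Y \<Longrightarrow> y \<in> gh_points Y \<Longrightarrow> gh_mdist Y x y \<le> B'"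
      by (rule compact_metric_bounded[OF rep_gh_space_compact[of Y]]) (rule that)
    define \<Delta> where "\<Delta> = B + B' + 2"
    have \<Delta>: "cantor_base g X Y x y \<le> \<Delta>" if "x \<in> K" "y \<in> K" for x y
      using B(1) B(2)[OF mem(1)[OF that(1)] mem(1)[OF that(2)]] B'(1) B'(2)[OF mem(2)[OF that(1)] mem(2)[OF that(2)]] vertical_le_2[OF that]
      by (simp add: base_eq \<Delta>_def)
    have \<Delta>0: "\<Delta> > 0" using B(1) B'(1) by (simp add: \<Delta>_def)
    show ?thesis
      unfolding pm_uniformly_perfect_def
    \<comment> \<open>This constant is below 1/2, the loss in \<open>scale_exists\<close> for r
      \<le> 1, and below 1 / r for all larger r up to \<Delta>, where flipping the first entry gives
      distance 1.\<close>
    proof (intro bexI[of _ "1 / (\<Delta> + 2)"] ballI allI impI)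
      fix x and r :: real
      assume x: "x \<in> K" and r: "r > 0" "\<exists>u\<in>K. \<exists>v\<in>K. r < cantor_base g X Y u v"
      have r\<Delta>: "r \<le> \<Delta>" using r(2) \<Delta> by (meson less_imp_le order_trans)
      obtain e b s where xe: "x = (e, b, s)" "e \<in> R" "s \<in> J" using x w by (auto simp: K_def P_def)
      have flip: "(e, b(n := \<not> b n), s) \<in> K" "cantor_base g X Y x (e, b(n := \<not> b n), s) = g n" for n
        using xe g.prefix_dist_flip[of b n] g.g_pos[of n] by (auto simp: K_def base_fibre)
      show "\<exists>y\<in>K. 1 / (\<Delta> + 2) * r \<le> cantor_base g X Y x y \<and> cantor_base g X Y x y \<le> r"
      proof (cases "r \<le> 1")
        case True
        then obtain n where n: "g n \<le> r" "r \<le> 2 * g n" using g.scale_exists[OF r(1)] by blast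
        have "1 / (\<Delta> + 2) * r \<le> 1 / 2 * r" using \<Delta>0 r(1) by (intro mult_right_mono) (auto simp: field_simps)
        then have "1 / (\<Delta> + 2) * r \<le> g n" using n(2) by linarith
        then show ?thesis using flip[of n] n(1) by (intro bexI[of _ "(e, b(n := \<not> b n), s)"]) auto
      next
        case False
        have "1 / (\<Delta> + 2) * r \<le> 1" using r\<Delta> \<Delta>0 by (simp add: field_simps)
        then show ?thesis using flip[of 0] False g.g_0 by (intro bexI[of _ "(e, b(0 := \<not> b 0), s)"]) auto
      qed
    qed (use \<Delta>0 in auto)
  qed
  have not_up: "\<not> pm_uniformly_perfect K (cantor_base g X Y)" if w: "w = 0"
  proof
    assume "pm_uniformly_perfect K (cantor_base g X Y)"
    then obtain c where c: "c \<in> {0<..<1}" "\<forall>x\<in>K. \<forall>r>0. (\<exists>u\<in>K. \<exists>v\<in>K. r < cantor_base g X Y u v) \<longrightarrow>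
        (\<exists>y\<in>K. c * r \<le> cantor_base g X Y x y \<and> cantor_base g X Y x y \<le> r)"
      unfolding pm_uniformly_perfect_def by (elim bexE)
    define e :: "(real \<times> real) \<times> (nat \<Rightarrow> bool) \<times> real" where "e = (x0, \<lambda>_. False, 2)"
    have e: "e \<in> K" using w by (simp add: e_def K_def P_def)
    \<comment> \<open>The radius 1/2 falls into the gap around \<open>e\<close>: every other point
      has height at most 1 and hence distance at least 1 from it.\<close>
    have "1/2 < cantor_base g X Y o1 e"
      using base_ge[of o1 e] by (simp add: o1_def e_def)
    then have "\<exists>u\<in>K. \<exists>v\<in>K. 1/2 < cantor_base g X Y u v" using e fibre(1) by blast
    then obtain y where y: "y \<in> K" "c * (1/2) \<le> cantor_base g X Y e y" "cantor_base g X Y e y \<le> 1/2"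
      using c(2)[rule_format, OF e, of "1/2"] by auto
    show False
    proof (cases "y = e")
      case True
      then show False using y(2) c(1) pseudometricD(1)[OF pm_base e] by simp
    next
      case False
      then have "snd (snd y) \<in> J" using K(2)[OF y(1)] by (auto simp: e_def)
      then show False using base_ge[of e y] y(3) J(2) by (auto simp: e_def)
    qed
  qed
  show ?thesis
  proof (rule geodesics_eqpoll_continuum[OF X Y])
    fix l t :: real assume lt: "l \<in> {0<..1}" "t \<in> {0<..<1}"
    show "gh_class K (\<rho> l t) \<in> X_set u v w"
      using doubling not_doubling ud not_ud up not_up properties[OF lt] by (auto simp: X_set_def E_set_def)
  qed
qed

section \<open>Cantor spaces\<close>

definition cantor_map :: "(nat \<Rightarrow> bool) \<Rightarrow> real"
  where "cantor_map b = (\<Sum>n. 2 * of_bool (b n) / 3 ^ Suc n)"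

lemma cantor_set_eq: "cantor_set = range cantor_map"
  by (simp add: cantor_set_def cantor_map_def[abs_def])

lemma cantor_series_sums: "(\<lambda>n. 2 / 3 ^ Suc n) sums (1::real)"
  using sums_mult[OF geometric_sums[of "1/3::real"], of "2/3"] by (simp add: power_one_over field_simps)

lemma cantor_map_summable: "summable (\<lambda>n. 2 * of_bool (b n) / 3 ^ Suc n :: real)"
  by (rule summable_comparison_test'[OF sums_summable[OF cantor_series_sums]]) auto

lemma cantor_map_bounds: "0 \<le> cantor_map b" "cantor_map b \<le> 1"
proof -
  show "0 \<le> cantor_map b"
    unfolding cantor_map_def by (rule suminf_nonneg[OF cantor_map_summable]) simp
  have "cantor_map b \<le> (\<Sum>n. 2 / 3 ^ Suc n)"
    unfolding cantor_map_def
    by (rule suminf_le[OF _ cantor_map_summable sums_summable[OF cantor_series_sums]]) auto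
  then show "cantor_map b \<le> 1" using sums_unique[OF cantor_series_sums] by simp
qed

lemma cantor_map_rec: "cantor_map b = (2 * of_bool (b 0) + cantor_map (\<lambda>n. b (Suc n))) / 3"
proof -
  have "(\<Sum>n. 2 * of_bool (b (Suc n)) / 3 ^ Suc (Suc n)) = cantor_map b - 2 * of_bool (b 0) / 3"
    using suminf_split_head[OF cantor_map_summable[of b]] by (simp add: cantor_map_def)
  moreover have "(\<Sum>n. 2 * of_bool (b (Suc n)) / 3 ^ Suc (Suc n)) = cantor_map (\<lambda>n. b (Suc n)) / 3"
    using suminf_divide[OF cantor_map_summable[of "\<lambda>n. b (Suc n)"], of 3]
    by (simp add: cantor_map_def mult.commute)
  ultimately show ?thesis by simp
qed

lemma cantor_map_agree: "agree n b c \<Longrightarrow> \<bar>cantor_map b - cantor_map c\<bar> \<le> (1/3) ^ n"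
proof (induction n arbitrary: b c)
  case 0
  then show ?case using cantor_map_bounds[of b] cantor_map_bounds[of c] by simp
next
  case (Suc n)
  then have "\<bar>cantor_map (\<lambda>n. b (Suc n)) - cantor_map (\<lambda>n. c (Suc n))\<bar> \<le> (1/3) ^ n" "b 0 = c 0"
    by (auto simp: agree_def)
  then show ?case by (simp add: cantor_map_rec[of b] cantor_map_rec[of c] diff_divide_distrib[symmetric] abs_divide)
qed

text \<open>The first entry decides between the disjoint intervals [0, 1/3] and [2/3, 1]; by
  self-similarity the value then determines all later entries.\<close>

lemma cantor_map_inj: "inj cantor_map"
proof -
  have "b n = c n" if "cantor_map b = cantor_map c" for b c n
    using that
  proof (induction n arbitrary: b c)
    case 0
    then have "2 * of_bool (b 0) + cantor_map (\<lambda>n. b (Suc n)) = 2 * of_bool (c 0) + cantor_map (\<lambda>n. c (Suc n))"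
      using cantor_map_rec[of b] cantor_map_rec[of c] by simp
    then show ?case
      using cantor_map_bounds[of "\<lambda>n. b (Suc n)"] cantor_map_bounds[of "\<lambda>n. c (Suc n)"]
      by (cases "b 0"; cases "c 0") auto
  next
    case (Suc n)
    then have "2 * of_bool (b 0) + cantor_map (\<lambda>n. b (Suc n)) = 2 * of_bool (c 0) + cantor_map (\<lambda>n. c (Suc n))"
      using cantor_map_rec[of b] cantor_map_rec[of c] by simp
    then have "cantor_map (\<lambda>n. b (Suc n)) = cantor_map (\<lambda>n. c (Suc n))"
      using cantor_map_bounds[of "\<lambda>n. b (Suc n)"] cantor_map_bounds[of "\<lambda>n. c (Suc n)"]
      by (cases "b 0"; cases "c 0") auto
    then show ?case by (rule Suc.IH)
  qed
  then show ?thesis by (auto simp: inj_def)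
qed

lemma cantor_map_lipschitz: "\<bar>cantor_map b - cantor_map c\<bar> \<le> prefix_dist (\<lambda>n. (1/2) ^ n) b c"
proof (cases "b = c")
  case False
  define k where "k = (LEAST n. b n \<noteq> c n)"
  have "agree k b c" unfolding agree_def k_def using not_less_Least by blast
  then have "\<bar>cantor_map b - cantor_map c\<bar> \<le> (1/3) ^ k" by (rule cantor_map_agree)
  also have "\<dots> \<le> (1/2) ^ k" by (intro power_mono) auto
  finally show ?thesis using False by (simp add: prefix_dist_def k_def)
qed (simp add: prefix_dist_def)

lemma isometric_imp_homeomorphic:
  assumes "isometric m n"
  shows "mtopology_of m homeomorphic_space mtopology_of n"
proof -
  obtain f where f: "f ` mspace m = mspace n" "\<And>x y. x \<in> mspace m \<Longrightarrow> y \<in> mspace m \<Longrightarrow> mdist n (f x) (f y) = mdist m x y"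
    using assms by (auto simp: isometric_def isometric_embedding_def)
  interpret MM: Metric_space12 "mspace m" "mdist m" "mspace n" "mdist n"
    by (simp add: Metric_space12_mspace_mdist)
  have "homeomorphic_map MM.M1.mtopology MM.M2.mtopology f"
    by (rule MM.isometry_imp_homeomorphic_map[OF f])
  then show ?thesis
    by (simp add: mtopology_of_def homeomorphic_map_imp_homeomorphic_space)
qed

text \<open>A homeomorphism from the Cantor set composed with \<open>cantor_map\<close>. Continuity
  is expressed through prefixes, the language of the retraction that follows.\<close>

lemma cantor_space_parametrisation:
  assumes "X \<in> cantor_spaces"
  obtains u where "range u = gh_points X"
    "\<forall>c. \<forall>\<epsilon>>0. \<exists>n. \<forall>b. agree n b c \<longrightarrow> gh_mdist X (u b) (u c) < \<epsilon>"
proof -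
  define m where "m = rep_gh_space X"
  obtain m' where m': "compact_metric m'" "mtopology_of m' homeomorphic_space top_of_set cantor_set" "X = abs_gh_space m'"
    using assms by (auto simp: cantor_spaces_def gh_spaces_with_def)
  have "isometric m m'" unfolding m_def m'(3) by (rule rep_abs_gh_space[OF m'(1)])
  then have "top_of_set cantor_set homeomorphic_space mtopology_of m"
    using isometric_imp_homeomorphic m'(2) homeomorphic_space_trans homeomorphic_space_sym by blast
  then obtain f where f: "homeomorphic_map (top_of_set cantor_set) (mtopology_of m) f"
    by (auto simp: homeomorphic_space)
  then have fc: "continuous_map (top_of_set cantor_set) (mtopology_of m) f" and fs: "f ` cantor_set = mspace m"
    using homeomorphic_imp_surjective_map[OF f] by (auto simp: homeomorphic_imp_continuous_map)
  interpret M: Metric_space "mspace m" "mdist m" by simp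
  show thesis
  proof (rule that[of "\<lambda>b. f (cantor_map b)"])
    show "range (\<lambda>b. f (cantor_map b)) = gh_points X"
      using fs by (simp add: cantor_set_eq image_image m_def)
    show "\<forall>c. \<forall>\<epsilon>>0. \<exists>n. \<forall>b. agree n b c \<longrightarrow> gh_mdist X (f (cantor_map b)) (f (cantor_map c)) < \<epsilon>"
    proof (intro allI impI)
      fix c and \<epsilon> :: real assume \<epsilon>: "\<epsilon> > 0"
      define U where "U = {x \<in> cantor_set. f x \<in> M.mball (f (cantor_map c)) \<epsilon>}"
      have fm: "f (cantor_map b) \<in> mspace m" for b using fs by (auto simp: cantor_set_eq)
      have "openin (top_of_set cantor_set) U"
        using openin_continuous_map_preimage[OF fc, of "M.mball (f (cantor_map c)) \<epsilon>"]
        by (simp add: U_def mtopology_of_def)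
      moreover have "cantor_map c \<in> U" using \<epsilon> fm by (simp add: U_def cantor_set_eq mdist_self)
      ultimately obtain e where e: "e > 0" "\<And>x. x \<in> cantor_set \<Longrightarrow> dist x (cantor_map c) < e \<Longrightarrow> x \<in> U"
        by (auto simp: openin_euclidean_subtopology_iff)
      obtain n where n: "(1/3) ^ n < e" using real_arch_pow_inv[OF e(1), of "1/3"] by auto
      have "mdist m (f (cantor_map b)) (f (cantor_map c)) < \<epsilon>" if "agree n b c" for b
      proof -
        have "cantor_map b \<in> U"
          using cantor_map_agree[OF that] n by (intro e(2)) (auto simp: cantor_set_eq dist_real_def)
        then show ?thesis by (simp add: U_def mdist_commute)
      qed
      then show "\<exists>n. \<forall>b. agree n b c \<longrightarrow> gh_mdist X (f (cantor_map b)) (f (cantor_map c)) < \<epsilon>"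
        by (auto simp: m_def)
    qed
  qed
qed

text \<open>
  The greedy retraction onto \<open>A\<close> follows \<open>c\<close> as long as some element of \<open>A\<close> does; \<open>live A c n\<close> are the
  elements of \<open>A\<close> with the first \<open>n\<close> entries of the image of \<open>c\<close>.
\<close>

primrec live :: "(nat \<Rightarrow> bool) set \<Rightarrow> (nat \<Rightarrow> bool) \<Rightarrow> nat \<Rightarrow> (nat \<Rightarrow> bool) set" where
  "live A c 0 = A"
| "live A c (Suc n) = (if {a \<in> live A c n. a n = c n} = {} then live A c n else {a \<in> live A c n. a n = c n})"

lemma live_nonempty: "A \<noteq> {} \<Longrightarrow> live A c n \<noteq> {}"
  by (induction n) auto

lemma live_antimono: "m \<le> n \<Longrightarrow> live A c n \<subseteq> live A c m"
  by (induction n rule: dec_induct) auto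

lemma live_agree: "a \<in> live A c n \<Longrightarrow> b \<in> live A c n \<Longrightarrow> agree n a b"
proof (induction n)
  case (Suc n)
  then have "a \<in> live A c n" "b \<in> live A c n" "a n = b n" by (auto split: if_splits)
  then show ?case using Suc.IH by (auto simp: agree_def less_Suc_eq)
qed (simp add: agree_def)

lemma live_cong: "agree n c c' \<Longrightarrow> live A c n = live A c' n"
proof (induction n)
  case (Suc n)
  then have "live A c n = live A c' n" "c n = c' n" by (auto simp: agree_def)
  then show ?case by (simp only: live.simps)
qed simp

lemma live_self: "c \<in> A \<Longrightarrow> c \<in> live A c n"
  by (induction n) auto

text \<open>All elements of \<open>live A c (Suc i)\<close> share entry i, which becomes entry i of
  r c. Hence r c is approximated by elements of A and lies in A by closedness; an element of A stays
  live in its own process and is fixed.\<close>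

lemma cantor_retraction:
  assumes ne: "A \<noteq> {}" and cl: "\<And>c. (\<And>n. \<exists>a\<in>A. agree n a c) \<Longrightarrow> c \<in> A"
  obtains r where "\<And>c. r c \<in> A" "\<And>c. c \<in> A \<Longrightarrow> r c = c" "\<And>n b c. agree n b c \<Longrightarrow> agree n (r b) (r c)"
proof -
  define r where "r c i = (SOME a. a \<in> live A c (Suc i)) i" for c i
  have r: "agree n a (r c)" if a: "a \<in> live A c n" for a c n
    unfolding agree_def
  proof (intro allI impI)
    fix i assume "i < n"
    then have "a \<in> live A c (Suc i)" by (intro subsetD[OF live_antimono a]) simp
    moreover have "(SOME a. a \<in> live A c (Suc i)) \<in> live A c (Suc i)"
      unfolding some_in_eq by (rule live_nonempty[OF ne])
    ultimately have "agree (Suc i) a (SOME a. a \<in> live A c (Suc i))" by (rule live_agree)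
    then show "a i = r c i" by (simp add: r_def agree_def)
  qed
  show thesis
  proof (rule that[of r])
    show "r c \<in> A" for c
    proof (rule cl)
      fix n
      obtain a where "a \<in> live A c n" using live_nonempty[OF ne] by blast
      then show "\<exists>a\<in>A. agree n a (r c)" using r[of a c n] live_antimono[of 0 n A c] by (intro bexI[of _ a]) auto
    qed
    show "r c = c" if "c \<in> A" for c
    proof
      show "r c i = c i" for i
        using r[OF live_self[OF that, of "Suc i"]] by (simp add: agree_def)
    qed
    show "agree n (r b) (r c)" if "agree n b c" for n b c
    proof -
      obtain a where "a \<in> live A b n" using live_nonempty[OF ne] by blast
      then have "agree n a (r b)" "agree n a (r c)" using r live_cong[OF that, of A] by auto
      then show ?thesis by (simp add: agree_def)
    qed
  qed
qed

section \<open>Geodesics through Cantor spaces\<close>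

theorem cantor_spaces_geodesics:
  assumes X: "X \<in> cantor_spaces" and Y: "Y \<in> cantor_spaces" and pos: "dist X Y > 0"
  shows "{\<gamma> \<in> geodesics X Y. \<gamma> ` {0..1} \<subseteq> cantor_spaces} \<approx> (UNIV :: nat set set)"
proof -
  define m n where "m = rep_gh_space X" and "n = rep_gh_space Y"
  obtain R where R: "R \<subseteq> mspace m \<times> mspace n" "fst ` R = mspace m" "snd ` R = mspace n"
    "\<forall>x\<in>R. \<forall>y\<in>R. \<bar>mdist m (fst x) (fst y) - mdist n (snd x) (snd y)\<bar> \<le> 2 * dist X Y"
    "sequentially_compact R (\<lambda>x y. max (mdist m (fst x) (fst y)) (mdist n (snd x) (snd y)))"
    unfolding m_def n_def by (rule optimal_correspondence_gh_space)
  have "fst ` R \<noteq> {}"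
    unfolding R(2) using rep_gh_space_compact[of X] by (simp add: compact_metric_def m_def)
  then obtain x0 where x0: "x0 \<in> R" by auto
  obtain f where f: "range f = mspace m" "\<forall>c. \<forall>\<epsilon>>0. \<exists>k. \<forall>b. agree k b c \<longrightarrow> mdist m (f b) (f c) < \<epsilon>"
    unfolding m_def by (rule cantor_space_parametrisation[OF X])
  obtain h where h: "range h = mspace n" "\<forall>c. \<forall>\<epsilon>>0. \<exists>k. \<forall>b. agree k b c \<longrightarrow> mdist n (h b) (h c) < \<epsilon>"
    unfolding n_def by (rule cantor_space_parametrisation[OF Y])
  \<comment> \<open>Even entries parametrise X and odd entries Y, so F maps onto the whole
    product.\<close>
  define F where "F c = (f (\<lambda>i. c (2 * i)), h (\<lambda>i. c (2 * i + 1)))" for c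
  define \<Delta> where "\<Delta> x y = max (mdist m (fst x) (fst y)) (mdist n (snd x) (snd y))" for x y
  have Fmem: "F c \<in> mspace m \<times> mspace n" for c using f(1) h(1) by (auto simp: F_def)
  have Fsurj: "\<exists>c. F c = x" if "x \<in> mspace m \<times> mspace n" for x
  proof -
    have "fst x \<in> range f" "snd x \<in> range h" using that f(1) h(1) by auto
    then obtain a b where ab: "f a = fst x" "h b = snd x" by (metis rangeE)
    have "F (\<lambda>i. if even i then a (i div 2) else b (i div 2)) = x"
      using ab by (simp add: F_def)
    then show ?thesis by blast
  qed
  have Fcont: "\<exists>k. \<forall>b. agree k b c \<longrightarrow> \<Delta> (F b) (F c) < \<epsilon>" if "\<epsilon> > 0" for c \<epsilon>
  proof -
    obtain k where k: "\<And>b. agree k b (\<lambda>i. c (2 * i)) \<Longrightarrow> mdist m (f b) (f (\<lambda>i. c (2 * i))) < \<epsilon>" using f(2) \<open>\<epsilon> > 0\<close> by blast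
    obtain k' where k': "\<And>b. agree k' b (\<lambda>i. c (2 * i + 1)) \<Longrightarrow> mdist n (h b) (h (\<lambda>i. c (2 * i + 1))) < \<epsilon>" using h(2) \<open>\<epsilon> > 0\<close> by blast
    \<comment> \<open>A prefix of length 2 (k + k') contains the first k + k' even and odd
      entries.\<close>
    have "\<Delta> (F b) (F c) < \<epsilon>" if "agree (2 * (k + k')) b c" for b
      using k[of "\<lambda>i. b (2 * i)"] k'[of "\<lambda>i. b (2 * i + 1)"] that by (auto simp: agree_def F_def \<Delta>_def)
    then show ?thesis by blast
  qed
  have \<Delta>0: "x = y" if "x \<in> mspace m \<times> mspace n" "y \<in> mspace m \<times> mspace n" "\<Delta> x y \<le> 0" for x y
  proof -
    have "mdist m (fst x) (fst y) \<le> 0" "mdist n (snd x) (snd y) \<le> 0" using that(3) by (simp_all add: \<Delta>_def)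
    then have "mdist m (fst x) (fst y) = 0" "mdist n (snd x) (snd y) = 0" by (simp_all add: order.antisym)
    then show ?thesis using that(1,2) by (auto simp: mem_Times_iff prod_eq_iff)
  qed
  \<comment> \<open>As R is compact and F continuous, A is closed and hence a retract of the binary
    sequences; F after the retraction is a continuous surjection onto R.\<close>
  define A where "A = {c. F c \<in> R}"
  have "A \<noteq> {}" using Fsurj[of x0] x0 R(1) by (auto simp: A_def)
  moreover have "c \<in> A" if c: "\<And>k. \<exists>a\<in>A. agree k a c" for c
  proof -
    obtain a where a: "\<And>k. a k \<in> A" "\<And>k. agree k (a k) c" using c by metis
    obtain x r where x: "x \<in> R" "strict_mono r" "(\<lambda>i. \<Delta> (F (a (r i))) x) \<longlonglongrightarrow> 0"
      using sequentially_compactE[OF R(5), of "\<lambda>k. F (a k)"] a(1) unfolding A_def \<Delta>_def by blast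
    have xm: "x \<in> mspace m \<times> mspace n" using x(1) R(1) by auto
    have "\<Delta> (F c) x \<le> 0 + \<epsilon>" if "\<epsilon> > 0" for \<epsilon>
    proof -
      obtain k where k: "\<And>b. agree k b c \<Longrightarrow> \<Delta> (F b) (F c) < \<epsilon> / 2" using Fcont[of "\<epsilon> / 2" c] \<open>\<epsilon> > 0\<close> by auto
      have "\<forall>\<^sub>F i in sequentially. \<Delta> (F (a (r i))) x < \<epsilon> / 2"
        by (rule order_tendstoD(2)[OF x(3)]) (use \<open>\<epsilon> > 0\<close> in simp)
      then obtain N where N: "\<And>i. i \<ge> N \<Longrightarrow> \<Delta> (F (a (r i))) x < \<epsilon> / 2" by (auto simp: eventually_sequentially)
      define i where "i = max N k"
      have "k \<le> r i" using seq_suble[OF x(2), of i] by (simp add: i_def)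
      then have "agree k (a (r i)) c" using a(2)[of "r i"] by (simp add: agree_def)
      then have 1: "\<Delta> (F (a (r i))) (F c) < \<epsilon> / 2" by (rule k)
      have 2: "\<Delta> (F (a (r i))) x < \<epsilon> / 2" by (rule N) (simp add: i_def)
      have mem: "fst (F b) \<in> mspace m" "snd (F b) \<in> mspace n" "fst x \<in> mspace m" "snd x \<in> mspace n" for b
        using Fmem[of b] xm by auto
      have "mdist m (fst (F c)) (fst x) \<le> \<epsilon>" "mdist n (snd (F c)) (snd x) \<le> \<epsilon>"
        using 1 2 mdist_triangle[OF mem(1)[of c] mem(1)[of "a (r i)"] mem(3)] mdist_triangle[OF mem(2)[of c] mem(2)[of "a (r i)"] mem(4)]
          mdist_commute[of m "fst (F c)" "fst (F (a (r i)))"] mdist_commute[of n "snd (F c)" "snd (F (a (r i)))"]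
        unfolding \<Delta>_def by linarith+
      then show ?thesis by (simp add: \<Delta>_def)
    qed
    then have "\<Delta> (F c) x \<le> 0" by (rule field_le_epsilon)
    then have "F c = x" by (rule \<Delta>0[OF Fmem xm])
    then show ?thesis using x(1) by (simp add: A_def)
  qed
  ultimately obtain r where r: "\<forall>c. r c \<in> A" "\<forall>c\<in>A. r c = c" "\<forall>k b c. agree k b c \<longrightarrow> agree k (r b) (r c)"
    using cantor_retraction[of A] by metis
  define \<phi> where "\<phi> c = F (r (\<lambda>i. c (Suc i)))" for c
  have \<phi>R: "\<phi> c \<in> R" for c using r(1) by (simp add: \<phi>_def A_def)
  have \<phi>surj: "\<exists>c. \<phi> c = x" if "x \<in> R" for x
  proof -
    obtain c where c: "F c = x" using Fsurj \<open>x \<in> R\<close> R(1) by blast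
    \<comment> \<open>Any first entry would do here, since \<phi> drops it.\<close>
    then have "\<phi> (case_nat False c) = x" using that r(2) by (simp add: \<phi>_def A_def)
    then show ?thesis by blast
  qed
  have \<phi>cont: "\<exists>k. \<forall>b. agree k b c \<longrightarrow> \<Delta> (\<phi> b) (\<phi> c) < \<epsilon>" if "\<epsilon> > 0" for c \<epsilon>
  proof -
    obtain k where k: "\<And>b. agree k b (r (\<lambda>i. c (Suc i))) \<Longrightarrow> \<Delta> (F b) (F (r (\<lambda>i. c (Suc i)))) < \<epsilon>" using Fcont \<open>\<epsilon> > 0\<close> by blast
    have "\<Delta> (\<phi> b) (\<phi> c) < \<epsilon>" if "agree (Suc k) b c" for b
    proof -
      have "agree k (\<lambda>i. b (Suc i)) (\<lambda>i. c (Suc i))" using that by (simp add: agree_def)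
      then show ?thesis unfolding \<phi>_def using k r(3) by blast
    qed
    then show ?thesis by blast
  qed
  \<comment> \<open>The first entry of \<open>c\<close> is ignored by \<open>\<phi>\<close>, so that the fibres of \<open>\<phi>\<close> have more than one point.\<close>
  define g :: "nat \<Rightarrow> real" where "g = (\<lambda>n. (1/2) ^ n)"
  \<comment> \<open>The graph of \<phi> is parametrised bijectively by binary sequences. The product
    of R with the sequences would also work as a space, but recognising it as a Cantor set would
    take Brouwer's characterisation.\<close>
  define K :: "((real \<times> real) \<times> (nat \<Rightarrow> bool) \<times> real) set" where "K = range (\<lambda>c. (\<phi> c, c, 0))"
  define o1 o2 where "o1 = (\<lambda>_ :: nat. False)" and "o2 = o1(0 := True)"
  interpret g: prefix_weight g unfolding g_def by (rule prefix_weight_geometric)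
  have base: "cantor_base g X Y (\<phi> b, b, 0) (\<phi> c, c, 0) = max (\<Delta> (\<phi> b) (\<phi> c)) (prefix_dist g b c)" for b c
    using g.prefix_dist_nonneg[of b c] by (simp add: cantor_base_def \<Delta>_def m_def n_def max_absorb1)
  have "range \<phi> = R" using \<phi>R \<phi>surj by blast
  then have fstK: "fst ` K = R" by (simp add: K_def image_image)
  interpret cantor_family g X Y K "(\<phi> o1, o1, 0)" "(\<phi> o2, o2, 0)"
  proof
    show "(\<lambda>x. fst (fst x)) ` K = gh_points X" "(\<lambda>x. snd (fst x)) ` K = gh_points Y"
      using R(2,3) unfolding m_def n_def fstK[symmetric] image_image by simp_all
    show "\<bar>gh_mdist X (fst (fst x)) (fst (fst y)) - gh_mdist Y (snd (fst x)) (snd (fst y))\<bar>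
        \<le> 2 * dist X Y" if "x \<in> K" "y \<in> K" for x y
      using R(4) fstK that by (auto simp: m_def n_def)
    show "sequentially_compact K (cantor_base g X Y)"
      unfolding sequentially_compact_def
    proof (intro allI impI)
      fix \<sigma> :: "nat \<Rightarrow> (real \<times> real) \<times> (nat \<Rightarrow> bool) \<times> real" assume "range \<sigma> \<subseteq> K"
      then have "\<sigma> i \<in> range (\<lambda>c. (\<phi> c, c, 0))" for i by (auto simp: K_def)
      then have \<sigma>: "\<sigma> i = (\<phi> (fst (snd (\<sigma> i))), fst (snd (\<sigma> i)), 0)" for i
        by (metis (no_types, lifting) rangeE fst_conv snd_conv)
      obtain c s where s: "strict_mono s" "(\<lambda>i. prefix_dist g (fst (snd (\<sigma> (s i)))) c) \<longlonglongrightarrow> 0"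
        using sequentially_compactE[OF g.sequentially_compact_prefix_dist, of "\<lambda>i. fst (snd (\<sigma> i))"] by blast
      have "(\<lambda>i. \<Delta> (\<phi> (fst (snd (\<sigma> (s i))))) (\<phi> c)) \<longlonglongrightarrow> 0"
      proof (rule order_tendstoI)
        fix e :: real assume "e < 0"
        then show "\<forall>\<^sub>F i in sequentially. e < \<Delta> (\<phi> (fst (snd (\<sigma> (s i))))) (\<phi> c)"
          by (intro always_eventually allI) (auto simp: \<Delta>_def less_max_iff_disj intro: less_le_trans)
      next
        fix e :: real assume "0 < e"
        then obtain k where k: "\<And>b. agree k b c \<Longrightarrow> \<Delta> (\<phi> b) (\<phi> c) < e" using \<phi>cont by blast
        show "\<forall>\<^sub>F i in sequentially. \<Delta> (\<phi> (fst (snd (\<sigma> (s i))))) (\<phi> c) < e"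
          using eventually_mono[OF g.tendsto_imp_agree[OF s(2), of k] k] .
      qed
      then have "(\<lambda>i. max (\<Delta> (\<phi> (fst (snd (\<sigma> (s i))))) (\<phi> c)) (prefix_dist g (fst (snd (\<sigma> (s i)))) c)) \<longlonglongrightarrow> max 0 0"
        by (intro tendsto_max s(2))
      moreover have "cantor_base g X Y (\<sigma> i) (\<phi> c, c, 0) = max (\<Delta> (\<phi> (fst (snd (\<sigma> i)))) (\<phi> c)) (prefix_dist g (fst (snd (\<sigma> i))) c)" for i
        by (subst \<sigma>) (rule base)
      ultimately have "(\<lambda>i. cantor_base g X Y (\<sigma> (s i)) (\<phi> c, c, 0)) \<longlonglongrightarrow> 0" by simp
      then show "\<exists>k\<in>K. \<exists>r. strict_mono r \<and> (\<lambda>i. cantor_base g X Y (\<sigma> (r i)) k) \<longlonglongrightarrow> 0"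
        using s(1) by (intro bexI[of _ "(\<phi> c, c, 0)"] exI[of _ s]) (auto simp: K_def)
    qed
    show "fst (\<phi> o1, o1, 0 :: real) = fst (\<phi> o2, o2, 0 :: real)"
      by (simp add: \<phi>_def o2_def)
    show "(\<phi> o1, o1, 0 :: real) \<noteq> (\<phi> o2, o2, 0)" by (auto simp: o1_def o2_def fun_eq_iff)
  qed (use pos in \<open>auto simp: K_def\<close>)
  show ?thesis
  proof (rule geodesics_eqpoll_continuum[OF X Y])
    fix l t :: real assume l: "l \<in> {0<..1}" and t: "t \<in> {0<..<1}"
    then have t': "t \<in> {0..1}" by auto
    obtain M :: "real metric" and \<psi> where M: "compact_metric M" "quotient_map_of M K (\<rho> l t) \<psi>"
      using quotient_exists[OF compact_\<rho>[OF l t']] by metis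
    define \<theta> where "\<theta> c = \<psi> (\<phi> c, c, 0)" for c
    have \<theta>range: "range \<theta> = mspace M"
      using M(2) by (simp add: \<theta>_def K_def quotient_map_of_def image_image)
    \<comment> \<open>The inverse of the parametrisation \<theta> is Lipschitz for
      \<open>prefix_dist\<close>; this gives injectivity of \<theta> and continuity of H
      below.\<close>
    have \<theta>dist: "prefix_dist g b c \<le> C l t * mdist M (\<theta> b) (\<theta> c)" for b c
    proof -
      have "prefix_dist g b c \<le> cantor_base g X Y (\<phi> b, b, 0) (\<phi> c, c, 0)" by (simp add: base)
      also have "\<dots> \<le> C l t * \<rho> l t (\<phi> b, b, 0) (\<phi> c, c, 0)"
        by (rule base_le_\<rho>[OF l t]) (auto simp: K_def)
      also have "\<rho> l t (\<phi> b, b, 0) (\<phi> c, c, 0) = mdist M (\<theta> b) (\<theta> c)"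
        using M(2) by (auto simp: quotient_map_of_def \<theta>_def K_def)
      finally show ?thesis .
    qed
    have \<theta>inj: "inj \<theta>"
    proof (rule injI, rule ccontr)
      fix b c assume "\<theta> b = \<theta> c" "b \<noteq> c"
      moreover have "\<theta> c \<in> mspace M" using \<theta>range by auto
      ultimately show False using \<theta>dist[of b c] g.prefix_dist_pos[of b c] by (simp add: mdist_self)
    qed
    \<comment> \<open>H is a continuous bijection from a compact space onto the Cantor set, which is
      Hausdorff, hence a homeomorphism.\<close>
    define H where "H y = cantor_map (inv \<theta> y)" for y
    have H: "H (\<theta> c) = cantor_map c" for c by (simp add: H_def inv_f_f[OF \<theta>inj])
    have "Lipschitz_continuous_map M euclidean_metric H"
      unfolding Lipschitz_continuous_map_def
    proof (intro conjI exI[of _ "C l t"] ballI)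
      fix x y assume "x \<in> mspace M" "y \<in> mspace M"
      then obtain b c where bc: "x = \<theta> b" "y = \<theta> c" using \<theta>range by (metis rangeE)
      have "\<bar>cantor_map b - cantor_map c\<bar> \<le> C l t * mdist M (\<theta> b) (\<theta> c)"
        using order_trans[OF cantor_map_lipschitz \<theta>dist[unfolded g_def]] .
      then show "mdist euclidean_metric (H x) (H y) \<le> C l t * mdist M x y"
        by (simp add: bc H dist_real_def)
    qed simp
    then have "continuous_map (mtopology_of M) euclidean H"
      using Lipschitz_continuous_imp_continuous_map by fastforce
    moreover have Himage: "H ` mspace M = cantor_set"
      by (simp add: \<theta>range[symmetric] image_image H cantor_set_eq)
    ultimately have "continuous_map (mtopology_of M) (top_of_set cantor_set) H"
      by (auto simp: continuous_map_in_subtopology)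
    moreover have "inj_on H (mspace M)"
      unfolding \<theta>range[symmetric] by (rule inj_onI) (auto simp: H dest: injD[OF cantor_map_inj])
    ultimately have "homeomorphic_map (mtopology_of M) (top_of_set cantor_set) H"
      using M(1) Himage
      by (intro continuous_imp_homeomorphic_map) (auto simp: compact_metric_def Hausdorff_space_subtopology)
    then have "mtopology_of M homeomorphic_space top_of_set cantor_set"
      by (rule homeomorphic_map_imp_homeomorphic_space)
    then show "gh_class K (\<rho> l t) \<in> cantor_spaces"
      unfolding cantor_spaces_def gh_spaces_with_def gh_class_eqI[OF M] using M(1) by blast
  qed
qed

theorem theorem1p6:
  fixes S :: "gh_space set"
  assumes "(\<exists>u\<in>{0, 1, 2}. \<exists>v\<in>{0, 1, 2}. \<exists>w\<in>{0, 1, 2}. S = X_set u v w)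
      \<or> (\<exists>D. dimensional_function D \<and> S = infinite_dimensional D)
      \<or> S = cantor_spaces"
  shows "\<forall>X\<in>S. \<forall>Y\<in>S. dist X Y > 0 \<longrightarrow>
      {\<gamma> \<in> geodesics X Y. \<gamma> ` {0..1} \<subseteq> S} \<approx> (UNIV :: nat set set)"
  using assms X_set_geodesics infinite_dimensional_geodesics cantor_spaces_geodesics by blast

end
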